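(* The space $H^{5}_{\mathrm{GF}}(\mathfrak{ham}_{2}^{0},\mathfrak{sp}(2,\mathbb{R}))_{10}$ is isomorphic to $\mathbb{R}$. Let $\gamma$ denote the Gel'fand-Kalinin-Fuks class, i.e. a generator of the one-dimensional real vector space $H^{7}_{\mathrm{GF}}(\mathfrak{ham}_{2},\mathfrak{sp}(2,\mathbb{R}))_{8}\cong\mathbb{R}$. Then there is a unique element $\eta\in H^{5}_{\mathrm{GF}}(\mathfrak{ham}_{2}^{0},\mathfrak{sp}(2,\mathbb{R}))_{10}$ such that $$\gamma=\eta\wedge\omega\quad\text{in } H^{7}_{\mathrm{GF}}(\mathfrak{ham}_{2},\mathfrak{sp}(2,\mathbb{R}))_{8},$$ where $\omega=z^{0}_{1}\wedge z^{1}_{1}$ is the cochain associated with the linear symplectic form of $\mathbb{R}^{2}$.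
   Context: Lie algebras. $\mathfrak{ham}_{2}$ is the Lie algebra of formal Hamiltonian vector fields on the symplectic plane $\mathbb{R}^{2}$. It is identified with the Lie algebra $\mathbb{R}[[x,y]]/\mathbb{R}$ of formal power series modulo constants, with the Poisson bracket $\{f,g\}=\frac{\partial f}{\partial x}\frac{\partial g}{\partial y}-\frac{\partial f}{\partial y}\frac{\partial g}{\partial x}$ (so $\{x,y\}=1$). Let $S_{A}$ be the space of homogeneous polynomials of degree $A$ in $x,y$; then $\{S_A,S_B\}\subset S_{A+B-2}$. $\mathfrak{ham}_{2}=\prod_{A\ge 1}S_{A}$. The subalgebra $\mathfrak{ham}_{2}^{0}=\prod_{A\ge 2}S_{A}$ consists of the formal Hamiltonian vector fields vanishing at the origin. The subalgebra $S_{2}$ is $\mathfrak{sp}(2,\mathbb{R})$. Cochains. For $A\ge1$ and $0\le a\le A$, let $z^{a}_{A}$ denote the basis of $S_{A}^{*}$ dual to the basis $\frac{x^{a}}{a!}\frac{y^{A-a}}{(A-a)!}$ of $S_{A}$. Gel'fand-Fuks (continuous) cochains of $\mathfrak{ham}_{2}$ (resp. $\mathfrak{ham}_2^0$) are the elements of the exterior algebra generated by all $z^{a}_{A}$ with $A\ge1$ (resp. $A\ge2$), with the Chevalley-Eilenberg differential (trivial real coefficients). The weight of $z^{a}_{A}$ is $A-2$, and weights add under the wedge product; the differential preserves weight. Relative cohomology. $C^{m}_{\mathrm{GF}}(\mathfrak{ham}_{2},\mathfrak{sp}(2,\mathbb{R}))_{w}$ is the space of relative $m$-cochains of weight $w$,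 i.e. those annihilated by the interior product and by the Lie derivative with respect to every element of $\mathfrak{sp}(2,\mathbb{R})=S_2$. Equivalently, it is the space of $\mathfrak{sp}(2,\mathbb{R})$-invariant elements of degree $m$ and weight $w$ in the exterior algebra on the $z^{a}_{A}$ with $A\geq 1$, $A\ne2$. Likewise $C^{m}_{\mathrm{GF}}(\mathfrak{ham}_{2}^{0},\mathfrak{sp}(2,\mathbb{R}))_{w}$ is the space of $\mathfrak{sp}(2,\mathbb{R})$-invariant elements of degree $m$ and weight $w$ in the exterior algebra on the $z^{a}_{A}$ with $A\ge3$. With the Chevalley-Eilenberg differential of the respective Lie algebra these are finite-dimensional cochain complexes for each fixed $w$. Their cohomology groups are denoted $H^{m}_{\mathrm{GF}}(\mathfrak{ham}_{2},\mathfrak{sp}(2,\mathbb{R}))_{w}$ and $H^{m}_{\mathrm{GF}}(\mathfrak{ham}_{2}^{0},\mathfrak{sp}(2,\mathbb{R}))_{w}$. The product with $\omega$. A relative cochain of $\mathfrak{ham}_2^0$, being a polynomial in the $z^a_A$ with $A\ge3$, is regarded as an element of the exterior algebra of $\mathfrak{ham}_2$ by the same expression. Wedging it with $\omega=z^{0}_{1}\wedge z^{1}_{1}$ (degree $2$, weight $-2$) is a map of complexes and induces the (Kontsevich) homomorphism $H^{m}_{\mathrm{GF}}(\mathfrak{ham}_{2}^{0},\mathfrak{sp}(2,\mathbb{R}))_{w}\to H^{m+2}_{\mathrm{GF}}(\mathfrak{ham}_{2},\mathfrak{sp}(2,\mathbb{R}))_{w-2}$, $\eta\mapsto\eta\wedge\omega$.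 By a result of Gel'fand, Kalinin and Fuks, $H^{7}_{\mathrm{GF}}(\mathfrak{ham}_{2},\mathfrak{sp}(2,\mathbb{R}))_{8}\cong\mathbb{R}$; a generator is called the Gel'fand-Kalinin-Fuks class. *)

theory Defs
  imports "HOL-Analysis.Finite_Function_Topology"
    "HOL-Computational_Algebra.Formal_Power_Series"
begin

section \<open>Formal Hamiltonian vector fields on the plane\<close>

text \<open>A series in \<open>\<real>[[x,y]]\<close> is a power series in \<open>y\<close> with coefficients in \<open>\<real>[[x]]\<close>: the
  coefficient of \<open>x\<^sup>i y\<^sup>j\<close> in \<open>f\<close> is \<open>fps_nth (fps_nth f j) i\<close>.

  The quotient by the constants is not formed. Everything below sees a series only through its
  coefficients of positive total degree (the coordinates \<open>zcoord (A, a)\<close> with \<open>A \<ge> 1\<close>) and through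
  the bracket, and the bracket with a constant vanishes.\<close>

type_synonym series = "real fps fps"

definition dx :: "series \<Rightarrow> series" where
  "dx f = Abs_fps (\<lambda>j. fps_deriv (fps_nth f j))"

definition dy :: "series \<Rightarrow> series" where
  "dy f = fps_deriv f"

definition poisson :: "series \<Rightarrow> series \<Rightarrow> series" where
  "poisson f g = dx f * dy g - dy f * dx g"

definition homogeneous :: "nat \<Rightarrow> series set" where
  "homogeneous A = {f. \<forall>i j. i + j \<noteq> A \<longrightarrow> fps_nth (fps_nth f j) i = 0}"

text \<open>The pair \<open>(A, a)\<close> stands for the generator \<open>z\<^sup>a\<^sub>A\<close>, where \<open>0 \<le> a \<le> A\<close>.\<close>

type_synonym gen = "nat \<times> nat"

definition basis_elem :: "gen \<Rightarrow> series" where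
  "basis_elem = (\<lambda>(A, a).
     fps_const (fps_const (1 / fact a) * fps_X ^ a) *
     (fps_const (fps_const (1 / fact (A - a))) * fps_X ^ (A - a)))"

text \<open>The linear form \<open>z\<^sup>a\<^sub>A\<close>, dual to the basis \<open>x\<^sup>a/a! \<cdot> y\<^sup>A\<^sup>-\<^sup>a/(A-a)!\<close>.\<close>

definition zcoord :: "gen \<Rightarrow> series \<Rightarrow> real" where
  "zcoord = (\<lambda>(A, a) f. fact a * fact (A - a) * fps_nth (fps_nth f (A - a)) a)"

text \<open>The parameter \<open>k \<ge> 1\<close> selects the Lie algebra \<open>\<Prod>\<^bsub>A \<ge> k\<^esub> S\<^sub>A\<close>, that is, the
  Hamiltonian vector fields of the plane for \<open>k = 1\<close> and those vanishing at the origin for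
  \<open>k = 2\<close>.\<close>

definition gens :: "nat \<Rightarrow> gen set" where
  "gens k = {(A, a). k \<le> A \<and> a \<le> A}"

definition gen_less :: "gen \<Rightarrow> gen \<Rightarrow> bool" where
  "gen_less = (\<lambda>(A, a) (B, b). A < B \<or> A = B \<and> a < b)"

definition gen_weight :: "gen \<Rightarrow> int" where
  "gen_weight = (\<lambda>(A, a). int A - 2)"


section \<open>The exterior algebra on the generators\<close>

text \<open>A cochain is a finite linear combination of the monomials
  \<open>z\<^bsub>p\<^sub>1\<^esub> \<and> \<dots> \<and> z\<^bsub>p\<^sub>m\<^esub>\<close> with \<open>p\<^sub>1 < \<dots> < p\<^sub>m\<close>, and such a monomial is
  indexed by the set \<open>{p\<^sub>1, \<dots>, p\<^sub>m}\<close>. (Infinite index sets, which the type admits, are excluded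
  in \<open>monomials\<close>.)\<close>

type_synonym cochain = "gen set \<Rightarrow>\<^sub>0 real"

definition zmono :: "gen set \<Rightarrow> cochain" where
  "zmono I = Poly_Mapping.single I 1"

text \<open>The sign of the permutation that sorts the concatenation of \<open>I\<close> and \<open>J\<close>.\<close>

definition shuffle_sign :: "gen set \<Rightarrow> gen set \<Rightarrow> real" where
  "shuffle_sign I J = (-1) ^ card {(p, q). p \<in> I \<and> q \<in> J \<and> gen_less q p}"

definition wedge :: "cochain \<Rightarrow> cochain \<Rightarrow> cochain" where
  "wedge u v =
     (\<Sum>I\<in>Poly_Mapping.keys u. \<Sum>J\<in>Poly_Mapping.keys v.
        if I \<inter> J = {}
        then (Poly_Mapping.lookup u I * Poly_Mapping.lookup v J * shuffle_sign I J) *\<^sub>R zmono (I \<union> J)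
        else 0)"

definition omega :: cochain where
  "omega = wedge (zmono {(1, 0)}) (zmono {(1, 1)})"

definition monomials :: "nat \<Rightarrow> nat \<Rightarrow> int \<Rightarrow> gen set set" where
  "monomials k m w =
     {I. finite I \<and> I \<subseteq> gens k \<and> card I = m \<and> (\<Sum>p\<in>I. gen_weight p) = w}"

text \<open>The graded derivation with prescribed values \<open>\<phi> p\<close> on the generators \<open>z\<^sub>p\<close>:
  \<open>z\<^bsub>p\<^sub>1\<^esub> \<and> \<dots> \<and> z\<^bsub>p\<^sub>m\<^esub>\<close> is sent to
  \<open>\<Sum>\<^sub>i (-1)\<^sup>i\<^sup>-\<^sup>1 \<phi> p\<^sub>i \<and> z\<^bsub>p\<^sub>1\<^esub> \<and> \<dots> \<and> z\<^bsub>p\<^sub>m\<^esub>\<close> with the factor \<open>z\<^bsub>p\<^sub>i\<^esub>\<close> omitted on the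
  right. If every \<open>\<phi> p\<close> has degree 0 or 2, this is the antiderivation extending \<open>\<phi>\<close>, since
  elements of even degree commute with everything; if every \<open>\<phi> p\<close> has degree 1, moving
  \<open>\<phi> p\<^sub>i\<close> back to the \<open>i\<close>-th place cancels the sign and this is the ordinary derivation
  extending \<open>\<phi>\<close>.\<close>

definition extend_derivation :: "(gen \<Rightarrow> cochain) \<Rightarrow> cochain \<Rightarrow> cochain" where
  "extend_derivation \<phi> u =
     (\<Sum>I\<in>Poly_Mapping.keys u. \<Sum>p\<in>I.
        (Poly_Mapping.lookup u I * (-1) ^ card {q \<in> I. gen_less q p}) *\<^sub>R
          wedge (\<phi> p) (zmono (I - {p})))"

definition interior :: "series \<Rightarrow> cochain \<Rightarrow> cochain" where
  "interior X = extend_derivation (\<lambda>r. zcoord r X *\<^sub>R zmono {})"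

text \<open>The linear form \<open>Y \<mapsto> z\<^sub>r {X, Y}\<close> and the bilinear form \<open>(X, Y) \<mapsto> z\<^sub>r {X, Y}\<close> on
  \<open>\<Prod>\<^bsub>B \<ge> k\<^esub> S\<^sub>B\<close> are written out in the generators. Since \<open>{S\<^sub>B, S\<^sub>C} \<subseteq> S\<^bsub>B+C-2\<^esub>\<close>
  and \<open>B, C \<ge> 1\<close>, for \<open>r = (A, a)\<close> only the generators of degree at most \<open>A + 1\<close> contribute.\<close>

definition gens_near :: "nat \<Rightarrow> gen \<Rightarrow> gen set" where
  "gens_near k r = {p \<in> gens k. fst p \<le> fst r + 1}"

text \<open>Lie derivative: \<open>(L\<^sub>X z\<^sub>r)(Y) = - z\<^sub>r {X, Y}\<close>, extended as a derivation.\<close>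

definition lie_deriv :: "nat \<Rightarrow> series \<Rightarrow> cochain \<Rightarrow> cochain" where
  "lie_deriv k X = extend_derivation (\<lambda>r.
     - (\<Sum>p\<in>gens_near k r. zcoord r (poisson X (basis_elem p)) *\<^sub>R zmono {p}))"

text \<open>Chevalley--Eilenberg differential: \<open>(d z\<^sub>r)(X, Y) = - z\<^sub>r {X, Y}\<close>, extended as an
  antiderivation.\<close>

definition ce_diff :: "nat \<Rightarrow> cochain \<Rightarrow> cochain" where
  "ce_diff k = extend_derivation (\<lambda>r.
     - (\<Sum>p\<in>gens_near k r. \<Sum>q\<in>{q \<in> gens_near k r. gen_less p q}.
          zcoord r (poisson (basis_elem p) (basis_elem q)) *\<^sub>R wedge (zmono {p}) (zmono {q})))"


section \<open>Relative cohomology\<close>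

text \<open>Cochains relative to \<open>S\<^sub>2 = \<ss>\<pp>(2,\<real>)\<close>.\<close>

definition rel_cochains :: "nat \<Rightarrow> nat \<Rightarrow> int \<Rightarrow> cochain set" where
  "rel_cochains k m w =
     {u. Poly_Mapping.keys u \<subseteq> monomials k m w \<and>
         (\<forall>X\<in>homogeneous 2. interior X u = 0 \<and> lie_deriv k X u = 0)}"

definition rel_cocycles :: "nat \<Rightarrow> nat \<Rightarrow> int \<Rightarrow> cochain set" where
  "rel_cocycles k m w = {u \<in> rel_cochains k m w. ce_diff k u = 0}"

definition rel_coboundaries :: "nat \<Rightarrow> nat \<Rightarrow> int \<Rightarrow> cochain set" where
  "rel_coboundaries k m w =
     (if m = 0 then {0} else ce_diff k ` rel_cochains k (m - 1) w)"

text \<open>The quotient \<open>Z/B\<close> of real vector spaces consists of the cosets of \<open>B\<close>. The sum of two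
  cosets is the elementwise sum; in the scalar multiple, \<open>B\<close> is added so that \<open>0\<close> times a coset
  is \<open>B\<close> rather than \<open>{0}\<close>.\<close>

definition coset :: "'v::real_vector set \<Rightarrow> 'v \<Rightarrow> 'v set" where
  "coset B u = {u + b |b. b \<in> B}"

definition quot :: "'v::real_vector set \<Rightarrow> 'v set \<Rightarrow> 'v set set" where
  "quot Z B = coset B ` Z"

definition quot_add :: "'v::real_vector set \<Rightarrow> 'v set \<Rightarrow> 'v set" where
  "quot_add X Y = {x + y |x y. x \<in> X \<and> y \<in> Y}"

definition quot_scale :: "'v::real_vector set \<Rightarrow> real \<Rightarrow> 'v set \<Rightarrow> 'v set" where
  "quot_scale B c X = {c *\<^sub>R x + b |x b. x \<in> X \<and> b \<in> B}"

definition quot_isomorphic_reals :: "'v::real_vector set \<Rightarrow> 'v set \<Rightarrow> bool" where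
  "quot_isomorphic_reals Z B \<longleftrightarrow>
     (\<exists>f :: 'v set \<Rightarrow> real. bij_betw f (quot Z B) UNIV \<and>
        (\<forall>X\<in>quot Z B. \<forall>Y\<in>quot Z B. f (quot_add X Y) = f X + f Y) \<and>
        (\<forall>c. \<forall>X\<in>quot Z B. f (quot_scale B c X) = c * f X))"

text \<open>A generator of a one-dimensional quotient: a nonzero element (the zero element of \<open>Z/B\<close>
  is \<open>B\<close>) of which every element is a multiple.\<close>

definition quot_generator :: "'v::real_vector set \<Rightarrow> 'v set \<Rightarrow> 'v set \<Rightarrow> bool" where
  "quot_generator Z B g \<longleftrightarrow>
     g \<in> quot Z B \<and> g \<noteq> B \<and> (\<forall>X\<in>quot Z B. \<exists>c. X = quot_scale B c g)"

definition cohomology :: "nat \<Rightarrow> nat \<Rightarrow> int \<Rightarrow> cochain set set" where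
  "cohomology k m w = quot (rel_cocycles k m w) (rel_coboundaries k m w)"

text \<open>The homomorphism \<open>\<eta> \<mapsto> \<eta> \<and> \<omega>\<close> from degree \<open>m\<close> and weight \<open>w\<close> for \<open>k = 2\<close> to degree
  \<open>m + 2\<close> and weight \<open>w - 2\<close> for \<open>k = 1\<close>. The value is the union of the classes of \<open>x \<and> \<omega>\<close> over
  all representatives \<open>x\<close>; it is the common class of these because wedging with \<open>\<omega>\<close> is a map of
  complexes.\<close>

definition wedge_omega :: "nat \<Rightarrow> int \<Rightarrow> cochain set \<Rightarrow> cochain set" where
  "wedge_omega m w X =
     (\<Union>x\<in>X. coset (rel_coboundaries 1 (m + 2) (w - 2)) (wedge x omega))"

end

theory Submission
  imports Defs
begin

text \<open>Why the theorem is true. Everything follows from one linear functional, the period: a combination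
of eight values of a cochain of degree 5 and weight 10, which vanishes on \<open>\<eta>\<close> as soon as
\<open>\<eta> \<and> \<omega>\<close> is the differential of a relative cochain of \<open>\<hh>\<aa>\<mm>\<^sub>2\<close> (\<open>period_of_coboundary\<close>). Two
facts are shown about relative cocycles \<open>\<eta>\<close> of \<open>\<hh>\<aa>\<mm>\<^sub>2\<^sup>0\<close> of degree 5 and weight 10: the period of
some \<open>\<eta>\<close> is not zero (\<open>exists_cocycle_with_period\<close>), and if the period of \<open>\<eta>\<close> is zero then \<open>\<eta>\<close> is
a coboundary (\<open>period_zero_imp_coboundary\<close>). Conversely \<open>dV \<and> \<omega> = d(V \<and> \<omega>)\<close>, so the period kills
coboundaries. Hence it induces an isomorphism \<open>H\<^sup>5 \<rightarrow> \<real>\<close>, and the product with \<open>\<omega>\<close> is injective on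
\<open>H\<^sup>5\<close>. If \<open>H\<^sup>7\<close> has a generator \<open>\<gamma>\<close>, then the product of a nonzero class with \<open>\<omega>\<close> is a
nonzero multiple of \<open>\<gamma>\<close>, and after rescaling it is \<open>\<gamma>\<close>.

Both facts are proved by counting unknowns and equations instead of writing cochains down. A cochain
is replaced by its values on the monomials \<open>x\<^sup>a y\<^sup>A\<^sup>-\<^sup>a\<close>, for which the structure constants are the
integers \<open>a B - b A\<close>. By the representation theory of \<open>\<ss>\<pp>(2)\<close>, a cochain of torus weight zero
killed by \<open>x\<^sup>2\<close> is invariant (\<open>rel_form_highest_weight\<close>); so in degree 5 invariance amounts to 180
equations for 192 unknowns, one for each monomial of torus weight \<open>-2\<close>. The differential of an
invariant cochain vanishes when 4 of its coordinates do (\<open>covers_6\<close>), and an invariant cocycle with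
period zero vanishes when 7 of its coordinates do (\<open>covers_5\<close>). As \<open>180 + 4 + 7 < 192\<close>, there is a
nonzero invariant cocycle with those 7 coordinates equal to zero, and its period cannot be zero.
In degree 4 there are 264 unknowns and 255 equations of invariance, and an invariant cocycle
vanishes when 2 of its coordinates do (\<open>covers_4\<close>). Given a cocycle \<open>\<eta>\<close> with period zero,
consider the unknown pair of an invariant \<open>V\<close> with those 2 coordinates equal to zero and a number
\<open>t\<close> such that 7 coordinates of \<open>dV - t \<eta>\<close> vanish. Since \<open>255 + 2 + 7 < 264 + 1\<close>, a nonzero pair
exists. Then \<open>dV = t \<eta>\<close>, and \<open>t = 0\<close> would force \<open>V = 0\<close>; so \<open>\<eta>\<close> is the differential of \<open>V / t\<close>.

That a few coordinates determine a cocycle is verified by elimination: one relation after another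
is found in which all terms but one are known to vanish. The general facts about the complex,
namely \<open>d\<^sup>2 = 0\<close> and the invariance of \<open>d\<close>, come from the Cartan calculus: the formula
\<open>i\<^sub>p d + d i\<^sub>p = L\<^sub>p\<close> allows induction on the number of arguments.\<close>

section \<open>The bracket of monomials\<close>

text \<open>\<open>{x\<^sup>a y\<^sup>A\<^sup>-\<^sup>a, x\<^sup>b y\<^sup>B\<^sup>-\<^sup>b}\<close> is the multiple \<open>a (B - b) - (A - a) b = a B - b A\<close> of the monomial
\<open>gen_bracket (A, a) (B, b)\<close>. For \<open>A = B = 1\<close> the bracket is a constant, which is zero in the Lie
algebra.\<close>

fun struct_const :: "gen \<Rightarrow> gen \<Rightarrow> int" where
  "struct_const (A, a) (B, b) = (if A + B \<le> 2 then 0 else int a * int B - int b * int A)"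

text \<open>The subtractions are truncated only where the structure constant is zero.\<close>

fun gen_bracket :: "gen \<Rightarrow> gen \<Rightarrow> gen" where
  "gen_bracket (A, a) (B, b) = (A + B - 2, a + b - 1)"

lemma gen_less_irrefl [simp]: "\<not> gen_less p p"
  by (auto simp: gen_less_def split: prod.splits)

lemma gen_less_asym: "gen_less p q \<Longrightarrow> \<not> gen_less q p"
  by (auto simp: gen_less_def split: prod.splits)

lemma gen_less_linear: "p \<noteq> q \<Longrightarrow> gen_less p q \<longleftrightarrow> \<not> gen_less q p"
  by (auto simp: gen_less_def split: prod.splits)

lemma struct_const_swap: "struct_const q p = - struct_const p q"
  by (cases p; cases q) auto

lemma gen_bracket_swap: "gen_bracket q p = gen_bracket p q"
  by (cases p; cases q) (auto simp: add.commute)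

lemma gen_bracket_assoc:
  assumes "p \<in> gens 1" "q \<in> gens 1" "r \<in> gens 1"
    "struct_const p q * struct_const (gen_bracket p q) r \<noteq> 0"
  shows "gen_bracket (gen_bracket p q) r = (fst p + fst q + fst r - 4, snd p + snd q + snd r - 2)"
proof -
  obtain A a B b C c where pqr: "p = (A, a)" "q = (B, b)" "r = (C, c)"
    by (cases p; cases q; cases r) auto
  have nz: "struct_const p q \<noteq> 0" "struct_const (gen_bracket p q) r \<noteq> 0"
    using assms(4) by auto
  have 1: "a + b \<ge> 1" using nz(1) by (auto simp: pqr split: if_splits intro: Suc_leI)
  have 2: "a + b - 1 + c \<ge> 1"
  proof (rule ccontr)
    assume "\<not> 1 \<le> a + b - 1 + c"
    then have "a + b - 1 = 0" "c = 0" by auto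
    then show False using nz(2) by (simp add: pqr split: if_splits)
  qed
  have 3: "A + B > 2" using nz(1) by (auto simp: pqr split: if_splits)
  show ?thesis using 1 2 3 by (auto simp: pqr)
qed

lemma struct_const_double:
  assumes "(A, a) \<in> gens 1" "(B, b) \<in> gens 1" "(C, c) \<in> gens 1"
  shows "struct_const (A, a) (B, b) * struct_const (gen_bracket (A, a) (B, b)) (C, c) =
    (if A + B + C \<le> 4 then 0
     else (int a * int B - int b * int A) *
       ((int a + int b - 1) * int C - int c * (int A + int B - 2)))"
proof (cases "A + B \<le> 2")
  case True
  then have "A = 1" "B = 1" "a \<le> 1" "b \<le> 1" using assms by (auto simp: gens_def)
  moreover have "a = 0 \<or> a = 1" "b = 0 \<or> b = 1" using \<open>a \<le> 1\<close> \<open>b \<le> 1\<close> by auto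
  ultimately show ?thesis by auto
next
  case False
  show ?thesis
  proof (cases "a + b = 0")
    case True
    then show ?thesis by auto
  next
    case nz: False
    have "int (a + b - 1) = int a + int b - 1" "int (A + B - 2) = int A + int B - 2"
      using nz False by (auto simp: of_nat_diff)
    then show ?thesis using False assms(3) by (auto simp: gens_def)
  qed
qed

text \<open>The three double brackets are multiples of the same monomial, so the Jacobi identity may be tested
against any function \<open>H\<close> of that monomial.\<close>

lemma jacobi:
  fixes H :: "gen \<Rightarrow> real"
  assumes "p \<in> gens 1" "q \<in> gens 1" "r \<in> gens 1"
  shows "struct_const p q * struct_const (gen_bracket p q) r * H (gen_bracket (gen_bracket p q) r) +
     struct_const q r * struct_const (gen_bracket q r) p * H (gen_bracket (gen_bracket q r) p) +
     struct_const r p * struct_const (gen_bracket r p) q * H (gen_bracket (gen_bracket r p) q) = 0"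
proof -
  obtain A a B b C c where pqr: "p = (A, a)" "q = (B, b)" "r = (C, c)"
    by (cases p; cases q; cases r) auto
  define t where "t = (fst p + fst q + fst r - 4, snd p + snd q + snd r - 2)"
  have H: "struct_const x y * struct_const (gen_bracket x y) z * H (gen_bracket (gen_bracket x y) z)
      = of_int (struct_const x y * struct_const (gen_bracket x y) z) * H t"
    if "x \<in> gens 1" "y \<in> gens 1" "z \<in> gens 1"
      "fst x + fst y + fst z = fst p + fst q + fst r" "snd x + snd y + snd z = snd p + snd q + snd r"
    for x y z
  proof (cases "struct_const x y * struct_const (gen_bracket x y) z = 0")
    case True
    then have "real_of_int (struct_const x y) * real_of_int (struct_const (gen_bracket x y) z) = 0"
      by (metis of_int_0 of_int_mult)
    then show ?thesis using True by simp
  next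
    case False
    from gen_bracket_assoc[OF that(1-3) False] show ?thesis by (simp only: that t_def of_int_mult)
  qed
  have "struct_const p q * struct_const (gen_bracket p q) r +
     struct_const q r * struct_const (gen_bracket q r) p +
     struct_const r p * struct_const (gen_bracket r p) q = 0"
    using assms unfolding pqr by (simp only: struct_const_double) (auto simp: algebra_simps)
  then have "real_of_int (struct_const p q * struct_const (gen_bracket p q) r +
     struct_const q r * struct_const (gen_bracket q r) p +
     struct_const r p * struct_const (gen_bracket r p) q) * H t = 0"
    by simp
  then show ?thesis
    using assms by (subst (1 2 3) H) (auto simp: ring_distribs)
qed

section \<open>Cartan calculus\<close>

text \<open>The sign that moves \<open>p\<close> to its place in the sorted monomial indexed by \<open>J\<close>.\<close>

definition pos_sign :: "gen \<Rightarrow> gen set \<Rightarrow> real" where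
  "pos_sign p J = (-1) ^ card {q \<in> J. gen_less q p}"

text \<open>The interior product with the monomial \<open>p\<close>, for a cochain given by its values \<open>F J\<close> on sorted
tuples of monomials. Infinite sets carry no values; setting them to zero makes the identities
below hold as equations of functions.\<close>

definition contract :: "gen \<Rightarrow> (gen set \<Rightarrow> real) \<Rightarrow> gen set \<Rightarrow> real" where
  "contract p F J = (if p \<in> J \<or> infinite J then 0 else pos_sign p J * F (insert p J))"

text \<open>The operator \<open>\<Sum>\<^sub>p z\<^sub>p \<and> G\<^sub>p\<close>. Since only \<open>p \<in> J\<close> contributes to the value at \<open>J\<close>, it makes sense for
infinitely many \<open>p\<close>.\<close>

definition assemble :: "(gen \<Rightarrow> gen set \<Rightarrow> real) \<Rightarrow> gen set \<Rightarrow> real" where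
  "assemble G J = (\<Sum>p\<in>J. pos_sign p J * G p (J - {p}))"

text \<open>The Lie derivative \<open>- \<Sum>\<^sub>q z\<^sub>q \<and> i\<^bsub>{p,q}\<^esub>\<close>.\<close>

definition lie_op :: "gen \<Rightarrow> (gen set \<Rightarrow> real) \<Rightarrow> gen set \<Rightarrow> real" where
  "lie_op p F = assemble (\<lambda>q J. - (struct_const p q * contract (gen_bracket p q) F J))"

text \<open>The Chevalley--Eilenberg differential in the form \<open>d = 1/2 \<Sum>\<^sub>p z\<^sub>p \<and> L\<^sub>p\<close>, where each pair of
arguments is counted twice.\<close>

definition diff_op :: "(gen set \<Rightarrow> real) \<Rightarrow> gen set \<Rightarrow> real" where
  "diff_op F = assemble (\<lambda>p J. lie_op p F J / 2)"

lemma pos_sign_square [simp]: "pos_sign p J * pos_sign p J = 1"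
  by (simp add: pos_sign_def flip: power_add mult_2)

lemma pos_sign_insert:
  assumes "finite J" "q \<notin> J"
  shows "pos_sign p (insert q J) = (if gen_less q p then - pos_sign p J else pos_sign p J)"
proof -
  have "{x \<in> insert q J. gen_less x p} = (if gen_less q p then insert q {x \<in> J. gen_less x p}
     else {x \<in> J. gen_less x p})" by auto
  then show ?thesis using assms by (simp add: pos_sign_def)
qed

lemma pos_sign_remove [simp]: "pos_sign p (J - {p}) = pos_sign p J"
proof -
  have "{x \<in> J - {p}. gen_less x p} = {x \<in> J. gen_less x p}" by auto
  then show ?thesis by (simp add: pos_sign_def)
qed

lemma contract_anticommute: "contract p (contract q F) J = - contract q (contract p F) J"
proof (cases "p = q \<or> p \<in> J \<or> q \<in> J \<or> infinite J")
  case True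
  then show ?thesis by (auto simp: contract_def)
next
  case False
  then show ?thesis
    using gen_less_linear[of p q]
    by (auto simp: contract_def pos_sign_insert insert_commute)
qed

lemma contract_anticommute': "contract p (contract q F) = (\<lambda>J. - contract q (contract p F) J)"
  by (rule ext) (rule contract_anticommute)

text \<open>The canonical anticommutation relation \<open>i\<^sub>p z\<^sub>q + z\<^sub>q i\<^sub>p = \<delta>\<^sub>p\<^sub>q\<close>, summed over \<open>q\<close>. The commutation relations
below rest on this one and on the anticommutation of contractions.\<close>

lemma contract_assemble:
  assumes "\<And>J. infinite J \<Longrightarrow> G p J = 0"
  shows "contract p (assemble G) J = G p J - assemble (\<lambda>q. contract p (G q)) J"
proof (cases "finite J")
  case False
  then show ?thesis using assms by (simp add: contract_def assemble_def)
next
  case fin: True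
  show ?thesis
  proof (cases "p \<in> J")
    case True
    have *: "(\<Sum>q\<in>J. pos_sign q J * contract p (G q) (J - {q})) =
        (\<Sum>q\<in>J. if q = p then G p J else 0)"
    proof (rule sum.cong[OF refl])
      fix q assume "q \<in> J"
      show "pos_sign q J * contract p (G q) (J - {q}) = (if q = p then G p J else 0)"
      proof (cases "q = p")
        case True
        then show ?thesis using fin \<open>q \<in> J\<close>
          by (simp add: contract_def insert_absorb flip: mult.assoc)
      next
        case False
        then show ?thesis using \<open>p \<in> J\<close> by (simp add: contract_def)
      qed
    qed
    show ?thesis using True fin unfolding assemble_def * by (simp add: contract_def)
  next
    case False
    have *: "pos_sign p J * (pos_sign q (insert p J) * G q (insert p J - {q})) =
       - (pos_sign q J * contract p (G q) (J - {q}))" if q: "q \<in> J" for q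
    proof -
      have pq: "p \<noteq> q" using q False by auto
      have ins: "insert p J - {q} = insert p (J - {q})" using pq by auto
      have s: "pos_sign p J = (if gen_less q p then - pos_sign p (J - {q}) else pos_sign p (J - {q}))"
        using pos_sign_insert[of "J - {q}" q p] q fin by (simp add: insert_absorb)
      show ?thesis
        using False fin pq gen_less_linear[OF pq]
        by (auto simp: contract_def ins s pos_sign_insert)
    qed
    have "contract p (assemble G) J = pos_sign p J * assemble G (insert p J)"
      using False fin by (simp add: contract_def)
    also have "assemble G (insert p J) = pos_sign p J * G p J +
        (\<Sum>q\<in>J. pos_sign q (insert p J) * G q (insert p J - {q}))"
      using False fin pos_sign_remove[of p "insert p J"]
      by (simp add: assemble_def del: pos_sign_remove)
    finally have "contract p (assemble G) J = G p J +
        (\<Sum>q\<in>J. pos_sign p J * (pos_sign q (insert p J) * G q (insert p J - {q})))"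
      by (simp add: ring_distribs sum_distrib_left flip: mult.assoc)
    then show ?thesis by (simp add: * sum_negf assemble_def)
  qed
qed

lemma contract_infinite [simp]: "infinite J \<Longrightarrow> contract p F J = 0"
  by (simp add: contract_def)

lemma assemble_infinite [simp]: "infinite J \<Longrightarrow> assemble G J = 0"
  by (simp add: assemble_def)

lemma lie_op_infinite [simp]: "infinite J \<Longrightarrow> lie_op p F J = 0"
  by (simp add: lie_op_def)

lemma diff_op_infinite [simp]: "infinite J \<Longrightarrow> diff_op F J = 0"
  by (simp add: diff_op_def)

lemma assemble_empty [simp]: "assemble G {} = 0"
  by (simp add: assemble_def)

lemma lie_op_empty [simp]: "lie_op p F {} = 0"
  by (simp add: lie_op_def)

lemma diff_op_empty [simp]: "diff_op F {} = 0"
  by (simp add: diff_op_def)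

lemma contract_lin: "contract p (\<lambda>J. a * F J + b * G J) J = a * contract p F J + b * contract p G J"
  by (simp add: contract_def algebra_simps)

lemma assemble_lin:
  "assemble (\<lambda>p J. a * F p J + b * G p J) J = a * assemble F J + b * assemble G J"
  by (simp add: assemble_def algebra_simps sum.distrib sum_distrib_left)

lemma lie_op_lin: "lie_op p (\<lambda>J. a * F J + b * G J) J = a * lie_op p F J + b * lie_op p G J"
proof -
  have "lie_op p (\<lambda>J. a * F J + b * G J) J =
    assemble (\<lambda>q J. a * - (struct_const p q * contract (gen_bracket p q) F J) +
       b * - (struct_const p q * contract (gen_bracket p q) G J)) J"
    unfolding lie_op_def by (simp add: contract_lin algebra_simps)
  then show ?thesis by (simp only: assemble_lin lie_op_def)
qed

lemma diff_op_lin: "diff_op (\<lambda>J. a * F J + b * G J) J = a * diff_op F J + b * diff_op G J"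
proof -
  have "diff_op (\<lambda>J. a * F J + b * G J) J =
    assemble (\<lambda>p J. a * (lie_op p F J / 2) + b * (lie_op p G J / 2)) J"
    unfolding diff_op_def by (simp add: lie_op_lin algebra_simps add_divide_distrib)
  then show ?thesis by (simp only: assemble_lin diff_op_def)
qed

lemma contract_lie_op:
  "contract r (lie_op p F) J =
     lie_op p (contract r F) J - struct_const p r * contract (gen_bracket p r) F J"
proof -
  have "contract r (lie_op p F) J = - (struct_const p r * contract (gen_bracket p r) F J) -
     assemble (\<lambda>q. contract r (\<lambda>J. - (struct_const p q * contract (gen_bracket p q) F J))) J"
    unfolding lie_op_def by (subst contract_assemble) auto
  also have "(\<lambda>q. contract r (\<lambda>J. - (struct_const p q * contract (gen_bracket p q) F J))) =
      (\<lambda>q J. - 1 * - (struct_const p q * contract (gen_bracket p q) (contract r F) J) + 0 * 0)"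
    using contract_lin[of r "- _" "contract _ F" 0 "\<lambda>_. 0"] contract_anticommute[of r]
    by (intro ext) simp
  also have "assemble \<dots> J = - lie_op p (contract r F) J"
    unfolding lie_op_def by (subst assemble_lin) (simp add: assemble_def)
  finally show ?thesis by simp
qed

text \<open>Contracting \<open>1/2 \<Sum>\<^sub>p z\<^sub>p \<and> L\<^sub>p F\<close> with \<open>r\<close> gives half of \<open>L\<^sub>r F\<close> from \<open>p = r\<close>; the other half
comes from the commutators \<open>[i\<^sub>r, L\<^sub>p] = - i\<^bsub>{p,r}\<^esub>\<close>.\<close>

theorem cartan_formula: "contract r (diff_op F) J = lie_op r F J - diff_op (contract r F) J"
proof -
  have 1: "contract r (diff_op F) J =
      lie_op r F J / 2 - assemble (\<lambda>p. contract r (\<lambda>J. lie_op p F J / 2)) J"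
    unfolding diff_op_def by (subst contract_assemble) auto
  have 2: "(\<lambda>p. contract r (\<lambda>J. lie_op p F J / 2)) =
    (\<lambda>p J. 1 * (lie_op p (contract r F) J / 2) +
       - (1/2) * - (struct_const r p * contract (gen_bracket r p) F J))"
  proof (intro ext)
    fix p J
    have "contract r (\<lambda>J. lie_op p F J / 2) J = contract r (lie_op p F) J / 2"
      by (simp add: contract_def)
    then show "contract r (\<lambda>J. lie_op p F J / 2) J = 1 * (lie_op p (contract r F) J / 2) +
       - (1/2) * - (struct_const r p * contract (gen_bracket r p) F J)"
      using struct_const_swap[of p r] gen_bracket_swap[of p r]
      by (simp add: contract_lie_op diff_divide_distrib)
  qed
  show ?thesis unfolding 1 2 assemble_lin by (simp add: diff_op_def lie_op_def)
qed

text \<open>The basis of the inductions below: away from the empty set a function is determined by its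
contractions.\<close>

lemma nonempty_via_contract:
  assumes "finite J" "r \<in> J"
  shows "F J = pos_sign r J * contract r F (J - {r})"
  using assms by (simp add: contract_def insert_absorb flip: mult.assoc)

text \<open>Contracting the difference of the two sides with \<open>r\<close> gives the same difference for \<open>i\<^sub>r F\<close>, plus
terms that cancel by the Jacobi identity.\<close>

lemma lie_op_bracket:
  assumes "finite J" "J \<subseteq> gens 1" "p \<in> gens 1" "q \<in> gens 1"
  shows "lie_op p (lie_op q F) J - lie_op q (lie_op p F) J =
    struct_const p q * lie_op (gen_bracket p q) F J"
  using assms(1,2)
proof (induction J arbitrary: F rule: finite_psubset_induct)
  case (psubset J)
  show ?case
  proof (cases "J = {}")
    case True
    then show ?thesis by simp
  next
    case False
    then obtain r where r: "r \<in> J" by auto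
    let ?K = "J - {r}" and ?c = "\<lambda>x y. real_of_int (struct_const x y)"
    have IH: "lie_op p (lie_op q (contract r F)) ?K - lie_op q (lie_op p (contract r F)) ?K =
        ?c p q * lie_op (gen_bracket p q) (contract r F) ?K"
      using psubset r by blast
    have exp2: "contract r (lie_op x (lie_op y F)) K = lie_op x (lie_op y (contract r F)) K
        - ?c y r * lie_op x (contract (gen_bracket y r) F) K
        - ?c x r * lie_op y (contract (gen_bracket x r) F) K
        + ?c x r * ?c y (gen_bracket x r) * contract (gen_bracket y (gen_bracket x r)) F K" for x y K
    proof -
      have "contract r (lie_op x (lie_op y F)) K = lie_op x (contract r (lie_op y F)) K
         - ?c x r * contract (gen_bracket x r) (lie_op y F) K"
        by (rule contract_lie_op)
      also have "contract r (lie_op y F) = (\<lambda>J. 1 * lie_op y (contract r F) J +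
           - ?c y r * contract (gen_bracket y r) F J)"
        by (intro ext) (simp add: contract_lie_op)
      also have "lie_op x \<dots> K = lie_op x (lie_op y (contract r F)) K
         - ?c y r * lie_op x (contract (gen_bracket y r) F) K"
        by (subst lie_op_lin) simp
      also have "contract (gen_bracket x r) (lie_op y F) K = lie_op y (contract (gen_bracket x r) F) K
         - ?c y (gen_bracket x r) * contract (gen_bracket y (gen_bracket x r)) F K"
        by (rule contract_lie_op)
      finally show ?thesis by (simp add: algebra_simps)
    qed
    have rg: "r \<in> gens 1" using r psubset.prems by auto
    have jac: "?c p q * ?c (gen_bracket p q) r * contract (gen_bracket (gen_bracket p q) r) F ?K
      + ?c p r * ?c q (gen_bracket p r) * contract (gen_bracket q (gen_bracket p r)) F ?K
      - ?c q r * ?c p (gen_bracket q r) * contract (gen_bracket p (gen_bracket q r)) F ?K = 0"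
      using jacobi[OF assms(3,4) rg, of "\<lambda>x. contract x F ?K"]
        struct_const_swap[of p "gen_bracket q r"] struct_const_swap[of q "gen_bracket p r"]
        struct_const_swap[of r p] gen_bracket_swap[of p "gen_bracket q r"]
        gen_bracket_swap[of q "gen_bracket p r"] gen_bracket_swap[of r p]
      by (simp add: algebra_simps)
    define E where "E = (\<lambda>J. lie_op p (lie_op q F) J - lie_op q (lie_op p F) J
       - ?c p q * lie_op (gen_bracket p q) F J)"
    have "contract r E ?K = contract r (lie_op p (lie_op q F)) ?K - contract r (lie_op q (lie_op p F)) ?K
       - ?c p q * contract r (lie_op (gen_bracket p q) F) ?K"
      by (simp add: E_def contract_def algebra_simps)
    also have "\<dots> = 0"
      unfolding exp2[of p q] exp2[of q p] contract_lie_op[of r "gen_bracket p q" F]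
      using IH jac by (simp add: algebra_simps)
    finally have "E J = 0" using nonempty_via_contract[of J r E] r psubset.hyps by simp
    then show ?thesis by (simp add: E_def)
  qed
qed

text \<open>Contraction with \<open>r\<close> turns the commutator \<open>[L\<^sub>p, d]\<close> into its negative on \<open>i\<^sub>r F\<close>, up to
\<open>[L\<^sub>p, L\<^sub>r] - L\<^bsub>{p,r}\<^esub> = 0\<close>.\<close>

theorem lie_op_diff_op:
  assumes "finite J" "J \<subseteq> gens 1" "p \<in> gens 1"
  shows "lie_op p (diff_op F) J = diff_op (lie_op p F) J"
  using assms(1,2)
proof (induction J arbitrary: F rule: finite_psubset_induct)
  case (psubset J)
  show ?case
  proof (cases "J = {}")
    case True
    then show ?thesis by simp
  next
    case False
    then obtain r where r: "r \<in> J" by auto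
    let ?K = "J - {r}" and ?c = "\<lambda>x y. real_of_int (struct_const x y)"
    have IH: "lie_op p (diff_op (contract r F)) ?K = diff_op (lie_op p (contract r F)) ?K"
      using psubset r by blast
    have br: "lie_op p (lie_op r F) ?K - lie_op r (lie_op p F) ?K = ?c p r * lie_op (gen_bracket p r) F ?K"
      using lie_op_bracket[of ?K p r F] psubset r assms by auto
    have "contract r (lie_op p (diff_op F)) ?K = lie_op p (contract r (diff_op F)) ?K
        - ?c p r * contract (gen_bracket p r) (diff_op F) ?K"
      by (rule contract_lie_op)
    also have "contract r (diff_op F) = (\<lambda>J. 1 * lie_op r F J + - 1 * diff_op (contract r F) J)"
      by (intro ext) (simp add: cartan_formula)
    also have "lie_op p \<dots> ?K = lie_op p (lie_op r F) ?K - lie_op p (diff_op (contract r F)) ?K"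
      by (subst lie_op_lin) simp
    finally have 1: "contract r (lie_op p (diff_op F)) ?K = lie_op p (lie_op r F) ?K
       - lie_op p (diff_op (contract r F)) ?K
       - ?c p r * (lie_op (gen_bracket p r) F ?K - diff_op (contract (gen_bracket p r) F) ?K)"
      by (simp add: cartan_formula)
    have "contract r (diff_op (lie_op p F)) ?K = lie_op r (lie_op p F) ?K - diff_op (contract r (lie_op p F)) ?K"
      by (rule cartan_formula)
    also have "contract r (lie_op p F) = (\<lambda>J. 1 * lie_op p (contract r F) J +
        - ?c p r * contract (gen_bracket p r) F J)"
      by (intro ext) (simp add: contract_lie_op)
    also have "diff_op \<dots> ?K = diff_op (lie_op p (contract r F)) ?K
        - ?c p r * diff_op (contract (gen_bracket p r) F) ?K"
      by (subst diff_op_lin) simp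
    finally have "contract r (lie_op p (diff_op F)) ?K = contract r (diff_op (lie_op p F)) ?K"
      using 1 IH br by (simp add: algebra_simps)
    then show ?thesis
      using nonempty_via_contract[of J r "lie_op p (diff_op F)"]
        nonempty_via_contract[of J r "diff_op (lie_op p F)"] r psubset.hyps by simp
  qed
qed

text \<open>By the Cartan formula \<open>i\<^sub>r d d = [L\<^sub>r, d] + d d i\<^sub>r\<close>.\<close>

theorem diff_op_diff_op:
  assumes "finite J" "J \<subseteq> gens 1"
  shows "diff_op (diff_op F) J = 0"
  using assms
proof (induction J arbitrary: F rule: finite_psubset_induct)
  case (psubset J)
  show ?case
  proof (cases "J = {}")
    case True
    then show ?thesis by simp
  next
    case False
    then obtain r where r: "r \<in> J" by auto
    let ?K = "J - {r}"
    have IH: "diff_op (diff_op (contract r F)) ?K = 0"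
      using psubset r by blast
    have lie: "lie_op r (diff_op F) ?K = diff_op (lie_op r F) ?K"
      using lie_op_diff_op[of ?K r F] psubset r by auto
    have "contract r (diff_op (diff_op F)) ?K = lie_op r (diff_op F) ?K - diff_op (contract r (diff_op F)) ?K"
      by (rule cartan_formula)
    also have "contract r (diff_op F) = (\<lambda>J. 1 * lie_op r F J + - 1 * diff_op (contract r F) J)"
      by (intro ext) (simp add: cartan_formula)
    also have "diff_op \<dots> ?K = diff_op (lie_op r F) ?K - diff_op (diff_op (contract r F)) ?K"
      by (subst diff_op_lin) simp
    finally have "contract r (diff_op (diff_op F)) ?K = 0"
      using IH lie by simp
    then show ?thesis
      using nonempty_via_contract[of J r "diff_op (diff_op F)"] r psubset.hyps by simp
  qed
qed

section \<open>Coefficients of the Poisson bracket\<close>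

text \<open>The factor between the monomial \<open>x\<^sup>a y\<^sup>A\<^sup>-\<^sup>a\<close> and the basis element \<open>basis_elem (A, a)\<close>.\<close>

fun gen_norm :: "gen \<Rightarrow> real" where
  "gen_norm (A, a) = fact a * fact (A - a)"

lemma gen_norm_pos [simp]: "gen_norm p > 0" "gen_norm p \<noteq> 0"
  by (cases p; simp)+

definition monom_xy :: "nat \<Rightarrow> nat \<Rightarrow> series" where
  "monom_xy i j = fps_const (fps_X ^ i) * fps_X ^ j"

definition const_xy :: "real \<Rightarrow> series" where
  "const_xy c = fps_const (fps_const c)"

lemma nth_monom_xy: "fps_nth (fps_nth (monom_xy i j) j') i' = (if i' = i \<and> j' = j then 1 else 0)"
  by (simp add: monom_xy_def fps_X_power_nth)

lemma nth_const_xy: "fps_nth (fps_nth (const_xy c * f) j) i = c * fps_nth (fps_nth f j) i"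
  by (simp add: const_xy_def)

lemma series_eqI: "(\<And>i j. fps_nth (fps_nth f j) i = fps_nth (fps_nth g j) i) \<Longrightarrow> f = (g :: series)"
  by (simp add: fps_eq_iff)

lemma basis_elem_eq: "basis_elem (A, a) = const_xy (1 / gen_norm (A, a)) * monom_xy a (A - a)"
proof -
  have "const_xy (1 / gen_norm (A, a)) =
      fps_const (fps_const (1 / fact a)) * fps_const (fps_const (1 / fact (A - a)))"
    by (simp add: const_xy_def)
  moreover have "basis_elem (A, a) = fps_const (fps_const (1 / fact a)) * fps_const (fps_X ^ a) *
      (fps_const (fps_const (1 / fact (A - a))) * fps_X ^ (A - a))"
    by (simp only: basis_elem_def prod.case fps_const_mult)
  ultimately show ?thesis by (simp only: monom_xy_def mult_ac)
qed

lemma const_xy_mult: "const_xy c * f * (const_xy d * g) = const_xy (c * d) * (f * g)"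
proof -
  have "const_xy (c * d) = const_xy c * const_xy d" by (simp add: const_xy_def)
  then show ?thesis by (simp only: mult_ac)
qed

lemma monom_xy_mult: "monom_xy i j * monom_xy k l = monom_xy (i + k) (j + l)"
  by (simp add: monom_xy_def power_add algebra_simps flip: fps_const_mult)

lemma dx_monom_xy: "dx (monom_xy i j) = const_xy (real i) * monom_xy (i - 1) j"
  by (rule series_eqI) (auto simp: dx_def nth_monom_xy nth_const_xy)

lemma dy_monom_xy: "dy (monom_xy i j) = const_xy (real j) * monom_xy i (j - 1)"
  by (rule series_eqI) (auto simp: dy_def nth_monom_xy nth_const_xy fps_of_nat[symmetric] simp del: fps_of_nat)

lemma dx_add: "dx (f + g) = dx f + dx g" and dy_add: "dy (f + g) = dy f + dy g"
  by (simp_all add: dx_def dy_def fps_eq_iff)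

lemma dx_const: "dx (const_xy c * f) = const_xy c * dx f" and dy_const: "dy (const_xy c * f) = const_xy c * dy f"
  by (simp_all add: dx_def dy_def const_xy_def fps_eq_iff)

lemma poisson_scale: "poisson (const_xy c * f) (const_xy d * g) = const_xy (c * d) * poisson f g"
  by (simp only: poisson_def dx_const dy_const const_xy_mult right_diff_distrib)

lemma poisson_add_left: "poisson (f + g) h = poisson f h + poisson g h"
  by (simp add: poisson_def dx_add dy_add algebra_simps)

lemma zcoord_const: "zcoord r (const_xy c * f) = c * zcoord r f"
  by (cases r) (simp add: zcoord_def nth_const_xy)

lemma zcoord_add: "zcoord r (f + g) = zcoord r f + zcoord r g"
  by (cases r) (simp add: zcoord_def algebra_simps)

lemma zcoord_poisson_monom_xy:
  assumes "(A, a) \<in> gens 1" "(B, b) \<in> gens 1" "r \<in> gens 1"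
  shows "zcoord r (poisson (monom_xy a (A - a)) (monom_xy b (B - b))) =
    (if r = gen_bracket (A, a) (B, b) then gen_norm r * struct_const (A, a) (B, b) else 0)"
proof -
  obtain C c where r: "r = (C, c)" by (cases r)
  define i j where "i = A - a" and "j = B - b"
  have A: "A = a + i" and B: "B = b + j" using assms by (auto simp: i_def j_def gens_def)
  define l where "l = C - c"
  have C: "C = c + l" using assms by (auto simp: r l_def gens_def)
  have p: "poisson (monom_xy a i) (monom_xy b j) =
     const_xy (real a * real j) * monom_xy (a - 1 + b) (i + (j - 1)) -
     const_xy (real i * real b) * monom_xy (a + (b - 1)) (i - 1 + j)"
    by (simp only: poisson_def dx_monom_xy dy_monom_xy const_xy_mult monom_xy_mult)
  have z: "zcoord r f = gen_norm r * fps_nth (fps_nth f l) c" for f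
    by (simp add: r zcoord_def l_def)
  have n: "fps_nth (fps_nth (poisson (monom_xy a i) (monom_xy b j)) l) c =
     (if c = a - 1 + b \<and> l = i + (j - 1) then real a * real j else 0) -
     (if c = a + (b - 1) \<and> l = i - 1 + j then real i * real b else 0)"
    unfolding p fps_sub_nth nth_const_xy nth_monom_xy by simp
  have "\<dots> = (if r = gen_bracket (A, a) (B, b) then real_of_int (struct_const (A, a) (B, b)) else 0)"
  proof (cases "A + B \<le> 2")
    case True
    then have "A = 1" "B = 1" "C \<ge> 1" using assms by (auto simp: gens_def r)
    then show ?thesis unfolding r A B C
      by (cases a; cases b; cases i; cases j) auto
  next
    case False
    have eqv: "(r = gen_bracket (A, a) (B, b)) = (c = a + b - 1 \<and> c + l = a + i + b + j - 2)"
      by (auto simp: r A B C)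
    have sc: "real_of_int (struct_const (A, a) (B, b)) = real a * real j - real i * real b"
      using False by (simp add: A B algebra_simps)
    show ?thesis
      unfolding eqv sc using False unfolding A B
      by (cases a; cases b; cases i; cases j) auto
  qed
  then show ?thesis by (simp add: z n flip: i_def j_def)
qed

lemma zcoord_poisson_basis:
  assumes "p \<in> gens 1" "q \<in> gens 1" "r \<in> gens 1"
  shows "zcoord r (poisson (basis_elem p) (basis_elem q)) =
    (if r = gen_bracket p q then gen_norm r * struct_const p q / (gen_norm p * gen_norm q) else 0)"
proof -
  obtain A a B b where pq: "p = (A, a)" "q = (B, b)" by (cases p; cases q) auto
  show ?thesis
    using zcoord_poisson_monom_xy[of A a B b r] assms unfolding pq basis_elem_eq poisson_scale zcoord_const
    by (auto simp: field_simps)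
qed

definition quad_coeff :: "series \<Rightarrow> nat \<Rightarrow> real" where
  "quad_coeff X i = fps_nth (fps_nth X (2 - i)) i"

text \<open>An element of \<open>S\<^sub>2\<close> is a combination of \<open>y\<^sup>2\<close>, \<open>x y\<close> and \<open>x\<^sup>2\<close>; this reduces invariance to
three operators.\<close>

lemma homogeneous_2_eq:
  assumes "X \<in> homogeneous 2"
  shows "X = const_xy (quad_coeff X 0) * monom_xy 0 2 + const_xy (quad_coeff X 1) * monom_xy 1 1 +
    const_xy (quad_coeff X 2) * monom_xy 2 0"
proof (rule series_eqI)
  fix i j
  show "fps_nth (fps_nth X j) i = fps_nth (fps_nth (const_xy (quad_coeff X 0) * monom_xy 0 2 +
    const_xy (quad_coeff X 1) * monom_xy 1 1 + const_xy (quad_coeff X 2) * monom_xy 2 0) j) i"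
  proof (cases "i + j = 2")
    case True
    then have "i = 0 \<and> j = 2 \<or> i = 1 \<and> j = 1 \<or> i = 2 \<and> j = 0" by auto
    then show ?thesis by (auto simp: fps_add_nth nth_const_xy nth_monom_xy quad_coeff_def)
  next
    case False
    then have "fps_nth (fps_nth X j) i = 0" using assms by (auto simp: homogeneous_def)
    moreover have "\<not> (i = 0 \<and> j = 2)" "\<not> (i = 1 \<and> j = 1)" "\<not> (i = 2 \<and> j = 0)" using False by auto
    ultimately show ?thesis by (auto simp: nth_const_xy nth_monom_xy)
  qed
qed

lemma zcoord_poisson_quadratic:
  assumes "X \<in> homogeneous 2" "q \<in> gens 1" "r \<in> gens 1"
  shows "zcoord r (poisson X (basis_elem q)) =
    (\<Sum>i\<le>2. quad_coeff X i * (if r = gen_bracket (2, i) q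
       then gen_norm r * struct_const (2, i) q / gen_norm q else 0))"
proof -
  obtain B b where q: "q = (B, b)" by (cases q)
  have g: "(2, 0) \<in> gens 1" "(2, 1) \<in> gens 1" "(2, 2) \<in> gens 1" by (auto simp: gens_def)
  have z: "zcoord r (poisson (const_xy c * monom_xy i (2 - i)) (basis_elem q)) =
      c * (if r = gen_bracket (2, i) q then gen_norm r * struct_const (2, i) q / gen_norm q else 0)"
    if "(2, i) \<in> gens 1" for c i
    using zcoord_poisson_monom_xy[OF that, of B b r] assms(2,3)
    unfolding q basis_elem_eq poisson_scale zcoord_const by auto
  have "zcoord r (poisson X (basis_elem q)) =
      zcoord r (poisson (const_xy (quad_coeff X 0) * monom_xy 0 (2 - 0)) (basis_elem q)) +
      zcoord r (poisson (const_xy (quad_coeff X 1) * monom_xy 1 (2 - 1)) (basis_elem q)) +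
      zcoord r (poisson (const_xy (quad_coeff X 2) * monom_xy 2 (2 - 2)) (basis_elem q))"
    by (subst homogeneous_2_eq[OF assms(1)]) (simp add: poisson_add_left zcoord_add)
  also have "\<dots> = (\<Sum>i\<in>{0, 1, 2}. quad_coeff X i * (if r = gen_bracket (2, i) q
       then gen_norm r * struct_const (2, i) q / gen_norm q else 0))"
    unfolding z[OF g(1)] z[OF g(2)] z[OF g(3)] by simp
  also have "{0, 1, 2} = {..(2::nat)}" by auto
  finally show ?thesis .
qed

section \<open>Cochains as functions of monomials\<close>

abbreviation "lk \<equiv> Poly_Mapping.lookup"

abbreviation "supp \<equiv> Poly_Mapping.keys"

lemma lookup_scaleR: "lk (c *\<^sub>R u) J = c * lk u J"
proof -
  have "finite {i. c *\<^sub>R lk u i \<noteq> 0}"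
    by (rule finite_subset[OF _ finite_keys[of u]]) (auto simp: in_keys_iff)
  then show ?thesis by (simp add: scaleR_poly_mapping_def)
qed

lemma lookup_zmono: "lk (zmono I) J = (if I = J then 1 else 0)"
  by (simp add: zmono_def lookup_single when_def)

lemma lookup_wedge_zmono:
  assumes "finite S" "supp u \<subseteq> S"
  shows "lk (wedge u (zmono M)) J =
    (\<Sum>I\<in>S. if I \<inter> M = {} \<and> I \<union> M = J then lk u I * shuffle_sign I M else 0)"
proof -
  have M: "supp (zmono M) = {M}" by (simp add: zmono_def)
  have "lk (wedge u (zmono M)) J = (\<Sum>I\<in>supp u.
      lk (if I \<inter> M = {} then (lk u I * 1 * shuffle_sign I M) *\<^sub>R zmono (I \<union> M) else 0) J)"
    unfolding wedge_def M lookup_sum by (simp add: lookup_zmono cong: if_cong)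
  also have "\<dots> = (\<Sum>I\<in>supp u.
      if I \<inter> M = {} \<and> I \<union> M = J then lk u I * shuffle_sign I M else 0)"
    by (intro sum.cong) (auto simp: lookup_scaleR lookup_zmono)
  also have "\<dots> = (\<Sum>I\<in>S. if I \<inter> M = {} \<and> I \<union> M = J then lk u I * shuffle_sign I M else 0)"
    using assms by (intro sum.mono_neutral_left) (auto simp: in_keys_iff)
  finally show ?thesis .
qed

lemma lookup_wedge_add:
  "lk (wedge (u + v) (zmono M)) J = lk (wedge u (zmono M)) J + lk (wedge v (zmono M)) J"
proof -
  let ?S = "supp u \<union> supp v"
  have "supp (u + v) \<subseteq> ?S" by (rule keys_add)
  then show ?thesis
    by (subst (1 2 3) lookup_wedge_zmono[where S = ?S])
       (auto simp: lookup_add algebra_simps simp flip: sum.distrib intro!: sum.cong)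
qed

lemma lookup_wedge_scaleR:
  "lk (wedge (c *\<^sub>R u) (zmono M)) J = c * lk (wedge u (zmono M)) J"
proof -
  have "supp (c *\<^sub>R u) \<subseteq> supp u" by (auto simp: in_keys_iff lookup_scaleR)
  then show ?thesis
    by (subst (1 2) lookup_wedge_zmono[where S = "supp u"])
       (auto simp: lookup_scaleR sum_distrib_left intro!: sum.cong)
qed

lemma lookup_wedge_uminus: "lk (wedge (- u) (zmono M)) J = - lk (wedge u (zmono M)) J"
  using lookup_wedge_scaleR[of "-1" u M J] by simp

lemma lookup_wedge_sum:
  "lk (wedge (\<Sum>x\<in>N. v x) (zmono M)) J = (\<Sum>x\<in>N. lk (wedge (v x) (zmono M)) J)"
proof (induction N rule: infinite_finite_induct)
  case empty
  then show ?case by (simp add: wedge_def)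
next
  case (infinite A)
  then show ?case by (simp add: wedge_def)
qed (simp add: lookup_wedge_add)

lemma shuffle_sign_single: "shuffle_sign {p} M = pos_sign p M"
proof -
  have "{(x, q). x \<in> {p} \<and> q \<in> M \<and> gen_less q x} = Pair p ` {q \<in> M. gen_less q p}" by auto
  then show ?thesis by (simp add: shuffle_sign_def pos_sign_def card_image inj_on_def)
qed

lemma shuffle_sign_pair:
  assumes "p \<noteq> q" "finite M"
  shows "shuffle_sign {p, q} M = pos_sign p M * pos_sign q M"
proof -
  have "{(x, y). x \<in> {p, q} \<and> y \<in> M \<and> gen_less y x} =
      Pair p ` {y \<in> M. gen_less y p} \<union> Pair q ` {y \<in> M. gen_less y q}" by auto
  moreover have "Pair p ` {y \<in> M. gen_less y p} \<inter> Pair q ` {y \<in> M. gen_less y q} = {}"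
    using assms by auto
  ultimately show ?thesis using assms
    by (simp add: shuffle_sign_def pos_sign_def card_image inj_on_def card_Un_disjoint power_add)
qed

lemma wedge_zmono_zmono:
  "wedge (zmono I) (zmono J) = (if I \<inter> J = {} then shuffle_sign I J *\<^sub>R zmono (I \<union> J) else 0)"
  by (simp add: wedge_def zmono_def)

lemma wedge_two_gens:
  assumes "gen_less p q"
  shows "wedge (zmono {p}) (zmono {q}) = zmono {p, q}"
proof -
  have "p \<noteq> q" "\<not> gen_less q p" using assms gen_less_asym by auto
  moreover from this have "{x \<in> {q}. gen_less x p} = {}" by auto
  then have "pos_sign p {q} = 1" by (simp only: pos_sign_def card.empty power_0)
  ultimately show ?thesis
    by (simp add: wedge_zmono_zmono shuffle_sign_single insert_commute)
qed

lemma lookup_extend_derivation: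
  "lk (extend_derivation \<phi> u) J = (\<Sum>I\<in>supp u. \<Sum>p\<in>I.
     lk u I * pos_sign p I * lk (wedge (\<phi> p) (zmono (I - {p}))) J)"
  by (simp add: extend_derivation_def lookup_sum lookup_scaleR pos_sign_def)

definition gen_scale :: "gen set \<Rightarrow> real" where
  "gen_scale J = prod gen_norm J"

text \<open>The values of a cochain on sets of monomials \<open>x\<^sup>a y\<^sup>A\<^sup>-\<^sup>a\<close>. In these coordinates the structure
constants are integers without factorials.\<close>

definition vals :: "cochain \<Rightarrow> gen set \<Rightarrow> real" where
  "vals u J = gen_scale J * lk u J"

lemma gen_scale_nonzero [simp]: "gen_scale J \<noteq> 0"
  by (cases "finite J") (auto simp: gen_scale_def)

lemma gen_scale_insert: "finite J \<Longrightarrow> p \<notin> J \<Longrightarrow> gen_scale (insert p J) = gen_norm p * gen_scale J"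
  by (simp add: gen_scale_def)

lemma finite_gens_near [simp]: "finite (gens_near k r)"
proof (rule finite_subset)
  show "gens_near k r \<subseteq> (SIGMA A:{..fst r + 1}. {..A})" by (auto simp: gens_near_def gens_def)
qed auto

text \<open>The monomials \<open>I\<close> and \<open>J\<close> differ by replacing \<open>p\<close> with \<open>q\<close>; the condition can be read from
either side. This is what turns the sum over the terms of \<open>L\<^sub>X z\<^sub>I\<close> into the sum that defines
\<open>lie_op\<close> at \<open>J\<close>.\<close>

lemma exchange_iff:
  assumes "p \<in> I" "q \<in> J"
  shows "q \<notin> I - {p} \<and> insert q (I - {p}) = J \<longleftrightarrow> p \<notin> J - {q} \<and> insert p (J - {q}) = I"
  using assms by blast

lemma vals_as_sum:
  "vals u K = (\<Sum>I\<in>supp u. if I = K then gen_scale K * lk u I else 0)"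
  by (simp add: vals_def in_keys_iff)

lemma contract_vals:
  assumes "\<And>I. I \<in> supp u \<Longrightarrow> finite I" "finite K"
  shows "contract b (vals u) K = (\<Sum>I\<in>supp u. \<Sum>p\<in>I.
    if p = b \<and> p \<notin> K \<and> insert p K = I then lk u I * (pos_sign p K * gen_scale I) else 0)"
proof -
  have "(\<Sum>p\<in>I. if p = b \<and> p \<notin> K \<and> insert p K = I then lk u I * (pos_sign p K * gen_scale I) else 0) =
     (if b \<in> K then 0 else pos_sign b K * (if I = insert b K then gen_scale (insert b K) * lk u I else 0))"
    if I: "I \<in> supp u" for I
  proof (cases "b \<notin> K \<and> insert b K = I")
    case True
    then have "(\<Sum>p\<in>I. if p = b \<and> p \<notin> K \<and> insert p K = I then lk u I * (pos_sign p K * gen_scale I) else 0)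
      = (\<Sum>p\<in>I. if p = b then lk u I * (pos_sign b K * gen_scale I) else 0)"
      by (intro sum.cong) auto
    then show ?thesis using True assms(1)[OF I] by auto
  next
    case False
    then have "(\<Sum>p\<in>I. if p = b \<and> p \<notin> K \<and> insert p K = I then lk u I * (pos_sign p K * gen_scale I) else 0)
      = (\<Sum>p\<in>I. 0)" by (intro sum.cong) auto
    then show ?thesis using False by auto
  qed
  then have "(\<Sum>I\<in>supp u. \<Sum>p\<in>I.
    if p = b \<and> p \<notin> K \<and> insert p K = I then lk u I * (pos_sign p K * gen_scale I) else 0) =
    (\<Sum>I\<in>supp u. if b \<in> K then 0
      else pos_sign b K * (if I = insert b K then gen_scale (insert b K) * lk u I else 0))"
    by (intro sum.cong) auto
  also have "\<dots> = contract b (vals u) K"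
    using assms(2) unfolding contract_def vals_as_sum by (simp add: sum_distrib_left if_distrib[of "(*) _"] cong: if_cong)
  finally show ?thesis by simp
qed

text \<open>The definition expands the image of each monomial \<open>z\<^sub>I\<close>; \<open>lie_op\<close> collects the contributions to
one value at \<open>J\<close>. Both are sums over the triples \<open>I\<close>, \<open>p \<in> I\<close>, \<open>q \<in> J\<close> with \<open>J\<close> obtained from
\<open>I\<close> by replacing \<open>p\<close> with \<open>q\<close>.\<close>

theorem vals_lie_deriv:
  assumes "k \<ge> 1" "X \<in> homogeneous 2" "finite J" "J \<subseteq> gens k"
    and u: "\<And>I. I \<in> supp u \<Longrightarrow> finite I \<and> I \<subseteq> gens k"
  shows "vals (lie_deriv k X u) J = (\<Sum>i\<le>2. quad_coeff X i * lie_op (2, i) (vals u) J)"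
proof -
  have g1: "gens k \<subseteq> gens 1" using assms(1) by (auto simp: gens_def)
  define z where "z = (\<lambda>p q. zcoord p (poisson X (basis_elem q)))"
  define T where "T = (\<lambda>I p q. if p \<notin> J - {q} \<and> insert p (J - {q}) = I
     then pos_sign p (J - {q}) * pos_sign q (J - {q}) * gen_scale I else 0)"
  have z: "z p q = (\<Sum>i\<le>2. quad_coeff X i * (if p = gen_bracket (2, i) q
       then gen_norm p * struct_const (2, i) q / gen_norm q else 0))"
    if "p \<in> gens k" "q \<in> gens k" for p q
    unfolding z_def using that g1 by (intro zcoord_poisson_quadratic assms) auto
  let ?S = "\<lambda>I p q i. - (quad_coeff X i * (if p = gen_bracket (2, i) q then struct_const (2, i) q * (lk u I * T I p q) else 0))"
  have inner: "gen_scale J * (pos_sign p I * lk (wedge (- (\<Sum>q\<in>gens_near k p. z p q *\<^sub>R zmono {q})) (zmono (I - {p}))) J)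
    = - (\<Sum>q\<in>J. \<Sum>i\<le>2. quad_coeff X i * (if p = gen_bracket (2, i) q then struct_const (2, i) q * T I p q else 0))"
    if I: "I \<in> supp u" and p: "p \<in> I" for I p
  proof -
    let ?f = "\<lambda>q. if q \<notin> I - {p} \<and> insert q (I - {p}) = J then z p q * pos_sign q (I - {p}) else 0"
    have "lk (wedge (- (\<Sum>q\<in>gens_near k p. z p q *\<^sub>R zmono {q})) (zmono (I - {p}))) J
      = - (\<Sum>q\<in>gens_near k p. ?f q)"
      unfolding lookup_wedge_uminus lookup_wedge_sum lookup_wedge_scaleR wedge_zmono_zmono
      by (intro arg_cong[where f = uminus] sum.cong)
         (auto simp: shuffle_sign_single lookup_scaleR lookup_zmono)
    also have "(\<Sum>q\<in>gens_near k p. ?f q) = (\<Sum>q\<in>J. ?f q)"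
    proof (rule sum.mono_neutral_cong)
      fix q assume q: "q \<in> J - gens_near k p"
      then have "q \<in> gens k" "p \<in> gens k" "fst q \<noteq> fst p"
        using assms(4) u[OF I] p by (auto simp: gens_near_def)
      moreover have "fst (gen_bracket (2, i) q) = fst q" for i by (cases q) auto
      ultimately have "p \<noteq> gen_bracket (2, i) q" for i by metis
      then have "z p q = 0" using \<open>p \<in> gens k\<close> \<open>q \<in> gens k\<close> by (simp add: z)
      then show "?f q = 0" by simp
    qed (use assms(3) in auto)
    finally have 1: "gen_scale J * (pos_sign p I * lk (wedge (- (\<Sum>q\<in>gens_near k p. z p q *\<^sub>R zmono {q})) (zmono (I - {p}))) J)
       = - (\<Sum>q\<in>J. gen_scale J * (pos_sign p I * ?f q))"
      by (simp add: sum_distrib_left)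
    have 2: "gen_scale J * (pos_sign p I * ?f q) =
      (\<Sum>i\<le>2. quad_coeff X i * (if p = gen_bracket (2, i) q then struct_const (2, i) q * T I p q else 0))"
      if q: "q \<in> J" for q
    proof (cases "p \<notin> J - {q} \<and> insert p (J - {q}) = I")
      case True
      then have M: "I - {p} = J - {q}" and c: "q \<notin> I - {p} \<and> insert q (I - {p}) = J" using q by auto
      have J: "gen_scale J = gen_norm q * gen_scale (J - {q})"
        using gen_scale_insert[of "J - {q}" q] q assms(3) by (simp add: insert_absorb)
      have I': "gen_scale I = gen_norm p * gen_scale (J - {q})"
        using gen_scale_insert[of "J - {q}" p] True assms(3) by auto
      have s: "pos_sign p I = pos_sign p (J - {q})" unfolding M[symmetric] by simp
      have T: "T I p q = pos_sign p (J - {q}) * pos_sign q (J - {q}) * (gen_norm p * gen_scale (J - {q}))"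
        unfolding T_def if_P[OF True] I' ..
      have pq: "p \<in> gens k" "q \<in> gens k" using u[OF I] p q assms(4) by auto
      have "gen_scale J * (pos_sign p I * ?f q) =
         z p q * (gen_norm q * gen_scale (J - {q}) * (pos_sign p (J - {q}) * pos_sign q (J - {q})))"
        by (simp only: if_P[OF c]) (simp only: M s J, simp)
      also have "\<dots> = (\<Sum>i\<le>2. quad_coeff X i * (if p = gen_bracket (2, i) q then struct_const (2, i) q * T I p q else 0))"
        unfolding z[OF pq] sum_distrib_right T by (intro sum.cong refl) (simp add: field_simps)
      finally show ?thesis .
    next
      case False
      then have c: "\<not> (q \<notin> I - {p} \<and> insert q (I - {p}) = J)"
        unfolding exchange_iff[OF p q] .
      have "T I p q = 0" unfolding T_def if_not_P[OF False] ..
      then show ?thesis unfolding if_not_P[OF c] by (auto intro!: sum.neutral)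
    qed
    show ?thesis unfolding 1 by (simp only: 2 cong: sum.cong)
  qed
  have "vals (lie_deriv k X u) J = (\<Sum>I\<in>supp u. \<Sum>p\<in>I. lk u I *
     (gen_scale J * (pos_sign p I * lk (wedge (- (\<Sum>q\<in>gens_near k p. z p q *\<^sub>R zmono {q})) (zmono (I - {p}))) J)))"
    unfolding vals_def lie_deriv_def lookup_extend_derivation z_def
    by (simp add: sum_distrib_left mult_ac)
  also have "\<dots> = (\<Sum>I\<in>supp u. \<Sum>p\<in>I. lk u I *
     - (\<Sum>q\<in>J. \<Sum>i\<le>2. quad_coeff X i * (if p = gen_bracket (2, i) q then struct_const (2, i) q * T I p q else 0)))"
    using inner by (intro sum.cong) auto
  also have "\<dots> = (\<Sum>I\<in>supp u. \<Sum>p\<in>I. \<Sum>q\<in>J. \<Sum>i\<le>2. ?S I p q i)"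
    by (auto simp: sum_distrib_left sum_negf intro!: sum.cong)
  also have "\<dots> = (\<Sum>I\<in>supp u. \<Sum>q\<in>J. \<Sum>p\<in>I. \<Sum>i\<le>2. ?S I p q i)"
    by (intro sum.cong[OF refl] sum.swap)
  also have "\<dots> = (\<Sum>q\<in>J. \<Sum>I\<in>supp u. \<Sum>p\<in>I. \<Sum>i\<le>2. ?S I p q i)"
    by (rule sum.swap)
  also have "\<dots> = (\<Sum>q\<in>J. \<Sum>I\<in>supp u. \<Sum>i\<le>2. \<Sum>p\<in>I. ?S I p q i)"
    by (intro sum.cong[OF refl] sum.swap)
  also have "\<dots> = (\<Sum>q\<in>J. \<Sum>i\<le>2. \<Sum>I\<in>supp u. \<Sum>p\<in>I. ?S I p q i)"
    by (intro sum.cong[OF refl] sum.swap)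
  also have "\<dots> = (\<Sum>i\<le>2. \<Sum>q\<in>J. \<Sum>I\<in>supp u. \<Sum>p\<in>I. ?S I p q i)"
    by (rule sum.swap)
  also have "\<dots> = (\<Sum>i\<le>2. quad_coeff X i * lie_op (2, i) (vals u) J)"
  proof (intro sum.cong[OF refl])
    fix i
    have "pos_sign q J * - (struct_const (2, i) q * contract (gen_bracket (2, i) q) (vals u) (J - {q})) =
      (\<Sum>I\<in>supp u. \<Sum>p\<in>I.
        - (if p = gen_bracket (2, i) q then struct_const (2, i) q * (lk u I * T I p q) else 0))" for q
    proof -
      have "contract (gen_bracket (2, i) q) (vals u) (J - {q}) = (\<Sum>I\<in>supp u. \<Sum>p\<in>I.
        if p = gen_bracket (2, i) q \<and> p \<notin> J - {q} \<and> insert p (J - {q}) = I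
        then lk u I * (pos_sign p (J - {q}) * gen_scale I) else 0)"
        using u assms(3) by (intro contract_vals) auto
      then show ?thesis
        by (auto simp: sum_distrib_left sum_negf T_def intro!: sum.cong)
    qed
    then show "(\<Sum>q\<in>J. \<Sum>I\<in>supp u. \<Sum>p\<in>I. ?S I p q i)
     = quad_coeff X i * lie_op (2, i) (vals u) J"
      unfolding lie_op_def assemble_def
      by (simp add: sum_distrib_left if_distrib sum_negf cong: if_cong)
  qed
  finally show ?thesis .
qed

lemma sum_ordered_pairs:
  fixes f :: "gen \<Rightarrow> gen \<Rightarrow> real"
  assumes "finite J" and sym: "\<And>q r. q \<in> J \<Longrightarrow> r \<in> J \<Longrightarrow> q \<noteq> r \<Longrightarrow> f q r = f r q"
  shows "(\<Sum>q\<in>J. \<Sum>r\<in>J - {q}. f q r) = 2 * (\<Sum>q\<in>J. \<Sum>r\<in>{r \<in> J. gen_less q r}. f q r)"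
proof -
  have "(\<Sum>q\<in>J. \<Sum>r\<in>J - {q}. f q r) =
      (\<Sum>q\<in>J. (\<Sum>r\<in>{r \<in> J. gen_less q r}. f q r) + (\<Sum>r\<in>{r \<in> J. gen_less r q}. f q r))"
  proof (intro sum.cong[OF refl])
    fix q
    have "J - {q} = {r \<in> J. gen_less q r} \<union> {r \<in> J. gen_less r q}"
    proof (rule set_eqI)
      fix r
      show "r \<in> J - {q} \<longleftrightarrow> r \<in> {r \<in> J. gen_less q r} \<union> {r \<in> J. gen_less r q}"
        using gen_less_linear[of q r] by auto
    qed
    then show "(\<Sum>r\<in>J - {q}. f q r) =
       (\<Sum>r\<in>{r \<in> J. gen_less q r}. f q r) + (\<Sum>r\<in>{r \<in> J. gen_less r q}. f q r)"
      using assms(1) by (simp only:) (rule sum.union_disjoint, auto dest: gen_less_asym)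
  qed
  also have "\<dots> = (\<Sum>q\<in>J. \<Sum>r\<in>{r \<in> J. gen_less q r}. f q r) +
      (\<Sum>q\<in>J. \<Sum>r\<in>{r \<in> J. gen_less r q}. f q r)"
    by (rule sum.distrib)
  also have "(\<Sum>q\<in>J. \<Sum>r\<in>{r \<in> J. gen_less r q}. f q r) =
      (\<Sum>r\<in>J. \<Sum>q\<in>{q \<in> J. gen_less r q}. f q r)"
    using assms(1) by (rule sum.swap_restrict[OF _ assms(1)])
  also have "\<dots> = (\<Sum>r\<in>J. \<Sum>q\<in>{q \<in> J. gen_less r q}. f r q)"
  proof (intro sum.cong[OF refl])
    fix r q assume "r \<in> J" "q \<in> {q \<in> J. gen_less r q}"
    then show "f q r = f r q" using sym[of q r] by (cases "q = r") auto
  qed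
  finally show ?thesis by simp
qed

text \<open>The summand is symmetric in the two arguments, since both its sign and the structure constant
change sign under the exchange.\<close>

lemma diff_op_ordered:
  assumes "finite J"
  shows "diff_op F J = - (\<Sum>q\<in>J. \<Sum>r\<in>{r \<in> J. gen_less q r}.
     pos_sign q (J - {q, r}) * pos_sign r (J - {q, r}) * struct_const q r *
     contract (gen_bracket q r) F (J - {q, r}))"
proof -
  define f where "f = (\<lambda>q r. pos_sign q J * (pos_sign r (J - {q}) *
     (struct_const q r * contract (gen_bracket q r) F (J - {q} - {r}))))"
  have s1: "pos_sign q J = pos_sign q (J - {q, r})" "pos_sign r (J - {q}) = pos_sign r (J - {q, r})"
    "pos_sign r J = - pos_sign r (J - {q, r})" "pos_sign q (J - {r}) = pos_sign q (J - {q, r})"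
    if "q \<in> J" "r \<in> J" "gen_less q r" for q r
  proof -
    have d: "q \<noteq> r" "\<not> gen_less r q" using that gen_less_asym by auto
    have Jq: "J - {r} = insert q (J - {q, r})" and Jr: "J - {q} = insert r (J - {q, r})" using that d by auto
    have "pos_sign q (J - {r}) = pos_sign q (J - {q, r})"
      unfolding Jq using assms by (subst pos_sign_insert) auto
    moreover have "pos_sign q J = pos_sign q (J - {r})"
      using pos_sign_insert[of "J - {r}" r q] assms that d by (simp add: insert_absorb)
    moreover have "pos_sign r (J - {q}) = pos_sign r (J - {q, r})"
      using pos_sign_remove[of r "J - {q}"] by (simp add: insert_commute flip: Diff_insert2 Diff_insert)
    moreover have "pos_sign r J = - pos_sign r (J - {q})"
      using pos_sign_insert[of "J - {q}" q r] assms that d by (simp add: insert_absorb)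
    ultimately show "pos_sign q J = pos_sign q (J - {q, r})" "pos_sign r (J - {q}) = pos_sign r (J - {q, r})"
      "pos_sign r J = - pos_sign r (J - {q, r})" "pos_sign q (J - {r}) = pos_sign q (J - {q, r})"
      by simp_all
  qed
  have sym': "f q r = f r q" if "q \<in> J" "r \<in> J" "gen_less q r" for q r
  proof -
    have "J - {r, q} = J - {q, r}" "J - {q} - {r} = J - {q, r}" "J - {r} - {q} = J - {q, r}" by auto
    then show ?thesis
      using s1[OF that] struct_const_swap[of q r] gen_bracket_swap[of q r] by (simp add: f_def)
  qed
  have "diff_op F J = - (\<Sum>q\<in>J. \<Sum>r\<in>J - {q}. f q r) / 2"
    unfolding diff_op_def lie_op_def assemble_def f_def
    by (simp add: sum_distrib_left sum_negf sum_divide_distrib)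
  also have "(\<Sum>q\<in>J. \<Sum>r\<in>J - {q}. f q r) = 2 * (\<Sum>q\<in>J. \<Sum>r\<in>{r \<in> J. gen_less q r}. f q r)"
    using assms gen_less_linear sym' by (intro sum_ordered_pairs) metis+
  also have "(\<Sum>q\<in>J. \<Sum>r\<in>{r \<in> J. gen_less q r}. f q r) = (\<Sum>q\<in>J. \<Sum>r\<in>{r \<in> J. gen_less q r}.
     pos_sign q (J - {q, r}) * pos_sign r (J - {q, r}) * struct_const q r *
     contract (gen_bracket q r) F (J - {q, r}))"
  proof (intro sum.cong[OF refl])
    fix q r assume "q \<in> J" "r \<in> {r \<in> J. gen_less q r}"
    moreover have "J - {q} - {r} = J - {q, r}" by auto
    ultimately show "f q r = pos_sign q (J - {q, r}) * pos_sign r (J - {q, r}) * struct_const q r *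
     contract (gen_bracket q r) F (J - {q, r})" by (simp add: f_def s1)
  qed
  finally show ?thesis by simp
qed

text \<open>As for the Lie derivative, with \<open>p \<in> I\<close> replaced by two elements \<open>q\<close>, \<open>r\<close> of \<open>J\<close>.\<close>

theorem vals_ce_diff:
  assumes "k \<ge> 1" "finite J" "J \<subseteq> gens k"
    and u: "\<And>I. I \<in> supp u \<Longrightarrow> finite I \<and> I \<subseteq> gens k"
  shows "vals (ce_diff k u) J = diff_op (vals u) J"
proof -
  have g1: "gens k \<subseteq> gens 1" using assms(1) by (auto simp: gens_def)
  define z where "z = (\<lambda>p q r. zcoord p (poisson (basis_elem q) (basis_elem r)))"
  define \<phi> where "\<phi> = (\<lambda>p. - (\<Sum>q\<in>gens_near k p. \<Sum>r\<in>{r \<in> gens_near k p. gen_less q r}.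
     z p q r *\<^sub>R wedge (zmono {q}) (zmono {r})))"
  let ?m = "\<lambda>p q r. struct_const q r * (if p = gen_bracket q r then 1 else 0)"
  define T where "T = (\<lambda>I p q r. if p \<notin> J - {q, r} \<and> insert p (J - {q, r}) = I
     then pos_sign p (J - {q, r}) * pos_sign q (J - {q, r}) * pos_sign r (J - {q, r}) * gen_scale I else 0)"
  have z: "z p q r = (if p = gen_bracket q r
       then gen_norm p * struct_const q r / (gen_norm q * gen_norm r) else 0)"
    if "p \<in> gens k" "q \<in> gens k" "r \<in> gens k" for p q r
    unfolding z_def using that g1 by (intro zcoord_poisson_basis) auto
  let ?S = "\<lambda>I p q r. - (?m p q r * (lk u I * T I p q r))"
  have inner: "gen_scale J * (pos_sign p I * lk (wedge (\<phi> p) (zmono (I - {p}))) J)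
    = - (\<Sum>q\<in>J. \<Sum>r\<in>{r \<in> J. gen_less q r}. ?m p q r * T I p q r)"
    if I: "I \<in> supp u" and p: "p \<in> I" for I p
  proof -
    let ?f = "\<lambda>q r. if {q, r} \<inter> (I - {p}) = {} \<and> {q, r} \<union> (I - {p}) = J
      then z p q r * (pos_sign q (I - {p}) * pos_sign r (I - {p})) else 0"
    have fin: "finite (I - {p})" using u[OF I] by auto
    have "lk (wedge (\<phi> p) (zmono (I - {p}))) J = - (\<Sum>q\<in>gens_near k p. \<Sum>r\<in>{r \<in> gens_near k p. gen_less q r}.
        z p q r * lk (wedge (zmono {q, r}) (zmono (I - {p}))) J)"
      unfolding \<phi>_def lookup_wedge_uminus lookup_wedge_sum lookup_wedge_scaleR
      by (simp add: wedge_two_gens)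
    also have "\<dots> = - (\<Sum>q\<in>gens_near k p. \<Sum>r\<in>{r \<in> gens_near k p. gen_less q r}. ?f q r)"
    proof (intro arg_cong[where f = uminus] sum.cong[OF refl])
      fix q r assume "r \<in> {r \<in> gens_near k p. gen_less q r}"
      then have "q \<noteq> r" by auto
      then show "z p q r * lk (wedge (zmono {q, r}) (zmono (I - {p}))) J = ?f q r"
        by (auto simp: wedge_zmono_zmono shuffle_sign_pair[OF _ fin] lookup_scaleR lookup_zmono)
    qed
    also have "(\<Sum>q\<in>gens_near k p. \<Sum>r\<in>{r \<in> gens_near k p. gen_less q r}. ?f q r) =
       (\<Sum>(q, r)\<in>(SIGMA q:gens_near k p. {r \<in> gens_near k p. gen_less q r}). ?f q r)"
      by (rule sum.Sigma) auto
    also have "\<dots> = (\<Sum>(q, r)\<in>(SIGMA q:J. {r \<in> J. gen_less q r}). ?f q r)"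
    proof (rule sum.mono_neutral_cong)
      show "finite (SIGMA q:J. {r \<in> J. gen_less q r})" using assms(2) by auto
      fix x assume x: "x \<in> (SIGMA q:J. {r \<in> J. gen_less q r}) - (SIGMA q:gens_near k p. {r \<in> gens_near k p. gen_less q r})"
      obtain q r where qr: "x = (q, r)" by (cases x)
      have g: "q \<in> gens k" "r \<in> gens k" "p \<in> gens k" using x qr u[OF I] p assms(3) by auto
      have "q \<notin> gens_near k p \<or> r \<notin> gens_near k p" using x qr by auto
      then have "fst q > fst p + 1 \<or> fst r > fst p + 1" using g by (auto simp: gens_near_def)
      moreover have "q \<in> gens 1" "r \<in> gens 1" using g g1 by blast+
      then have "fst q \<ge> 1" "fst r \<ge> 1" by (auto simp: gens_def)
      moreover have "fst (gen_bracket q r) = fst q + fst r - 2" by (cases q; cases r) simp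
      ultimately have "fst p \<noteq> fst (gen_bracket q r)" by linarith
      then have "p \<noteq> gen_bracket q r" by metis
      then show "(case x of (q, r) \<Rightarrow> ?f q r) = 0" using z g by (simp add: qr)
    next
      fix x assume x: "x \<in> (SIGMA q:gens_near k p. {r \<in> gens_near k p. gen_less q r}) - (SIGMA q:J. {r \<in> J. gen_less q r})"
      obtain q r where qr: "x = (q, r)" by (cases x)
      have "\<not> {q, r} \<union> (I - {p}) = J" using x qr by auto
      then show "(case x of (q, r) \<Rightarrow> ?f q r) = 0" by (simp add: qr)
    qed auto
    also have "\<dots> = (\<Sum>q\<in>J. \<Sum>r\<in>{r \<in> J. gen_less q r}. ?f q r)"
      using assms(2) by (subst sum.Sigma) auto
    finally have 1: "gen_scale J * (pos_sign p I * lk (wedge (\<phi> p) (zmono (I - {p}))) J)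
       = - (\<Sum>q\<in>J. \<Sum>r\<in>{r \<in> J. gen_less q r}. gen_scale J * (pos_sign p I * ?f q r))"
      by (simp add: sum_distrib_left)
    have 2: "gen_scale J * (pos_sign p I * ?f q r) = ?m p q r * T I p q r"
      if q: "q \<in> J" and r: "r \<in> {r \<in> J. gen_less q r}" for q r
    proof -
      have qr: "q \<noteq> r" "r \<in> J" using r by auto
      have iff: "{q, r} \<inter> (I - {p}) = {} \<and> {q, r} \<union> (I - {p}) = J \<longleftrightarrow>
         p \<notin> J - {q, r} \<and> insert p (J - {q, r}) = I" (is "?c = ?d")
      proof
        assume ?c
        then have "J - {q, r} = I - {p}" by auto
        then show ?d using p by (simp add: insert_absorb)
      next
        assume ?d
        then have "I - {p} = J - {q, r}" by auto
        then show ?c using q qr(2) by auto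
      qed
      show ?thesis
      proof (cases "p \<notin> J - {q, r} \<and> insert p (J - {q, r}) = I")
        case True
        then have M: "I - {p} = J - {q, r}" by auto
        have "J = insert q (insert r (J - {q, r}))" using q qr by auto
        then have J: "gen_scale J = gen_norm q * (gen_norm r * gen_scale (J - {q, r}))"
          using gen_scale_insert[of "J - {q, r}" r] gen_scale_insert[of "insert r (J - {q, r})" q] assms(2) qr
          by auto
        have I': "gen_scale I = gen_norm p * gen_scale (J - {q, r})"
          using gen_scale_insert[of "J - {q, r}" p] True assms(2) by auto
        have s: "pos_sign p I = pos_sign p (J - {q, r})" unfolding M[symmetric] by simp
        have T: "T I p q r = pos_sign p (J - {q, r}) * pos_sign q (J - {q, r}) * pos_sign r (J - {q, r}) *
            (gen_norm p * gen_scale (J - {q, r}))"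
          unfolding T_def if_P[OF True] I' ..
        have pq: "p \<in> gens k" "q \<in> gens k" "r \<in> gens k" using u[OF I] p q qr assms(3) by auto
        have c: ?c by (rule iffD2[OF iff True])
        have "gen_scale J * (pos_sign p I * ?f q r) = z p q r * (gen_norm q * (gen_norm r * gen_scale (J - {q, r}))
             * (pos_sign p (J - {q, r}) * pos_sign q (J - {q, r}) * pos_sign r (J - {q, r})))"
          by (simp only: if_P[OF c]) (simp only: M s J, simp)
        also have "\<dots> = ?m p q r * T I p q r"
          unfolding z[OF pq] T by (simp add: field_simps)
        finally show ?thesis .
      next
        case False
        then have c: "\<not> ?c" unfolding iff .
        have "T I p q r = 0" unfolding T_def if_not_P[OF False] ..
        then show ?thesis unfolding if_not_P[OF c] by (auto intro!: sum.neutral)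
      qed
    qed
    show ?thesis unfolding 1 by (simp only: 2 cong: sum.cong)
  qed
  have ce: "ce_diff k = extend_derivation \<phi>"
    by (simp only: ce_diff_def \<phi>_def z_def)
  have "vals (ce_diff k u) J = (\<Sum>I\<in>supp u. \<Sum>p\<in>I. lk u I *
     (gen_scale J * (pos_sign p I * lk (wedge (\<phi> p) (zmono (I - {p}))) J)))"
    unfolding vals_def ce lookup_extend_derivation sum_distrib_left
    by (intro sum.cong refl) algebra
  also have "\<dots> = (\<Sum>I\<in>supp u. \<Sum>p\<in>I. lk u I *
     - (\<Sum>q\<in>J. \<Sum>r\<in>{r \<in> J. gen_less q r}. ?m p q r * T I p q r))"
    using inner by (intro sum.cong) auto
  also have "\<dots> = (\<Sum>I\<in>supp u. \<Sum>p\<in>I. \<Sum>q\<in>J. \<Sum>r\<in>{r \<in> J. gen_less q r}. ?S I p q r)"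
    by (intro sum.cong refl) (simp only: sum_negf sum_distrib_left mult_minus_right mult.left_commute[of "lk u _"])
  also have "\<dots> = (\<Sum>I\<in>supp u. \<Sum>q\<in>J. \<Sum>p\<in>I. \<Sum>r\<in>{r \<in> J. gen_less q r}. ?S I p q r)"
    by (intro sum.cong[OF refl] sum.swap)
  also have "\<dots> = (\<Sum>q\<in>J. \<Sum>I\<in>supp u. \<Sum>p\<in>I. \<Sum>r\<in>{r \<in> J. gen_less q r}. ?S I p q r)"
    by (rule sum.swap)
  also have "\<dots> = (\<Sum>q\<in>J. \<Sum>I\<in>supp u. \<Sum>r\<in>{r \<in> J. gen_less q r}. \<Sum>p\<in>I. ?S I p q r)"
    by (intro sum.cong[OF refl] sum.swap)
  also have "\<dots> = (\<Sum>q\<in>J. \<Sum>r\<in>{r \<in> J. gen_less q r}. \<Sum>I\<in>supp u. \<Sum>p\<in>I. ?S I p q r)"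
    by (intro sum.cong[OF refl] sum.swap)
  also have "\<dots> = diff_op (vals u) J"
    unfolding diff_op_ordered[OF assms(2)] sum_negf[symmetric]
  proof (intro sum.cong[OF refl])
    fix q r
    have "contract (gen_bracket q r) (vals u) (J - {q, r}) = (\<Sum>I\<in>supp u. \<Sum>p\<in>I.
        if p = gen_bracket q r \<and> p \<notin> J - {q, r} \<and> insert p (J - {q, r}) = I
        then lk u I * (pos_sign p (J - {q, r}) * gen_scale I) else 0)"
      using u assms(2) by (intro contract_vals) auto
    then show "(\<Sum>I\<in>supp u. \<Sum>p\<in>I. ?S I p q r) =
       - (pos_sign q (J - {q, r}) * pos_sign r (J - {q, r}) * struct_const q r *
          contract (gen_bracket q r) (vals u) (J - {q, r}))"
      by (auto simp: sum_distrib_left sum_negf T_def intro!: sum.cong)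
  qed
  finally show ?thesis .
qed

section \<open>Relative cochains\<close>

definition rel_monomials :: "nat \<Rightarrow> nat \<Rightarrow> int \<Rightarrow> gen set set" where
  "rel_monomials k m w = {I \<in> monomials k m w. \<forall>p\<in>I. fst p \<noteq> 2}"

text \<open>The relative cochains in terms of their values. Invariance is required only at sets of generators
of the Lie algebra at hand.\<close>

definition rel_form :: "nat \<Rightarrow> nat \<Rightarrow> int \<Rightarrow> (gen set \<Rightarrow> real) \<Rightarrow> bool" where
  "rel_form k m w F \<longleftrightarrow> (\<forall>I. F I \<noteq> 0 \<longrightarrow> I \<in> rel_monomials k m w) \<and>
     (\<forall>i\<le>2. \<forall>J. finite J \<longrightarrow> J \<subseteq> gens k \<longrightarrow> lie_op (2, i) F J = 0)"

definition rel_diff :: "nat \<Rightarrow> (gen set \<Rightarrow> real) \<Rightarrow> gen set \<Rightarrow> real" where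
  "rel_diff k F J = (if finite J \<and> J \<subseteq> gens k then diff_op F J else 0)"

lemma vals_eq_0_iff [simp]: "vals u J = 0 \<longleftrightarrow> J \<notin> supp u"
  by (simp add: vals_def in_keys_iff)

lemma cochain_eqI: "(\<And>J. vals u J = vals v J) \<Longrightarrow> u = v"
  by (rule poly_mapping_eqI) (simp add: vals_def)

lemma vals_zero [simp]: "vals 0 J = 0"
  by (simp add: vals_def)

lemma vals_lin: "vals (a *\<^sub>R u + b *\<^sub>R v) J = a * vals u J + b * vals v J"
  by (simp add: vals_def lookup_add lookup_scaleR algebra_simps)

lemma keys_extend_derivation:
  assumes "J \<in> supp (extend_derivation \<phi> u)"
  shows "\<exists>I\<in>supp u. \<exists>p\<in>I. \<exists>K\<in>supp (\<phi> p). J = K \<union> (I - {p})"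
proof -
  have "lk (extend_derivation \<phi> u) J \<noteq> 0" using assms by (simp add: in_keys_iff)
  then obtain I where I: "I \<in> supp u"
    "(\<Sum>p\<in>I. lk u I * pos_sign p I * lk (wedge (\<phi> p) (zmono (I - {p}))) J) \<noteq> 0"
    unfolding lookup_extend_derivation by (rule sum.not_neutral_contains_not_neutral)
  from I(2) obtain p where p: "p \<in> I" "lk u I * pos_sign p I * lk (wedge (\<phi> p) (zmono (I - {p}))) J \<noteq> 0"
    by (rule sum.not_neutral_contains_not_neutral)
  then have "lk (wedge (\<phi> p) (zmono (I - {p}))) J \<noteq> 0" by auto
  then obtain K where "K \<in> supp (\<phi> p)"
    "(if K \<inter> (I - {p}) = {} \<and> K \<union> (I - {p}) = J then lk (\<phi> p) K * shuffle_sign K (I - {p}) else 0) \<noteq> 0"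
    unfolding lookup_wedge_zmono[OF finite_keys subset_refl]
    by (rule sum.not_neutral_contains_not_neutral)
  then have "K \<in> supp (\<phi> p)" "J = K \<union> (I - {p})" by (auto split: if_splits)
  then show ?thesis using I(1) p(1) by blast
qed

lemma keys_sum_scaleR:
  assumes "K \<in> supp (\<Sum>x\<in>N. v x)"
  shows "\<exists>x\<in>N. K \<in> supp (v x)"
proof -
  have "(\<Sum>x\<in>N. lk (v x) K) \<noteq> 0" using assms by (simp add: in_keys_iff lookup_sum)
  then obtain x where "x \<in> N" "lk (v x) K \<noteq> 0" by (rule sum.not_neutral_contains_not_neutral)
  then show ?thesis by (auto simp: in_keys_iff)
qed

lemma keys_uminus_cochain: "supp (- u) = supp (u :: cochain)"
  by (auto simp: in_keys_iff)

lemma keys_lie_deriv: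
  assumes "\<And>I. I \<in> supp u \<Longrightarrow> finite I \<and> I \<subseteq> gens k"
    "J \<in> supp (lie_deriv k X u)"
  shows "finite J \<and> J \<subseteq> gens k"
proof -
  obtain I p K where *: "I \<in> supp u" "p \<in> I"
    "K \<in> supp (- (\<Sum>q\<in>gens_near k p. zcoord p (poisson X (basis_elem q)) *\<^sub>R zmono {q}))"
    "J = K \<union> (I - {p})"
    using keys_extend_derivation assms(2) unfolding lie_deriv_def by blast
  then obtain q where "q \<in> gens_near k p" "K \<in> supp (zcoord p (poisson X (basis_elem q)) *\<^sub>R zmono {q})"
    using keys_sum_scaleR[OF *(3)[unfolded keys_uminus_cochain]] by blast
  then have "K = {q}" "q \<in> gens k"
    by (auto simp: in_keys_iff lookup_scaleR lookup_zmono gens_near_def split: if_splits)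
  then show ?thesis using assms(1)[OF *(1)] *(4) by auto
qed

lemma keys_ce_diff:
  assumes "\<And>I. I \<in> supp u \<Longrightarrow> finite I \<and> I \<subseteq> gens k"
    "J \<in> supp (ce_diff k u)"
  shows "finite J \<and> J \<subseteq> gens k"
proof -
  obtain I p K where *: "I \<in> supp u" "p \<in> I"
    "K \<in> supp (- (\<Sum>q\<in>gens_near k p. \<Sum>r\<in>{r \<in> gens_near k p. gen_less q r}.
          zcoord p (poisson (basis_elem q) (basis_elem r)) *\<^sub>R wedge (zmono {q}) (zmono {r})))"
    "J = K \<union> (I - {p})"
    using keys_extend_derivation assms(2) unfolding ce_diff_def by blast
  then obtain q where q: "q \<in> gens_near k p" "K \<in> supp (\<Sum>r\<in>{r \<in> gens_near k p. gen_less q r}.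
          zcoord p (poisson (basis_elem q) (basis_elem r)) *\<^sub>R wedge (zmono {q}) (zmono {r}))"
    using keys_sum_scaleR[OF *(3)[unfolded keys_uminus_cochain]] by blast
  then obtain r where r: "r \<in> {r \<in> gens_near k p. gen_less q r}"
    "K \<in> supp (zcoord p (poisson (basis_elem q) (basis_elem r)) *\<^sub>R wedge (zmono {q}) (zmono {r}))"
    using keys_sum_scaleR[OF q(2)] by blast
  then have "K = {q, r}" "q \<in> gens k" "r \<in> gens k"
    using q by (auto simp: in_keys_iff lookup_scaleR lookup_zmono wedge_two_gens gens_near_def split: if_splits)
  then show ?thesis using assms(1)[OF *(1)] *(4) by auto
qed

lemma vals_ce_diff_eq:
  assumes "k \<ge> 1" "\<And>I. I \<in> supp u \<Longrightarrow> finite I \<and> I \<subseteq> gens k"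
  shows "vals (ce_diff k u) = rel_diff k (vals u)"
proof
  fix J
  show "vals (ce_diff k u) J = rel_diff k (vals u) J"
    using vals_ce_diff[OF assms(1) _ _ assms(2), of J u] keys_ce_diff[OF assms(2), of u J]
    by (cases "finite J \<and> J \<subseteq> gens k") (auto simp: rel_diff_def)
qed

lemma quad_coeff_basis: "i \<le> 2 \<Longrightarrow> j \<le> 2 \<Longrightarrow>
    quad_coeff (basis_elem (2, i)) j = (if j = i then 1 / gen_norm (2, i) else 0)"
  by (auto simp: quad_coeff_def basis_elem_eq nth_const_xy nth_monom_xy)

lemma basis_elem_homogeneous: "i \<le> 2 \<Longrightarrow> basis_elem (2, i) \<in> homogeneous 2"
  by (auto simp: homogeneous_def basis_elem_eq nth_const_xy nth_monom_xy)

lemma zcoord_quadratic: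
  "X \<in> homogeneous 2 \<Longrightarrow> (A, a) \<in> gens 1 \<Longrightarrow> A \<noteq> 2 \<Longrightarrow> zcoord (A, a) X = 0"
  by (auto simp: homogeneous_def zcoord_def gens_def)

lemma zcoord_basis: "p \<in> gens 1 \<Longrightarrow> q \<in> gens 1 \<Longrightarrow> zcoord q (basis_elem p) = (if q = p then 1 else 0)"
  by (cases p; cases q) (auto simp: zcoord_def gens_def basis_elem_eq nth_const_xy nth_monom_xy)

text \<open>Contracting with \<open>basis_elem (2, i)\<close> isolates the coefficients of the monomials that contain
\<open>z\<^sup>i\<^sub>2\<close>.\<close>

lemma interior_vanishes_iff:
  assumes "k \<ge> 1" and u: "\<And>I. I \<in> supp u \<Longrightarrow> finite I \<and> I \<subseteq> gens k"
  shows "(\<forall>X\<in>homogeneous 2. interior X u = 0) \<longleftrightarrow>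
    (\<forall>I\<in>supp u. \<forall>p\<in>I. fst p \<noteq> 2)"
proof
  have g1: "gens k \<subseteq> gens 1" using assms(1) by (auto simp: gens_def)
  have lk: "lk (interior X u) J = (\<Sum>I\<in>supp u. \<Sum>p\<in>I.
     lk u I * pos_sign p I * (if I - {p} = J then zcoord p X else 0))" for X J
  proof -
    have "lk (wedge (c *\<^sub>R zmono {}) (zmono M)) J = (if M = J then c else 0)" for c M
      unfolding lookup_wedge_scaleR wedge_zmono_zmono by (simp add: shuffle_sign_def lookup_zmono)
    then show ?thesis
      unfolding interior_def lookup_extend_derivation by (simp only:)
  qed
  {
    assume *: "\<forall>X\<in>homogeneous 2. interior X u = 0"
    show "\<forall>I\<in>supp u. \<forall>p\<in>I. fst p \<noteq> 2"
    proof (intro ballI notI)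
      fix I0 p0 assume I0: "I0 \<in> supp u" and p0: "p0 \<in> I0" "fst p0 = 2"
      obtain i where i: "p0 = (2, i)" using p0(2) by (cases p0) auto
      have "p0 \<in> gens k" using u[OF I0] p0 by auto
      then have i2: "i \<le> 2" and p1: "p0 \<in> gens 1" using g1 by (auto simp: gens_def i)
      have "(if I - {p} = I0 - {p0} then zcoord p (basis_elem p0) else 0) = (if p = p0 \<and> I = I0 then 1 else 0)"
        if "I \<in> supp u" "p \<in> I" for I p
      proof -
        have "p \<in> gens 1" using u[OF that(1)] that(2) g1 by auto
        then show ?thesis using zcoord_basis[OF p1 \<open>p \<in> gens 1\<close>] that(2) p0(1) by auto
      qed
      then have "lk (interior (basis_elem p0) u) (I0 - {p0}) =
        (\<Sum>I\<in>supp u. \<Sum>p\<in>I. lk u I * pos_sign p I * (if p = p0 \<and> I = I0 then 1 else 0))"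
        unfolding lk by (intro sum.cong refl) simp
      also have "\<dots> = (\<Sum>I\<in>supp u. if I = I0 then lk u I0 * pos_sign p0 I0 else 0)"
      proof (intro sum.cong refl)
        fix I assume I: "I \<in> supp u"
        have "(\<Sum>p\<in>I. lk u I * pos_sign p I * (if p = p0 \<and> I = I0 then 1 else 0)) =
          (\<Sum>p\<in>I. if p = p0 then (if I = I0 then lk u I0 * pos_sign p0 I0 else 0) else 0)"
          by (intro sum.cong) auto
        then show "(\<Sum>p\<in>I. lk u I * pos_sign p I * (if p = p0 \<and> I = I0 then 1 else 0)) =
          (if I = I0 then lk u I0 * pos_sign p0 I0 else 0)"
          using u[OF I] p0(1) by auto
      qed
      also have "\<dots> = lk u I0 * pos_sign p0 I0" using I0 by simp
      finally have "lk u I0 * pos_sign p0 I0 = 0" using * basis_elem_homogeneous[OF i2] by (simp add: i)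
      then show False using I0 by (simp add: in_keys_iff pos_sign_def)
    qed
  }
  {
    assume *: "\<forall>I\<in>supp u. \<forall>p\<in>I. fst p \<noteq> 2"
    show "\<forall>X\<in>homogeneous 2. interior X u = 0"
    proof
      fix X assume X: "X \<in> homogeneous 2"
      show "interior X u = 0"
      proof (rule poly_mapping_eqI)
        fix J
        have "zcoord p X = 0" if "I \<in> supp u" "p \<in> I" for I p
          using * u[OF that(1)] that g1 zcoord_quadratic[OF X, of "fst p" "snd p"] by auto
        then show "lk (interior X u) J = lk 0 J" unfolding lk by (auto intro!: sum.neutral)
      qed
    qed
  }
qed

theorem rel_cochains_iff:
  assumes "k \<ge> 1"
  shows "u \<in> rel_cochains k m w \<longleftrightarrow> rel_form k m w (vals u)"
proof (cases "supp u \<subseteq> monomials k m w")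
  case False
  then show ?thesis by (auto simp: rel_cochains_def rel_form_def rel_monomials_def)
next
  case True
  then have u: "finite I \<and> I \<subseteq> gens k" if "I \<in> supp u" for I
    using that by (auto simp: monomials_def)
  have "(\<forall>X\<in>homogeneous 2. lie_deriv k X u = 0) \<longleftrightarrow>
    (\<forall>i\<le>2. \<forall>J. finite J \<longrightarrow> J \<subseteq> gens k \<longrightarrow> lie_op (2, i) (vals u) J = 0)"
  proof
    assume *: "\<forall>X\<in>homogeneous 2. lie_deriv k X u = 0"
    show "\<forall>i\<le>2. \<forall>J. finite J \<longrightarrow> J \<subseteq> gens k \<longrightarrow> lie_op (2, i) (vals u) J = 0"
    proof (intro allI impI)
      fix i J assume i: "i \<le> (2::nat)" and J: "finite J" "J \<subseteq> gens k"
      have "0 = vals (lie_deriv k (basis_elem (2, i)) u) J"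
        using * basis_elem_homogeneous[OF i] by simp
      also have "\<dots> = (\<Sum>j\<le>2. quad_coeff (basis_elem (2, i)) j * lie_op (2, j) (vals u) J)"
        using assms basis_elem_homogeneous[OF i] J u by (rule vals_lie_deriv)
      also have "\<dots> = (\<Sum>j\<le>2. if j = i then lie_op (2, i) (vals u) J / gen_norm (2, i) else 0)"
        using i by (intro sum.cong) (auto simp: quad_coeff_basis)
      also have "\<dots> = lie_op (2, i) (vals u) J / gen_norm (2, i)" using i by simp
      finally show "lie_op (2, i) (vals u) J = 0" by simp
    qed
  next
    assume *: "\<forall>i\<le>2. \<forall>J. finite J \<longrightarrow> J \<subseteq> gens k \<longrightarrow> lie_op (2, i) (vals u) J = 0"
    show "\<forall>X\<in>homogeneous 2. lie_deriv k X u = 0"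
    proof (intro ballI cochain_eqI)
      fix X J assume X: "X \<in> homogeneous 2"
      show "vals (lie_deriv k X u) J = vals 0 J"
      proof (cases "finite J \<and> J \<subseteq> gens k")
        case True
        then show ?thesis using vals_lie_deriv[OF assms X _ _ u, of J] * by simp
      next
        case False
        then show ?thesis using keys_lie_deriv[OF u] by (metis vals_eq_0_iff vals_zero)
      qed
    qed
  qed
  moreover have "(\<forall>X\<in>homogeneous 2. interior X u = 0) \<longleftrightarrow> (\<forall>I\<in>supp u. \<forall>p\<in>I. fst p \<noteq> 2)"
    by (rule interior_vanishes_iff[OF assms u])
  moreover have "(\<forall>I. vals u I \<noteq> 0 \<longrightarrow> I \<in> rel_monomials k m w) \<longleftrightarrow>
      (\<forall>I\<in>supp u. \<forall>p\<in>I. fst p \<noteq> 2)"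
    using True by (auto simp: rel_monomials_def)
  ultimately show ?thesis using True
    by (simp only: rel_cochains_def rel_form_def mem_Collect_eq ball_conj_distrib simp_thms)
qed

lemma finite_monomials: "finite (monomials k m w)"
proof -
  let ?N = "nat (w + 2 * int m + 2)"
  have "monomials k m w \<subseteq> Pow (SIGMA A:{..?N}. {..A})"
  proof
    fix I assume I: "I \<in> monomials k m w"
    have "int (fst p) \<le> w + 2 * int m + 2" if p: "p \<in> I" for p
    proof -
      have fin: "finite I" and c: "card I = m" using I by (auto simp: monomials_def)
      have "w = gen_weight p + (\<Sum>q\<in>I - {p}. gen_weight q)"
        using I fin p by (auto simp: monomials_def sum.remove)
      moreover have "(\<Sum>q\<in>I - {p}. gen_weight q) \<ge> (\<Sum>q\<in>I - {p}. - 2)"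
        by (intro sum_mono) (auto simp: gen_weight_def)
      moreover have "card (I - {p}) \<le> m" using c fin p by (simp add: card_Diff_singleton)
      moreover have "gen_weight p = int (fst p) - 2" by (cases p) (simp add: gen_weight_def)
      ultimately show ?thesis by simp
    qed
    then show "I \<in> Pow (SIGMA A:{..?N}. {..A})"
      using I by (fastforce simp: monomials_def gens_def)
  qed
  then show ?thesis by (rule finite_subset) auto
qed

definition of_vals :: "(gen set \<Rightarrow> real) \<Rightarrow> cochain" where
  "of_vals F = Abs_poly_mapping (\<lambda>J. F J / gen_scale J)"

lemma vals_of_vals: "finite {J. F J \<noteq> 0} \<Longrightarrow> vals (of_vals F) = F"
  by (intro ext) (simp add: vals_def of_vals_def)

lemma rel_form_finite: "rel_form k m w F \<Longrightarrow> finite {J. F J \<noteq> 0}"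
  by (rule finite_subset[OF _ finite_monomials[of k m w]]) (auto simp: rel_form_def rel_monomials_def)

text \<open>The index \<open>a + b - 1\<close> exceeds \<open>A + B - 2\<close> only for \<open>a = A\<close> and \<open>b = B\<close>, where the structure
constant is zero.\<close>

lemma gen_bracket_closed:
  assumes "k \<ge> 1" "p \<in> gens k" "q \<in> gens k" "struct_const p q \<noteq> 0"
  shows "gen_bracket p q \<in> gens k"
proof -
  obtain A a B b where pq: "p = (A, a)" "q = (B, b)" by (cases p; cases q) auto
  have "\<not> (a = A \<and> b = B)" using assms(4) by (auto simp: pq mult.commute split: if_splits)
  then show ?thesis using assms by (auto simp: pq gens_def split: if_splits)
qed

text \<open>The values of the Lie derivative at \<open>J\<close> come from sets that differ from \<open>J\<close> in one element. This
lemma and the next one serve to trace degree and weights through the operators.\<close>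

lemma lie_op_support:
  assumes "lie_op p F J \<noteq> 0"
  shows "\<exists>q\<in>J. struct_const p q \<noteq> 0 \<and> gen_bracket p q \<notin> J - {q} \<and>
    F (insert (gen_bracket p q) (J - {q})) \<noteq> 0"
proof -
  have "(\<Sum>q\<in>J. pos_sign q J * - (struct_const p q * contract (gen_bracket p q) F (J - {q}))) \<noteq> 0"
    using assms by (simp add: lie_op_def assemble_def)
  then obtain q where "q \<in> J"
    "pos_sign q J * - (struct_const p q * contract (gen_bracket p q) F (J - {q})) \<noteq> 0"
    by (rule sum.not_neutral_contains_not_neutral)
  then show ?thesis by (auto simp: contract_def split: if_splits)
qed

lemma diff_op_support:
  assumes "diff_op F J \<noteq> 0"
  shows "\<exists>q\<in>J. \<exists>r\<in>J. q \<noteq> r \<and> struct_const q r \<noteq> 0 \<and> gen_bracket q r \<notin> J - {q, r} \<and>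
    F (insert (gen_bracket q r) (J - {q, r})) \<noteq> 0"
proof -
  have fin: "finite J" using assms by (metis diff_op_infinite)
  have "(\<Sum>q\<in>J. \<Sum>r\<in>{r \<in> J. gen_less q r}.
     pos_sign q (J - {q, r}) * pos_sign r (J - {q, r}) * struct_const q r *
     contract (gen_bracket q r) F (J - {q, r})) \<noteq> 0"
    using assms unfolding diff_op_ordered[OF fin] by simp
  then obtain q where q: "q \<in> J" "(\<Sum>r\<in>{r \<in> J. gen_less q r}.
     pos_sign q (J - {q, r}) * pos_sign r (J - {q, r}) * struct_const q r *
     contract (gen_bracket q r) F (J - {q, r})) \<noteq> 0"
    by (rule sum.not_neutral_contains_not_neutral)
  from q(2) obtain r where "r \<in> {r \<in> J. gen_less q r}"
    "pos_sign q (J - {q, r}) * pos_sign r (J - {q, r}) * struct_const q r *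
     contract (gen_bracket q r) F (J - {q, r}) \<noteq> 0"
    by (rule sum.not_neutral_contains_not_neutral)
  then have "r \<in> J" "q \<noteq> r" "struct_const q r \<noteq> 0" "contract (gen_bracket q r) F (J - {q, r}) \<noteq> 0"
    by auto
  moreover from this(4) have "gen_bracket q r \<notin> J - {q, r}"
    "F (insert (gen_bracket q r) (J - {q, r})) \<noteq> 0"
    by (auto simp: contract_def split: if_splits)
  ultimately show ?thesis using q(1) by blast
qed

lemma lie_op_diff: "lie_op p (\<lambda>J. F J - G J) J = lie_op p F J - lie_op p G J"
  using lie_op_lin[of p 1 F "-1" G J] by simp

lemma diff_op_diff: "diff_op (\<lambda>J. F J - G J) J = diff_op F J - diff_op G J"
  using diff_op_lin[of 1 F "-1" G J] by simp

lemma lie_op_cong: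
  assumes "k \<ge> 1" "p \<in> gens k" "J \<subseteq> gens k"
    and eq: "\<And>K. finite K \<Longrightarrow> K \<subseteq> gens k \<Longrightarrow> F K = G K"
  shows "lie_op p F J = lie_op p G J"
proof (rule ccontr)
  assume "lie_op p F J \<noteq> lie_op p G J"
  then have *: "lie_op p (\<lambda>J. F J - G J) J \<noteq> 0" by (simp add: lie_op_diff)
  then have "finite J" by (metis lie_op_infinite)
  from lie_op_support[OF *] obtain q where q: "q \<in> J" "struct_const p q \<noteq> 0"
    "F (insert (gen_bracket p q) (J - {q})) \<noteq> G (insert (gen_bracket p q) (J - {q}))" by auto
  have "gen_bracket p q \<in> gens k" using assms q by (intro gen_bracket_closed) auto
  then show False using eq[of "insert (gen_bracket p q) (J - {q})"] q(3) \<open>finite J\<close> assms(3) by auto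
qed

lemma diff_op_cong:
  assumes "k \<ge> 1" "J \<subseteq> gens k"
    and eq: "\<And>K. finite K \<Longrightarrow> K \<subseteq> gens k \<Longrightarrow> F K = G K"
  shows "diff_op F J = diff_op G J"
proof (rule ccontr)
  assume "diff_op F J \<noteq> diff_op G J"
  then have *: "diff_op (\<lambda>J. F J - G J) J \<noteq> 0" by (simp add: diff_op_diff)
  then have "finite J" by (metis diff_op_infinite)
  from diff_op_support[OF *] obtain q r where q: "q \<in> J" "r \<in> J" "struct_const q r \<noteq> 0"
    "F (insert (gen_bracket q r) (J - {q, r})) \<noteq> G (insert (gen_bracket q r) (J - {q, r}))" by auto
  have "gen_bracket q r \<in> gens k" using assms q by (intro gen_bracket_closed) auto
  then show False using eq[of "insert (gen_bracket q r) (J - {q, r})"] q(4) \<open>finite J\<close> assms(2) by auto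
qed

lemma quad_in_gens: "k \<le> 2 \<Longrightarrow> i \<le> 2 \<Longrightarrow> (2, i) \<in> gens k"
  by (auto simp: gens_def)

lemma gens_subset: "k \<le> l \<Longrightarrow> gens l \<subseteq> gens k"
  by (auto simp: gens_def)

lemma rel_form_zero: "rel_form k m w F \<Longrightarrow> p \<in> J \<Longrightarrow> fst p = 2 \<Longrightarrow> F J = 0"
  by (auto simp: rel_form_def rel_monomials_def)

lemma rel_form_outside:
  assumes "rel_form k m w F" "\<not> (finite J \<and> J \<subseteq> gens k \<and> (\<forall>p\<in>J. fst p \<noteq> 2))"
  shows "F J = 0"
proof (rule ccontr)
  assume "F J \<noteq> 0"
  then have "J \<in> rel_monomials k m w" using assms(1) by (simp add: rel_form_def)
  then show False using assms(2) by (simp add: rel_monomials_def monomials_def)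
qed

lemma rel_form_lie: "rel_form k m w F \<Longrightarrow> i \<le> 2 \<Longrightarrow> J \<subseteq> gens k \<Longrightarrow> lie_op (2, i) F J = 0"
  by (cases "finite J") (auto simp: rel_form_def)

lemma gen_weight_bracket:
  assumes "struct_const q r \<noteq> 0"
  shows "gen_weight (gen_bracket q r) = gen_weight q + gen_weight r"
  using assms by (cases q; cases r) (auto simp: gen_weight_def split: if_splits)

text \<open>Degree and weight are read off from \<open>diff_op_support\<close>. The differential has no generator of \<open>S\<^sub>2\<close>,
because \<open>i\<^sub>p d F = L\<^sub>p F - d i\<^sub>p F = 0\<close> for \<open>p\<close> in \<open>S\<^sub>2\<close>, and it is invariant because \<open>L\<^sub>p\<close> commutes
with \<open>d\<close>.\<close>

theorem rel_diff_form:
  assumes k: "1 \<le> k" "k \<le> 2" and F: "rel_form k m w F"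
  shows "rel_form k (m + 1) w (rel_diff k F)"
  unfolding rel_form_def
proof (intro conjI allI impI)
  fix J assume nz: "rel_diff k F J \<noteq> 0"
  then have J: "finite J" "J \<subseteq> gens k" "diff_op F J \<noteq> 0" by (auto simp: rel_diff_def split: if_splits)
  obtain q r where q: "q \<in> J" "r \<in> J" "q \<noteq> r" "struct_const q r \<noteq> 0" "gen_bracket q r \<notin> J - {q, r}"
    "F (insert (gen_bracket q r) (J - {q, r})) \<noteq> 0"
    using diff_op_support[OF J(3)] by blast
  let ?I = "insert (gen_bracket q r) (J - {q, r})"
  have I: "?I \<in> monomials k m w" using F q(6) by (auto simp: rel_form_def rel_monomials_def)
  have c: "card J = Suc (Suc (card (J - {q, r})))" and m: "Suc (card (J - {q, r})) = m"
  proof -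
    have "J = insert q (insert r (J - {q, r}))" using q by auto
    then have "card J = card (insert q (insert r (J - {q, r})))" by simp
    then show "card J = Suc (Suc (card (J - {q, r})))" using J(1) q(3) by simp
    have "card ?I = m" using I by (simp add: monomials_def)
    then show "Suc (card (J - {q, r})) = m" using J(1) q(5) by simp
  qed
  have "(\<Sum>p\<in>?I. gen_weight p) = w" using I by (simp add: monomials_def)
  then have "gen_weight q + gen_weight r + (\<Sum>p\<in>J - {q, r}. gen_weight p) = w"
    using J(1) q(5) by (simp add: gen_weight_bracket[OF q(4)])
  moreover have "(\<Sum>p\<in>J. gen_weight p) = gen_weight q + (gen_weight r + (\<Sum>p\<in>J - {q, r}. gen_weight p))"
  proof -
    have "J = insert q (insert r (J - {q, r}))" using q by auto
    then have "(\<Sum>p\<in>J. gen_weight p) = (\<Sum>p\<in>insert q (insert r (J - {q, r})). gen_weight p)" by simp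
    then show ?thesis using J(1) q(3) by simp
  qed
  ultimately have "J \<in> monomials k (m + 1) w" using J c m by (auto simp: monomials_def)
  moreover have "fst p \<noteq> 2" if p: "p \<in> J" for p
  proof
    assume "fst p = 2"
    then obtain i where i: "p = (2, i)" by (cases p) auto
    then have i2: "i \<le> 2" using p J(2) by (auto simp: gens_def)
    have "contract p F = (\<lambda>K. 0 * F K + 0 * F K)"
      using rel_form_zero[OF F, of p] \<open>fst p = 2\<close> by (intro ext) (simp add: contract_def)
    then have "diff_op (contract p F) (J - {p}) = 0"
      using diff_op_lin[of 0 F 0 F "J - {p}"] by simp
    moreover have "lie_op p F (J - {p}) = 0"
      unfolding i using J(2) by (intro rel_form_lie[OF F i2]) auto
    ultimately have "contract p (diff_op F) (J - {p}) = 0" by (simp add: cartan_formula)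
    then show False using nonempty_via_contract[OF J(1) p, of "diff_op F"] J(3) by simp
  qed
  ultimately show "J \<in> rel_monomials k (m + 1) w" by (auto simp: rel_monomials_def)
next
  have g1: "gens k \<subseteq> gens 1" using k gens_subset by auto
  fix i :: nat and J :: "gen set" assume i: "i \<le> 2" and J: "finite J" "J \<subseteq> gens k"
  have p: "(2, i) \<in> gens k" using k i quad_in_gens by auto
  have "lie_op (2, i) (rel_diff k F) J = lie_op (2, i) (diff_op F) J"
    using k p J by (intro lie_op_cong[where k = k]) (auto simp: rel_diff_def)
  also have "\<dots> = diff_op (lie_op (2, i) F) J"
    using J p g1 by (intro lie_op_diff_op) auto
  also have "\<dots> = diff_op (\<lambda>K. 0 * F K + 0 * F K) J"
    using k J rel_form_lie[OF F i] by (intro diff_op_cong[where k = k]) auto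
  also have "\<dots> = 0" unfolding diff_op_lin by simp
  finally show "lie_op (2, i) (rel_diff k F) J = 0" .
qed

theorem rel_diff_rel_diff:
  assumes k: "1 \<le> k"
  shows "rel_diff k (rel_diff k F) = (\<lambda>J. 0)"
proof
  fix J
  show "rel_diff k (rel_diff k F) J = 0"
  proof (cases "finite J \<and> J \<subseteq> gens k")
    case True
    have "diff_op (rel_diff k F) J = diff_op (diff_op F) J"
      using True k by (intro diff_op_cong[where k = k]) (auto simp: rel_diff_def)
    also have "\<dots> = 0" using True k gens_subset[of 1 k] by (intro diff_op_diff_op) auto
    finally show ?thesis by (simp add: rel_diff_def)
  qed (auto simp: rel_diff_def)
qed

lemma rel_form_lin:
  assumes "rel_form k m w F" "rel_form k m w G"
  shows "rel_form k m w (\<lambda>J. a * F J + b * G J)"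
proof -
  have "I \<in> rel_monomials k m w" if "a * F I + b * G I \<noteq> 0" for I
  proof -
    have "F I \<noteq> 0 \<or> G I \<noteq> 0" using that by auto
    then show ?thesis using assms by (auto simp: rel_form_def)
  qed
  then show ?thesis unfolding rel_form_def lie_op_lin using assms by (simp add: rel_form_def)
qed

lemma rel_diff_lin: "rel_diff k (\<lambda>J. a * F J + b * G J) J = a * rel_diff k F J + b * rel_diff k G J"
  by (simp add: rel_diff_def diff_op_lin)

section \<open>The product with \<omega>\<close>

abbreviation omega_gens :: "gen set" where
  "omega_gens \<equiv> {(1, 0), (1, 1)}"

text \<open>The product with \<open>\<omega>\<close>. The generators of \<open>\<omega>\<close> precede all others and their number is even, so no
sign appears.\<close>

definition omega_ext :: "(gen set \<Rightarrow> real) \<Rightarrow> gen set \<Rightarrow> real" where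
  "omega_ext F J = (if omega_gens \<subseteq> J then F (J - omega_gens) else 0)"

lemma omega_ext_lin: "omega_ext (\<lambda>J. a * F J + b * G J) J = a * omega_ext F J + b * omega_ext G J"
  by (simp add: omega_ext_def)

lemma omega_eq: "omega = zmono omega_gens"
  unfolding omega_def by (rule wedge_two_gens) (simp add: gen_less_def)

lemma vals_wedge_omega:
  assumes u: "\<And>I. I \<in> supp u \<Longrightarrow> finite I \<and> I \<subseteq> gens 2"
  shows "vals (wedge u omega) = omega_ext (vals u)"
proof
  fix J
  have s: "shuffle_sign I omega_gens = 1" if I: "I \<in> supp u" for I
  proof -
    have "{(p, q). p \<in> I \<and> q \<in> omega_gens \<and> gen_less q p} = I \<times> omega_gens"
      using u[OF I] by (auto simp: gens_def gen_less_def)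
    then show ?thesis by (simp add: shuffle_sign_def card_cartesian_product)
  qed
  have "lk (wedge u omega) J = (\<Sum>I\<in>supp u.
      if I = J - omega_gens then (if omega_gens \<subseteq> J then lk u I else 0) else 0)"
    unfolding omega_eq lookup_wedge_zmono[OF finite_keys subset_refl]
  proof (intro sum.cong refl)
    fix I assume I: "I \<in> supp u"
    have d: "I \<inter> omega_gens = {}" using u[OF I] by (auto simp: gens_def)
    then have iff: "(I \<inter> omega_gens = {} \<and> I \<union> omega_gens = J) \<longleftrightarrow> (I = J - omega_gens \<and> omega_gens \<subseteq> J)"
      by blast
    show "(if I \<inter> omega_gens = {} \<and> I \<union> omega_gens = J then lk u I * shuffle_sign I omega_gens else 0) =
      (if I = J - omega_gens then (if omega_gens \<subseteq> J then lk u I else 0) else 0)"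
      unfolding iff s[OF I] by simp
  qed
  also have "\<dots> = (if omega_gens \<subseteq> J then lk u (J - omega_gens) else 0)"
    by (simp add: in_keys_iff)
  finally have lk: "lk (wedge u omega) J = (if omega_gens \<subseteq> J then lk u (J - omega_gens) else 0)" .
  have sc: "gen_scale J = gen_scale (J - omega_gens)" if "omega_gens \<subseteq> J"
  proof (cases "finite J")
    case True
    have "gen_scale J = (\<Prod>p\<in>J - omega_gens. gen_norm p) * (\<Prod>p\<in>omega_gens. gen_norm p)"
      unfolding gen_scale_def by (rule prod.subset_diff[OF that True])
    then show ?thesis by (simp add: gen_scale_def)
  next
    case False
    then show ?thesis by (simp add: gen_scale_def)
  qed
  show "vals (wedge u omega) J = omega_ext (vals u) J"
    using sc by (simp add: vals_def lk omega_ext_def)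
qed

lemma gens_1_cases: "p \<in> gens 1 \<Longrightarrow> p \<in> omega_gens \<and> fst p = 1 \<or> p \<in> gens 2 \<and> fst p \<noteq> 1"
  by (cases p) (auto simp: gens_def le_Suc_eq)

lemma omega_signs:
  "J \<subseteq> gens 1 \<Longrightarrow> pos_sign (1, 0) J = 1"
  "J \<subseteq> gens 1 \<Longrightarrow> (1, 0) \<notin> J \<Longrightarrow> pos_sign (1, 1) J = 1"
proof -
  assume J: "J \<subseteq> gens 1"
  have "{q \<in> J. gen_less q (1, 0)} = {}" using J by (auto simp: gens_def gen_less_def)
  then show "pos_sign (1, 0) J = 1" by (simp only: pos_sign_def card.empty power_0)
  assume "(1, 0) \<notin> J"
  then have "{q \<in> J. gen_less q (1, 1)} = {}"
    using J by (auto simp: gens_def gen_less_def) (metis gr0I)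
  then show "pos_sign (1, 1) J = 1" by (simp only: pos_sign_def card.empty power_0)
qed

text \<open>Recovers the factor of \<open>\<omega>\<close>: on sets that contain both generators, \<open>F\<close> is given by its double
contraction, which inverts \<open>omega_ext\<close>.\<close>

lemma via_omega_contract:
  assumes "finite J" "J \<subseteq> gens 1" "omega_gens \<subseteq> J"
  shows "F J = contract (1, 1) (contract (1, 0) F) (J - omega_gens)"
proof -
  have d: "J - {(1, 0)} - {(1, 1)} = J - omega_gens" by auto
  have "F J = contract (1, 0) F (J - {(1, 0)})"
    using nonempty_via_contract[of J "(1, 0)" F] assms omega_signs(1)[of J] by simp
  also have "\<dots> = pos_sign (1, 1) (J - {(1, 0)}) * contract (1, 1) (contract (1, 0) F) (J - {(1, 0)} - {(1, 1)})"
    using assms by (intro nonempty_via_contract) auto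
  also have "pos_sign (1, 1) (J - {(1, 0)}) = 1"
    using assms by (intro omega_signs) auto
  finally show ?thesis by (simp only: d mult_1)
qed

lemma contract_omega_ext:
  assumes "finite K" "K \<subseteq> gens 2"
  shows "contract (1, 1) (contract (1, 0) (omega_ext F)) K = F K"
proof -
  have K: "(1, 0) \<notin> K" "(1, 1) \<notin> K" using assms(2) by (auto simp: gens_def)
  have K1: "K \<subseteq> gens 1" using assms(2) gens_subset[of 1 2] by auto
  have "(1, 1) \<in> gens 1" by (simp add: gens_def)
  then have "pos_sign (1, 1) K = 1" "pos_sign (1, 0) (insert (1, 1) K) = 1"
    using omega_signs(2)[OF K1 K(1)] omega_signs(1)[of "insert (1, 1) K"] K1 by blast+
  moreover have "insert (1, 0) (insert (1, 1) K) - omega_gens = K" using K by auto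
  ultimately show ?thesis using K assms(1) by (simp add: contract_def omega_ext_def)
qed

text \<open>Commuting \<open>L\<^sub>p\<close> with the two contractions produces the trace of \<open>p\<close> on \<open>S\<^sub>1\<close>, which is zero for
\<open>\<ss>\<pp>(2)\<close>.\<close>

theorem omega_ext_form:
  assumes F: "rel_form 2 m w F"
  shows "rel_form 1 (m + 2) (w - 2) (omega_ext F)"
  unfolding rel_form_def
proof (intro conjI allI impI)
  fix J assume "omega_ext F J \<noteq> 0"
  then have J: "omega_gens \<subseteq> J" "J - omega_gens \<in> rel_monomials 2 m w"
    using F by (auto simp: omega_ext_def rel_form_def split: if_splits)
  let ?I = "J - omega_gens"
  have I: "finite ?I" "?I \<subseteq> gens 2" "card ?I = m" "(\<Sum>p\<in>?I. gen_weight p) = w"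
    using J(2) by (auto simp: rel_monomials_def monomials_def)
  have fin: "finite J" using I(1) by (metis finite.emptyI finite.insertI finite_Diff2)
  have "card J = m + 2" using card_Diff_subset[of omega_gens J] J(1) I(3) fin card_mono[OF fin J(1)] by simp
  moreover have "(\<Sum>p\<in>J. gen_weight p) = w - 2"
    using sum.subset_diff[OF J(1) fin, of gen_weight] I(4) by (simp add: gen_weight_def)
  moreover have "J \<subseteq> gens 1"
  proof
    fix p assume "p \<in> J"
    then show "p \<in> gens 1" using I(2) gens_subset[of 1 2] by (cases "p \<in> omega_gens") (auto simp: gens_def)
  qed
  moreover have "\<forall>p\<in>J. fst p \<noteq> 2" using J(2) by (auto simp: rel_monomials_def)
  ultimately show "J \<in> rel_monomials 1 (m + 2) (w - 2)"
    using fin by (simp add: rel_monomials_def monomials_def)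
next
  fix i :: nat and J :: "gen set" assume i: "i \<le> 2" and J: "finite J" "J \<subseteq> gens 1"
  let ?G = "omega_ext F" and ?p = "(2, i)" and ?x = "(1, 0)" and ?y = "(1, 1)"
  show "lie_op ?p ?G J = 0"
  proof (cases "omega_gens \<subseteq> J")
    case True
    let ?K = "J - omega_gens"
    have K: "finite ?K" "?K \<subseteq> gens 2" using J gens_1_cases by blast+
    have "lie_op ?p ?G J = contract ?y (contract ?x (lie_op ?p ?G)) ?K"
      using J True by (rule via_omega_contract)
    also have "contract ?x (lie_op ?p ?G) = (\<lambda>J. 1 * lie_op ?p (contract ?x ?G) J +
        - struct_const ?p ?x * contract (gen_bracket ?p ?x) ?G J)"
      by (intro ext) (simp add: contract_lie_op)
    also have "contract ?y \<dots> ?K = contract ?y (lie_op ?p (contract ?x ?G)) ?K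
        - struct_const ?p ?x * contract ?y (contract (gen_bracket ?p ?x) ?G) ?K"
      by (subst contract_lin) simp
    also have "\<dots> = lie_op ?p (contract ?y (contract ?x ?G)) ?K
        - struct_const ?p ?y * contract (gen_bracket ?p ?y) (contract ?x ?G) ?K
        - struct_const ?p ?x * contract ?y (contract (gen_bracket ?p ?x) ?G) ?K"
      by (subst contract_lie_op) simp
    also have "lie_op ?p (contract ?y (contract ?x ?G)) ?K = lie_op ?p F ?K"
      using K i by (intro lie_op_cong[where k = 2] quad_in_gens contract_omega_ext) auto
    also have "\<dots> = 0" using K i by (intro rel_form_lie[OF F])
    also have "0 - struct_const ?p ?y * contract (gen_bracket ?p ?y) (contract ?x ?G) ?K
        - struct_const ?p ?x * contract ?y (contract (gen_bracket ?p ?x) ?G) ?K = 0"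
    proof -
      have "i = 0 \<or> i = 1 \<or> i = 2" using i by auto
      then show ?thesis using contract_anticommute[of ?x ?x ?G ?K] contract_anticommute[of ?y ?y ?G ?K]
        by auto
    qed
    finally show ?thesis .
  next
    case False
    show ?thesis
    proof (rule ccontr)
      assume "lie_op ?p ?G J \<noteq> 0"
      from lie_op_support[OF this] obtain q where q: "q \<in> J"
        "omega_ext F (insert (gen_bracket ?p q) (J - {q})) \<noteq> 0" by blast
      let ?b = "gen_bracket ?p q"
      have sub: "omega_gens \<subseteq> insert ?b (J - {q})" using q(2) by (auto simp: omega_ext_def split: if_splits)
      obtain z where z: "z \<in> omega_gens" "z \<notin> J" using False by blast
      then have "z \<in> insert ?b (J - {q})" by (intro subsetD[OF sub])
      then have "z = ?b" using z(2) by simp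
      moreover have "fst ?b = fst q" by (cases q) auto
      ultimately have "fst q = 1" using z(1) by auto
      then have "q \<in> omega_gens" using q(1) J(2) gens_1_cases[of q] by blast
      then have "q \<in> insert ?b (J - {q})" by (rule subsetD[OF sub])
      then show False using z(2) q(1) \<open>z = ?b\<close> by simp
    qed
  qed
qed

text \<open>The differentials of the two Lie algebras differ by terms with a factor \<open>z\<^sub>1\<close>, which the product
with \<open>\<omega>\<close> kills, and \<open>d\<omega>\<close> involves only \<open>z\<^sub>1\<close> and \<open>z\<^sub>2\<close>. In the proof the two Lie derivatives
from the Cartan formula vanish since brackets with \<open>S\<^sub>1\<close> from degree at least 3 stay outside \<open>S\<^sub>1\<close>.\<close>

theorem rel_diff_omega_ext:
  assumes F: "rel_form 2 m w F"
  shows "rel_diff 1 (omega_ext F) = omega_ext (rel_diff 2 F)"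
proof
  fix J
  let ?G = "omega_ext F" and ?x = "(1, 0)" and ?y = "(1, 1)"
  have L: "rel_form 1 (m + 2 + 1) (w - 2) (rel_diff 1 ?G)"
    using rel_diff_form[OF _ _ omega_ext_form[OF F]] by simp
  have R: "rel_form 2 (m + 1) w (rel_diff 2 F)"
    using rel_diff_form[OF _ _ F] by simp
  have R': "rel_form 1 (m + 1 + 2) (w - 2) (omega_ext (rel_diff 2 F))"
    by (rule omega_ext_form[OF R])
  show "rel_diff 1 ?G J = omega_ext (rel_diff 2 F) J"
  proof (cases "finite J \<and> J \<subseteq> gens 1 \<and> (\<forall>p\<in>J. fst p \<noteq> 2)")
    case False
    show ?thesis unfolding rel_form_outside[OF L False] rel_form_outside[OF R' False] ..
  next
    case True
    then have J: "finite J" "J \<subseteq> gens 1" and n2: "\<And>p. p \<in> J \<Longrightarrow> fst p \<noteq> 2" by auto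
    show ?thesis
    proof (cases "omega_gens \<subseteq> J")
      case True
      let ?K = "J - omega_gens"
      have K: "finite ?K" "?K \<subseteq> gens 2" using J gens_1_cases by blast+
      \<comment> \<open>one of the two generators of \<omega> remains missing after the bracket\<close>
      have lie0: "lie_op r (contract s ?G) ?K = 0" if "r \<in> omega_gens" "s \<in> omega_gens" "r \<noteq> s" for r s
      proof (rule ccontr)
        assume "lie_op r (contract s ?G) ?K \<noteq> 0"
        from lie_op_support[OF this] obtain q where q: "q \<in> ?K" "struct_const r q \<noteq> 0"
          "contract s ?G (insert (gen_bracket r q) (?K - {q})) \<noteq> 0" by blast
        let ?b = "gen_bracket r q"
        have "omega_ext F (insert s (insert ?b (?K - {q}))) \<noteq> 0"
          using q(3) by (auto simp: contract_def split: if_splits)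
        then have "r \<in> insert s (insert ?b (?K - {q}))" using that(1) by (auto simp: omega_ext_def split: if_splits)
        then have "r = ?b" using that by auto
        have "fst r = 1" using that(1) by auto
        have "q \<in> J" using q(1) by blast
        moreover have "q \<in> gens 2" using K(2) q(1) by blast
        ultimately have "fst q \<ge> 2" "fst q \<noteq> 2" using n2 by (auto simp: gens_def)
        moreover have "fst ?b = fst r + fst q - 2" by (cases r; cases q) auto
        ultimately have "fst ?b > 1" using \<open>fst r = 1\<close> by linarith
        then show False using \<open>r = ?b\<close> \<open>fst r = 1\<close> by simp
      qed
      have "diff_op ?G J = contract ?y (contract ?x (diff_op ?G)) ?K"
        using J True by (rule via_omega_contract)
      also have "contract ?x (diff_op ?G) = (\<lambda>J. 1 * lie_op ?x ?G J + - 1 * diff_op (contract ?x ?G) J)"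
        by (intro ext) (simp add: cartan_formula)
      also have "contract ?y \<dots> ?K = contract ?y (lie_op ?x ?G) ?K - contract ?y (diff_op (contract ?x ?G)) ?K"
        by (subst contract_lin) simp
      also have "\<dots> = lie_op ?x (contract ?y ?G) ?K - lie_op ?y (contract ?x ?G) ?K +
          diff_op (contract ?y (contract ?x ?G)) ?K"
        by (simp add: cartan_formula contract_lie_op)
      also have "\<dots> = diff_op (contract ?y (contract ?x ?G)) ?K"
        using lie0[of ?x ?y] lie0[of ?y ?x] by simp
      also have "\<dots> = diff_op F ?K"
        using K by (intro diff_op_cong[where k = 2] contract_omega_ext) auto
      finally have "diff_op ?G J = diff_op F ?K" .
      then show ?thesis using J K True by (simp add: rel_diff_def omega_ext_def[of "rel_diff 2 F" J])
    next
      case False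
      have "diff_op ?G J = 0"
      proof (rule ccontr)
        assume "diff_op ?G J \<noteq> 0"
        from diff_op_support[OF this] obtain q r where q: "q \<in> J" "r \<in> J" "struct_const q r \<noteq> 0"
          "omega_ext F (insert (gen_bracket q r) (J - {q, r})) \<noteq> 0" by blast
        let ?b = "gen_bracket q r"
        have sub: "omega_gens \<subseteq> insert ?b (J - {q, r})" using q(4) by (auto simp: omega_ext_def split: if_splits)
        obtain z where z: "z \<in> omega_gens" "z \<notin> J" using False by blast
        then have "z \<in> insert ?b (J - {q, r})" by (intro subsetD[OF sub])
        then have "?b \<in> omega_gens" using z by simp
        then have "fst ?b = 1" by (elim insertE emptyE) simp_all
        moreover have "fst ?b = fst q + fst r - 2" by (cases r; cases q) auto
        moreover have "q \<in> gens 1" "r \<in> gens 1" using q J(2) by blast+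
        then have "fst q \<ge> 1" "fst r \<ge> 1" by (auto simp: gens_def)
        ultimately have "fst q = 2 \<or> fst r = 2" by linarith
        then show False using n2 q by auto
      qed
      then show ?thesis using False by (auto simp: rel_diff_def omega_ext_def)
    qed
  qed
qed

section \<open>Torus weights and highest weight vectors\<close>

text \<open>The Lie derivative for \<open>x y\<close> multiplies the value at \<open>J\<close> by the sum of these numbers over \<open>J\<close>.\<close>

fun torus_weight :: "gen \<Rightarrow> int" where
  "torus_weight (A, a) = 2 * int a - int A"

lemma lie_op_torus:
  assumes "finite J" "J \<subseteq> gens 1"
  shows "lie_op (2, 1) F J = real_of_int (\<Sum>q\<in>J. torus_weight q) * F J"
proof -
  have "pos_sign q J * - (struct_const (2, 1) q * contract (gen_bracket (2, 1) q) F (J - {q})) =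
      real_of_int (torus_weight q) * F J" if q: "q \<in> J" for q
  proof -
    have "q \<in> gens 1" using q assms by blast
    then have "struct_const (2, 1) q = - torus_weight q" "gen_bracket (2, 1) q = q"
      by (cases q; auto simp: gens_def)+
    then show ?thesis using nonempty_via_contract[OF assms(1) q, of F] by simp
  qed
  then show ?thesis unfolding lie_op_def assemble_def by (simp add: sum_distrib_right)
qed

declare of_int_sum [simp del]

lemma rel_form_torus_weight:
  assumes "1 \<le> k" "rel_form k m w F" "F J \<noteq> 0"
  shows "(\<Sum>q\<in>J. torus_weight q) = 0"
proof -
  have J: "finite J" "J \<subseteq> gens k" using assms(2,3) by (auto simp: rel_form_def rel_monomials_def monomials_def)
  then have "lie_op (2, 1) F J = 0" using assms(2) by (intro rel_form_lie) auto
  moreover have "J \<subseteq> gens 1" using J gens_subset[OF assms(1)] by blast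
  ultimately show ?thesis using lie_op_torus[OF J(1), of F] assms(3) by simp
qed

lemma sl2_relation:
  assumes "finite J" "J \<subseteq> gens 1"
  shows "lie_op (2, 2) (lie_op (2, 0) F) J =
    lie_op (2, 0) (lie_op (2, 2) F) J + 4 * (real_of_int (\<Sum>q\<in>J. torus_weight q) * F J)"
proof -
  have g: "(2, 2) \<in> gens 1" "(2, 0) \<in> gens 1" by (auto simp: gens_def)
  show ?thesis using lie_op_bracket[OF assms g, of F] lie_op_torus[OF assms, of F] by simp
qed

text \<open>Brackets with \<open>S\<^sub>2\<close> preserve the degrees of the generators, so only the torus weight changes.\<close>

lemma rel_monomials_replace:
  assumes J: "finite J" "J \<subseteq> gens k" and q: "q \<in> J" "b \<notin> J - {q}" "fst b = fst q"
    and I: "insert b (J - {q}) \<in> rel_monomials k m w"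
  shows "J \<in> rel_monomials k m w"
    "(\<Sum>p\<in>J. torus_weight p) = (\<Sum>p\<in>insert b (J - {q}). torus_weight p) - torus_weight b + torus_weight q"
proof -
  let ?K = "J - {q}"
  have fK: "finite ?K" using J by auto
  have sum: "(\<Sum>p\<in>J. f p) = (\<Sum>p\<in>insert b ?K. f p) - f b + f q" for f :: "gen \<Rightarrow> int"
    using sum.remove[OF J(1) q(1), of f] fK q(2) by simp
  show "(\<Sum>p\<in>J. torus_weight p) = (\<Sum>p\<in>insert b ?K. torus_weight p) - torus_weight b + torus_weight q"
    by (rule sum)
  have "gen_weight b = gen_weight q" using q(3) by (cases b; cases q) (simp add: gen_weight_def)
  then have 1: "(\<Sum>p\<in>J. gen_weight p) = w"
    using I sum[of gen_weight] by (simp add: rel_monomials_def monomials_def)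
  have "card (insert b ?K) = m" using I by (simp add: rel_monomials_def monomials_def)
  then have 2: "card J = m" using fK q(2) card_Suc_Diff1[OF J(1) q(1)] by simp
  have "\<forall>p\<in>insert b ?K. fst p \<noteq> 2" using I unfolding rel_monomials_def by blast
  then have "\<forall>p\<in>J. fst p \<noteq> 2" using q(3) by auto
  then show "J \<in> rel_monomials k m w" using 1 2 J by (simp add: rel_monomials_def monomials_def)
qed

text \<open>Let \<open>f\<close> be the operator of \<open>y\<^sup>2\<close> and \<open>e\<close> that of \<open>x\<^sup>2\<close>. If \<open>e F = 0\<close> and \<open>F\<close> has weight zero, then
\<open>e f\<^sup>n\<^sup>+\<^sup>1 F = 4 n (n + 1) f\<^sup>n F\<close>. The powers \<open>f\<^sup>n F\<close> vanish for large \<open>n\<close>, as torus weights are bounded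
in fixed degree and weight; going down with this formula gives \<open>f F = 0\<close>.\<close>

theorem rel_form_highest_weight:
  assumes k: "1 \<le> k" "k \<le> 2"
    and supp: "\<And>J. F J \<noteq> 0 \<Longrightarrow> J \<in> rel_monomials k m w \<and> (\<Sum>q\<in>J. torus_weight q) = 0"
    and e: "\<And>J. finite J \<Longrightarrow> J \<subseteq> gens k \<Longrightarrow> lie_op (2, 2) F J = 0"
  shows "rel_form k m w F"
proof -
  have g1: "gens k \<subseteq> gens 1" using k gens_subset by blast
  have quad: "(2, i) \<in> gens k" if "i \<le> 2" for i using k that quad_in_gens by blast
  define lower where "lower = (\<lambda>G J. if finite J \<and> J \<subseteq> gens k then lie_op (2, 0) G J else 0)"
  define L where "L = (\<lambda>n. (lower ^^ n) F)"
  have L0: "L 0 = F" and LSuc: "L (Suc n) = lower (L n)" for n by (simp_all add: L_def)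
  have supp_L: "L n J \<noteq> 0 \<Longrightarrow> J \<in> rel_monomials k m w \<and> (\<Sum>q\<in>J. torus_weight q) = 2 * int n" for n J
  proof (induction n arbitrary: J)
    case 0
    then show ?case using supp by (simp add: L0)
  next
    case (Suc n)
    then have J: "finite J" "J \<subseteq> gens k" "lie_op (2, 0) (L n) J \<noteq> 0"
      by (auto simp: LSuc lower_def split: if_splits)
    from lie_op_support[OF J(3)] obtain q where q: "q \<in> J" "struct_const (2, 0) q \<noteq> 0"
      "gen_bracket (2, 0) q \<notin> J - {q}" "L n (insert (gen_bracket (2, 0) q) (J - {q})) \<noteq> 0" by blast
    let ?b = "gen_bracket (2, 0) q" and ?K = "J - {q}"
    obtain A a where Aa: "q = (A, Suc a)" "A > 0" using q(2) by (cases q; cases "snd q") (auto split: if_splits)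
    then have b: "?b = (A, a)" by simp
    have I: "insert ?b ?K \<in> rel_monomials k m w" "(\<Sum>p\<in>insert ?b ?K. torus_weight p) = 2 * int n"
      using Suc.IH[OF q(4)] by auto
    have f: "fst ?b = fst q" unfolding b Aa by simp
    show ?case using rel_monomials_replace[OF J(1,2) q(1,3) f I(1)] I(2) by (simp add: b Aa)
  qed
  \<comment> \<open>the relation \<open>e f = f e + 4 h\<close> on vectors of torus weight \<open>2 n\<close> adds \<open>8 n\<close> at each step\<close>
  have raise: "lie_op (2, 2) (L (Suc n)) J = 4 * real n * real (Suc n) * L n J"
    if "finite J" "J \<subseteq> gens k" for n J
    using that
  proof (induction n arbitrary: J)
    case 0
    have "lie_op (2, 2) (L (Suc 0)) J = lie_op (2, 2) (lie_op (2, 0) F) J"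
      using 0 k quad by (intro lie_op_cong[where k = k]) (auto simp: LSuc L0 lower_def)
    also have "\<dots> = lie_op (2, 0) (lie_op (2, 2) F) J + 4 * (real_of_int (\<Sum>q\<in>J. torus_weight q) * F J)"
      using 0 g1 by (intro sl2_relation) auto
    also have "lie_op (2, 0) (lie_op (2, 2) F) J = lie_op (2, 0) (\<lambda>J. 0 * F J + 0 * F J) J"
      using 0 k quad e by (intro lie_op_cong[where k = k]) auto
    finally show ?case using supp[of J] unfolding lie_op_lin by auto
  next
    case (Suc n)
    have "lie_op (2, 2) (L (Suc (Suc n))) J = lie_op (2, 2) (lie_op (2, 0) (L (Suc n))) J"
      using Suc.prems k quad by (intro lie_op_cong[where k = k]) (auto simp: LSuc[of "Suc n"] lower_def)
    also have "\<dots> = lie_op (2, 0) (lie_op (2, 2) (L (Suc n))) J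
        + 4 * (real_of_int (\<Sum>q\<in>J. torus_weight q) * L (Suc n) J)"
      using Suc.prems g1 by (intro sl2_relation) auto
    also have "lie_op (2, 0) (lie_op (2, 2) (L (Suc n))) J =
        lie_op (2, 0) (\<lambda>J. 4 * real n * real (Suc n) * L n J + 0 * F J) J"
      using Suc k quad by (intro lie_op_cong[where k = k]) auto
    also have "\<dots> = 4 * real n * real (Suc n) * lie_op (2, 0) (L n) J"
      unfolding lie_op_lin by simp
    also have "lie_op (2, 0) (L n) J = L (Suc n) J" using Suc.prems by (simp add: LSuc lower_def)
    also have "real_of_int (\<Sum>q\<in>J. torus_weight q) * L (Suc n) J = 2 * real (Suc n) * L (Suc n) J"
      using supp_L[of "Suc n" J] by (cases "L (Suc n) J = 0") auto
    finally show ?case by (simp add: algebra_simps)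
  qed
  have vanish: "L n = (\<lambda>J. 0)" if "2 * int n > w + 2 * int m" for n
  proof (rule ext, rule ccontr)
    fix J assume "L n J \<noteq> 0"
    then have J: "J \<in> rel_monomials k m w" "(\<Sum>q\<in>J. torus_weight q) = 2 * int n" using supp_L by auto
    have "J \<subseteq> gens k" using J(1) by (auto simp: rel_monomials_def monomials_def)
    have "(\<Sum>q\<in>J. torus_weight q) \<le> (\<Sum>q\<in>J. gen_weight q + 2)"
    proof (rule sum_mono)
      fix q assume "q \<in> J"
      then have "q \<in> gens k" using \<open>J \<subseteq> gens k\<close> by blast
      then show "torus_weight q \<le> gen_weight q + 2" by (cases q) (auto simp: gens_def gen_weight_def)
    qed
    also have "\<dots> = w + 2 * int m" using J(1) by (simp add: sum.distrib rel_monomials_def monomials_def)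
    finally show False using that J(2) by simp
  qed
  have "L (Suc n) = (\<lambda>J. 0)" for n
  proof -
    have "L (Suc n + d) = (\<lambda>J. 0) \<Longrightarrow> L (Suc n) = (\<lambda>J. 0)" for d
    proof (induction d)
      case (Suc d)
      have "L (Suc n + d) J = 0" for J
      proof (rule ccontr)
        assume nz: "L (Suc n + d) J \<noteq> 0"
        then have J: "finite J" "J \<subseteq> gens k" using supp_L by (auto simp: rel_monomials_def monomials_def)
        have z: "L (Suc (Suc n + d)) = (\<lambda>J. 0 * F J + 0 * F J)" using Suc.prems by simp
        have "lie_op (2, 2) (L (Suc (Suc n + d))) J = 0"
          unfolding z lie_op_lin by simp
        then show False using raise[OF J, of "Suc n + d"] nz by (simp del: of_nat_Suc)
      qed
      then show ?case using Suc.IH by blast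
    qed simp
    moreover have "L (Suc n + nat (w + 2 * int m + 1)) = (\<lambda>J. 0)" by (rule vanish) auto
    ultimately show ?thesis by blast
  qed
  then have f: "lower F = (\<lambda>J. 0)" using LSuc[of 0] L0 by metis
  show ?thesis unfolding rel_form_def
  proof (intro conjI allI impI)
    fix J assume "F J \<noteq> 0"
    then show "J \<in> rel_monomials k m w" using supp by blast
  next
    fix i :: nat and J :: "gen set" assume i: "i \<le> 2" and J: "finite J" "J \<subseteq> gens k"
    consider "i = 0" | "i = 1" | "i = 2" using i by linarith
    then show "lie_op (2, i) F J = 0"
    proof cases
      case 1
      then show ?thesis using fun_cong[OF f, of J] J by (simp add: lower_def)
    next
      case 2
      have "J \<subseteq> gens 1" using J g1 by blast
      then show ?thesis using lie_op_torus[OF J(1), of F] supp[of J] 2 by auto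
    next
      case 3
      then show ?thesis using e J by simp
    qed
  qed
qed

section \<open>More unknowns than equations\<close>

text \<open>Stated for linear functionals on functions, so that the values of \<open>lie_op\<close> and \<open>rel_diff\<close> can be
used as equations without writing down a matrix. In the induction step, two solutions of the
earlier equations are combined, the second of which vanishes at a point where the first does not.\<close>

lemma nonzero_solution:
  fixes l :: "'e \<Rightarrow> ('s \<Rightarrow> real) \<Rightarrow> real"
  assumes lin: "\<And>e a b x y. l e (\<lambda>s. a * x s + b * y s) = a * l e x + b * l e y"
    and "finite E" "finite S" "card E < card S"
  shows "\<exists>x. (\<exists>s. x s \<noteq> 0) \<and> (\<forall>s. x s \<noteq> 0 \<longrightarrow> s \<in> S) \<and> (\<forall>e\<in>E. l e x = 0)"
  using assms(2-4)
proof (induction E arbitrary: S rule: finite_induct)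
  case empty
  then obtain s where "s \<in> S" by fastforce
  then show ?case by (intro exI[of _ "\<lambda>t. if t = s then 1 else 0"]) auto
next
  case (insert e E)
  obtain s where s: "s \<in> S" using insert by fastforce
  have "card E < card (S - {s})" using insert s by (simp add: card_Diff_singleton)
  then obtain x where x: "\<exists>t. x t \<noteq> 0" "\<And>t. x t \<noteq> 0 \<Longrightarrow> t \<in> S - {s}" "\<And>e. e \<in> E \<Longrightarrow> l e x = 0"
    using insert.IH[of "S - {s}"] insert.prems by blast
  obtain t where t: "x t \<noteq> 0" using x(1) by blast
  have "t \<in> S" using x(2)[OF t] by blast
  then have "card E < card (S - {t})" using insert by (simp add: card_Diff_singleton)
  then obtain y where y: "\<exists>t. y t \<noteq> 0" "\<And>r. y r \<noteq> 0 \<Longrightarrow> r \<in> S - {t}" "\<And>e. e \<in> E \<Longrightarrow> l e y = 0"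
    using insert.IH[of "S - {t}"] insert.prems by blast
  show ?case
  proof (cases "l e y = 0")
    case True
    then show ?thesis using y by (intro exI[of _ y]) auto
  next
    case False
    let ?z = "\<lambda>s. l e y * x s + (- l e x) * y s"
    have "y t = 0" using y(2)[of t] by blast
    then have "?z t \<noteq> 0" using t False by simp
    moreover have "r \<in> S" if "?z r \<noteq> 0" for r
    proof -
      have "x r \<noteq> 0 \<or> y r \<noteq> 0" using that by auto
      then show ?thesis using x(2)[of r] y(2)[of r] by blast
    qed
    moreover have "l d ?z = 0" if "d \<in> insert e E" for d
      unfolding lin using that x(3)[of d] y(3)[of d] by auto
    ultimately show ?thesis by (intro exI[of _ ?z]) blast
  qed
qed

declare of_int_sum [simp]

section \<open>Evaluation on lists of generators\<close>

text \<open>The value on an arbitrary tuple of monomials: successive contraction extends a function on sets to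
an alternating function on lists, without any explicit sign.\<close>

fun on_list :: "(gen set \<Rightarrow> real) \<Rightarrow> gen list \<Rightarrow> real" where
  "on_list F [] = F {}"
| "on_list F (p # ps) = on_list (contract p F) ps"

lemma on_list_lin: "on_list (\<lambda>J. a * F J + b * G J) ps = a * on_list F ps + b * on_list G ps"
proof (induction ps arbitrary: F G)
  case (Cons p ps)
  have "contract p (\<lambda>J. a * F J + b * G J) = (\<lambda>J. a * contract p F J + b * contract p G J)"
    by (intro ext contract_lin)
  then show ?case by (simp add: Cons.IH)
qed simp

lemma on_list_cong:
  assumes "set ps \<subseteq> X" "\<And>J. finite J \<Longrightarrow> J \<subseteq> X \<Longrightarrow> F J = G J"
  shows "on_list F ps = on_list G ps"
  using assms
proof (induction ps arbitrary: F G)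
  case (Cons p ps)
  have p: "p \<in> X" "set ps \<subseteq> X" using Cons.prems(1) by auto
  have c: "contract p F J = contract p G J" if "finite J" "J \<subseteq> X" for J
    using Cons.prems(2)[of "insert p J"] that p by (simp add: contract_def)
  show ?case using Cons.IH[OF p(2) c] by simp
qed simp

lemma on_list_swap: "on_list F (p # q # ps) = - on_list F (q # p # ps)"
  using on_list_lin[of "- 1" "contract p (contract q F)" 0 "\<lambda>_. 0" ps] contract_anticommute'[of q p F]
  by simp

lemma on_list_repeat: "on_list F (p # p # ps) = 0"
  using on_list_swap[of F p p ps] by simp

lemma on_list_sorted: "sorted_wrt gen_less ps \<Longrightarrow> on_list F ps = F (set ps)"
proof (induction ps arbitrary: F)
  case (Cons p ps)
  have "{q \<in> set ps. gen_less q p} = {}" using Cons.prems gen_less_asym by auto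
  then have "pos_sign p (set ps) = 1" by (simp only: pos_sign_def card.empty power_0)
  moreover have "p \<notin> set ps" using Cons.prems by auto
  ultimately show ?case using Cons by (simp add: contract_def)
qed simp

type_synonym terms = "(int \<times> gen list) list"

definition eval_terms :: "(gen set \<Rightarrow> real) \<Rightarrow> terms \<Rightarrow> real" where
  "eval_terms F ts = (\<Sum>(c, ps)\<leftarrow>ts. of_int c * on_list F ps)"

lemma eval_terms_simps [simp]:
  "eval_terms F [] = 0"
  "eval_terms F ((c, ps) # ts) = of_int c * on_list F ps + eval_terms F ts"
  "eval_terms F (ts @ us) = eval_terms F ts + eval_terms F us"
  by (simp_all add: eval_terms_def)

lemma eval_terms_lin:
  "eval_terms (\<lambda>J. a * F J + b * G J) ts = a * eval_terms F ts + b * eval_terms G ts"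
  by (induction ts) (auto simp: on_list_lin algebra_simps)

definition prefix_terms :: "gen \<Rightarrow> terms \<Rightarrow> terms" where
  "prefix_terms p ts = map (\<lambda>(c, ps). (c, p # ps)) ts"

definition scale_terms :: "int \<Rightarrow> terms \<Rightarrow> terms" where
  "scale_terms d ts = map (\<lambda>(c, ps). (d * c, ps)) ts"

lemma eval_prefix [simp]: "eval_terms F (prefix_terms p ts) = eval_terms (contract p F) ts"
  by (induction ts) (auto simp: prefix_terms_def)

lemma eval_scale [simp]: "eval_terms F (scale_terms d ts) = of_int d * eval_terms F ts"
  by (induction ts) (auto simp: scale_terms_def algebra_simps)

text \<open>The value of \<open>- L\<^sub>x F\<close> on a list as a combination of values of \<open>F\<close>: each entry in turn is replaced by
its bracket with \<open>x\<close>.\<close>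

fun lie_terms :: "gen \<Rightarrow> gen list \<Rightarrow> terms" where
  "lie_terms x [] = []"
| "lie_terms x (p # ps) = (struct_const x p, gen_bracket x p # ps) # prefix_terms p (lie_terms x ps)"

text \<open>The value of \<open>- d F\<close> on a list, from \<open>i\<^sub>p d = L\<^sub>p - d i\<^sub>p\<close> for the first entry \<open>p\<close>.\<close>

fun diff_terms :: "gen list \<Rightarrow> terms" where
  "diff_terms [] = []"
| "diff_terms (p # ps) = lie_terms p ps @ scale_terms (- 1) (prefix_terms p (diff_terms ps))"

lemma on_list_lie_op: "on_list (lie_op x F) ps = - eval_terms F (lie_terms x ps)"
proof (induction ps arbitrary: F)
  case (Cons p ps)
  have "contract p (lie_op x F) =
      (\<lambda>J. 1 * lie_op x (contract p F) J + - struct_const x p * contract (gen_bracket x p) F J)"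
    by (intro ext) (simp add: contract_lie_op)
  then show ?case by (simp only: on_list.simps on_list_lin) (simp add: Cons.IH)
qed simp

lemma on_list_diff_op: "on_list (diff_op F) ps = - eval_terms F (diff_terms ps)"
proof (induction ps arbitrary: F)
  case (Cons p ps)
  have "contract p (diff_op F) = (\<lambda>J. 1 * lie_op p F J + - 1 * diff_op (contract p F) J)"
    by (intro ext) (simp add: cartan_formula)
  then show ?case by (simp only: on_list.simps on_list_lin) (simp add: Cons.IH on_list_lie_op)
qed simp

text \<open>A repeated generator makes the value zero; the result is then a zero coefficient with an arbitrary
list.\<close>

fun signed_insert :: "gen \<Rightarrow> gen list \<Rightarrow> int \<times> gen list" where
  "signed_insert p [] = (1, [p])"
| "signed_insert p (q # qs) = (if p = q then (0, []) else if gen_less p q then (1, p # q # qs)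
     else (case signed_insert p qs of (s, rs) \<Rightarrow> (- s, q # rs)))"

fun signed_sort :: "gen list \<Rightarrow> int \<times> gen list" where
  "signed_sort [] = (1, [])"
| "signed_sort (p # ps) = (case signed_sort ps of (s, qs) \<Rightarrow>
     (case signed_insert p qs of (t, rs) \<Rightarrow> (s * t, rs)))"

fun same_list :: "gen list \<Rightarrow> gen list \<Rightarrow> bool" where
  "same_list [] [] = True"
| "same_list ((A, a) # ps) ((B, b) # qs) =
     (if a = b then (if A = B then same_list ps qs else False) else False)"
| "same_list _ _ = False"

text \<open>Tests are passed as arguments to auxiliary functions, here and below, rather than made by
conditional expressions: rewriting with conditionals would visit the long list again at every
test.\<close>

fun listed :: "gen list \<Rightarrow> gen list list \<Rightarrow> bool"
  and listed_or :: "bool \<Rightarrow> gen list \<Rightarrow> gen list list \<Rightarrow> bool" where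
  "listed ps [] = False"
| "listed ps (qs # qss) = listed_or (same_list ps qs) ps qss"
| "listed_or True ps qss = True"
| "listed_or False ps qss = listed ps qss"

lemma same_list_iff [simp]: "same_list ps qs \<longleftrightarrow> ps = qs"
  by (induction ps qs rule: same_list.induct) auto

lemma listed_iff [simp]: "listed ps qss \<longleftrightarrow> ps \<in> set qss"
proof (induction qss)
  case (Cons qs qss)
  then show ?case by (cases "ps = qs") simp_all
qed simp

fun cons_term :: "int \<Rightarrow> bool \<Rightarrow> gen list \<Rightarrow> terms \<Rightarrow> terms" where
  "cons_term c True ps ts = ts"
| "cons_term c False ps ts = (c, ps) # ts"

fun add_term :: "int \<Rightarrow> gen list \<Rightarrow> terms \<Rightarrow> terms"
  and add_here :: "bool \<Rightarrow> int \<Rightarrow> gen list \<Rightarrow> int \<Rightarrow> gen list \<Rightarrow> terms \<Rightarrow> terms" where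
  "add_term c ps [] = cons_term c (c = 0) ps []"
| "add_term c ps ((d, qs) # ts) = add_here (same_list ps qs) c ps d qs ts"
| "add_here True c ps d qs ts = cons_term (c + d) (c + d = 0) qs ts"
| "add_here False c ps d qs ts = (d, qs) # add_term c ps ts"

fun add_sorted :: "int \<Rightarrow> int \<times> gen list \<Rightarrow> terms \<Rightarrow> terms" where
  "add_sorted c (s, ps) ts = add_term (c * s) ps ts"

fun normal_form :: "terms \<Rightarrow> terms" where
  "normal_form [] = []"
| "normal_form ((c, ps) # ts) = add_sorted c (signed_sort ps) (normal_form ts)"

lemma on_list_signed_insert: "signed_insert p qs = (s, rs) \<Longrightarrow> on_list F (p # qs) = of_int s * on_list F rs"
proof (induction p qs arbitrary: F s rs rule: signed_insert.induct)
  case (2 p q qs)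
  show ?case
  proof (cases "p = q \<or> gen_less p q")
    case True
    then show ?thesis using 2(2) on_list_repeat[of F q qs] by (auto split: if_splits)
  next
    case False
    obtain t us where t: "signed_insert p qs = (t, us)" by fastforce
    have "on_list F (p # q # qs) = - on_list (contract q F) (p # qs)" using on_list_swap[of F p q qs] by simp
    also have "\<dots> = - (of_int t * on_list (contract q F) us)" using 2(1)[OF _ _ t] False by simp
    finally show ?thesis using 2(2) False t by auto
  qed
qed simp

lemma on_list_signed_sort: "signed_sort ps = (s, qs) \<Longrightarrow> on_list F ps = of_int s * on_list F qs"
proof (induction ps arbitrary: F s qs)
  case (Cons p ps)
  obtain t us where t: "signed_sort ps = (t, us)" by fastforce
  obtain r vs where r: "signed_insert p us = (r, vs)" by fastforce
  have "on_list F (p # ps) = of_int t * on_list (contract p F) us" using Cons.IH[OF t] by simp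
  also have "on_list (contract p F) us = of_int r * on_list F vs" using on_list_signed_insert[OF r] by simp
  finally show ?case using Cons.prems t r by auto
qed simp

lemma eval_cons_term:
  "b = (c = 0) \<Longrightarrow> eval_terms F (cons_term c b ps ts) = of_int c * on_list F ps + eval_terms F ts"
  by (cases b) auto

lemma eval_add_term: "eval_terms F (add_term c ps ts) = of_int c * on_list F ps + eval_terms F ts"
proof (induction ts)
  case (Cons t ts)
  obtain d qs where t: "t = (d, qs)" by fastforce
  show ?case
    using Cons.IH by (cases "ps = qs") (simp_all add: t eval_cons_term algebra_simps)
qed (simp add: eval_cons_term)

lemma eval_normal_form: "eval_terms F (normal_form ts) = eval_terms F ts"
proof (induction ts)
  case (Cons t ts)
  obtain c ps where t: "t = (c, ps)" by fastforce
  obtain s qs where s: "signed_sort ps = (s, qs)" by fastforce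
  show ?case using Cons.IH by (simp add: t s on_list_signed_sort[OF s] eval_add_term)
qed simp

lemma cons_term_nonzero:
  "b = (c = 0) \<Longrightarrow> \<forall>(d, qs)\<in>set ts. d \<noteq> 0 \<Longrightarrow> \<forall>(d, qs)\<in>set (cons_term c b ps ts). d \<noteq> 0"
  by (cases b) auto

lemma add_term_nonzero:
  "\<forall>(d, qs)\<in>set ts. d \<noteq> 0 \<Longrightarrow> \<forall>(d, qs)\<in>set (add_term c ps ts). d \<noteq> 0"
proof (induction ts)
  case (Cons t ts)
  obtain d qs where t: "t = (d, qs)" by fastforce
  show ?case
  proof (cases "ps = qs")
    case True
    then show ?thesis using Cons.prems cons_term_nonzero[of "c + d = 0" "c + d" ts qs] by (simp add: t)
  next
    case False
    then show ?thesis using Cons by (simp add: t)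
  qed
qed (use cons_term_nonzero[of "c = 0" c "[]" ps] in simp)

lemma normal_form_nonzero: "\<forall>(d, qs)\<in>set (normal_form ts). d \<noteq> 0"
proof (induction ts)
  case (Cons t ts)
  obtain c ps where t: "t = (c, ps)" by fastforce
  obtain s qs where s: "signed_sort ps = (s, qs)" by fastforce
  show ?case using add_term_nonzero[OF Cons.IH] by (simp add: t s)
qed simp

section \<open>Elimination\<close>

text \<open>Linear relations between the values of an invariant cocycle: \<open>Inv i ps\<close> says that the Lie
derivative with respect to \<open>x\<^sup>i y\<^sup>2\<^sup>-\<^sup>i\<close> vanishes on \<open>ps\<close>, \<open>Cls ps\<close> that the differential
does, and \<open>Aux\<close> stands for one further relation, given as a parameter.\<close>

datatype relation = Inv nat "gen list" | Cls "gen list" | Aux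

definition valid_gens :: "nat \<Rightarrow> gen list \<Rightarrow> bool" where
  "valid_gens k ps \<longleftrightarrow> list_all (\<lambda>(A, a). k \<le> A \<and> a \<le> A) ps"

fun relation_terms :: "nat \<Rightarrow> terms \<Rightarrow> relation \<Rightarrow> terms" where
  "relation_terms k ex (Inv i ps) = (if i \<le> 2 \<and> valid_gens k ps then lie_terms (2, i) ps else [])"
| "relation_terms k ex (Cls ps) = (if valid_gens k ps then diff_terms ps else [])"
| "relation_terms k ex Aux = ex"

fun combine :: "nat \<Rightarrow> terms \<Rightarrow> (int \<times> relation) list \<Rightarrow> terms" where
  "combine k ex [] = []"
| "combine k ex ((c, r) # rs) = scale_terms c (relation_terms k ex r) @ combine k ex rs"

lemma eval_combine: "eval_terms F (combine k ex rs) =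
    (\<Sum>(c, r)\<leftarrow>rs. of_int c * eval_terms F (relation_terms k ex r))"
  by (induction rs) auto

lemma valid_gensD: "valid_gens k ps \<Longrightarrow> set ps \<subseteq> gens k"
  by (auto simp: valid_gens_def gens_def list_all_iff)

lemma eval_lie_terms:
  assumes "rel_form k m w F" "i \<le> 2" "set ps \<subseteq> gens k"
  shows "eval_terms F (lie_terms (2, i) ps) = 0"
proof -
  have "on_list (lie_op (2, i) F) ps = on_list (\<lambda>J. 0 * F J + 0 * F J) ps"
    using rel_form_lie[OF assms(1,2)] by (intro on_list_cong[OF assms(3)]) simp
  then show ?thesis unfolding on_list_lin on_list_lie_op by simp
qed

lemma eval_diff_terms:
  assumes "set ps \<subseteq> gens k"
  shows "eval_terms F (diff_terms ps) = - on_list (rel_diff k F) ps"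
proof -
  have "on_list (diff_op F) ps = on_list (rel_diff k F) ps"
    by (intro on_list_cong[OF assms]) (simp add: rel_diff_def)
  then show ?thesis unfolding on_list_diff_op by simp
qed

lemma eval_relation:
  assumes "rel_form k m w F" "rel_diff k F = (\<lambda>J. 0)" "eval_terms F ex = 0"
  shows "eval_terms F (relation_terms k ex r) = 0"
proof (cases r)
  case (Inv i ps)
  then show ?thesis using eval_lie_terms[OF assms(1)] valid_gensD by auto
next
  case (Cls ps)
  have "on_list (\<lambda>J. 0) ps = (0::real)" using on_list_lin[of 0 F 0 F ps] by simp
  then show ?thesis using Cls eval_diff_terms[of ps k F] valid_gensD assms(2) by auto
qed (use assms in simp)

fun drop_term :: "bool \<Rightarrow> int \<Rightarrow> gen list \<Rightarrow> terms \<Rightarrow> terms" where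
  "drop_term True c ps ts = ts"
| "drop_term False c ps ts = (c, ps) # ts"

fun unknown_terms :: "terms \<Rightarrow> gen list list \<Rightarrow> terms" where
  "unknown_terms [] known = []"
| "unknown_terms ((c, ps) # ts) known = drop_term (listed ps known) c ps (unknown_terms ts known)"

text \<open>If exactly one term of a relation is not yet known to vanish, then it vanishes.\<close>

fun learn :: "terms \<Rightarrow> gen list list \<Rightarrow> gen list list" where
  "learn [] known = known"
| "learn [(c, ps)] known = ps # known"
| "learn (s # t # ts) known = known"

text \<open>A combination of relations that leaves more than one unknown term is ignored; so soundness does not
depend on the quality of the list of combinations.\<close>

fun eliminate :: "nat \<Rightarrow> terms \<Rightarrow> (int \<times> relation) list list \<Rightarrow> gen list list \<Rightarrow> gen list list" where
  "eliminate k ex [] known = known"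
| "eliminate k ex (rs # cert) known =
     eliminate k ex cert (learn (unknown_terms (normal_form (combine k ex rs)) known) known)"

lemma unknown_terms_eq: "unknown_terms ts known = filter (\<lambda>(c, ps). ps \<notin> set known) ts"
proof (induction ts)
  case (Cons t ts)
  obtain c ps where t: "t = (c, ps)" by fastforce
  show ?case using Cons.IH by (cases "ps \<in> set known") (simp_all add: t)
qed simp

lemma learn_sound:
  assumes "eval_terms F ts = 0" "\<forall>(c, ps)\<in>set ts. c \<noteq> 0" "\<forall>ps\<in>set known. on_list F ps = 0"
  shows "\<forall>ps\<in>set (learn (unknown_terms ts known) known). on_list F ps = 0"
proof -
  have "eval_terms F us = eval_terms F (unknown_terms us known)" for us
    unfolding unknown_terms_eq using assms(3) by (induction us) auto
  then have 0: "eval_terms F (unknown_terms ts known) = 0" using assms(1) by metis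
  have nz: "\<forall>(c, ps)\<in>set (unknown_terms ts known). c \<noteq> 0"
    using assms(2) unfolding unknown_terms_eq by auto
  show ?thesis using 0 nz assms(3)
    by (cases "(unknown_terms ts known, known)" rule: learn.cases) auto
qed

lemma eliminate_sound:
  assumes rel: "\<And>r. eval_terms F (relation_terms k ex r) = 0"
    and known: "\<forall>ps\<in>set known. on_list F ps = 0"
  shows "\<forall>ps\<in>set (eliminate k ex cert known). on_list F ps = 0"
  using known
proof (induction cert arbitrary: known)
  case (Cons rs cert)
  have "eval_terms F (normal_form (combine k ex rs)) = 0"
    by (simp add: eval_normal_form eval_combine rel case_prod_unfold)
  then show ?case
    using Cons.IH[OF learn_sound[OF _ normal_form_nonzero Cons.prems]] by simp
qed simp

section \<open>Enumeration of the monomials\<close>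

text \<open>Sublists of \<open>m\<close> generators with \<open>\<Sum> (A - 2) = w\<close> and torus weight \<open>h\<close>. The list of generators is
sorted by degree, so a branch ends as soon as \<open>m\<close> more generators would exceed the weight.\<close>

fun monomial_lists :: "gen list \<Rightarrow> nat \<Rightarrow> nat \<Rightarrow> int \<Rightarrow> gen list list" where
  "monomial_lists [] m w h = (if m = 0 \<and> w = 0 \<and> h = 0 then [[]] else [])"
| "monomial_lists (p # gs) m w h =
     (if m = 0 then (if w = 0 \<and> h = 0 then [[]] else [])
      else if w < m * (fst p - 2) then []
      else map ((#) p) (monomial_lists gs (m - 1) (w - (fst p - 2)) (h - torus_weight p)) @
        monomial_lists gs m w h)"

definition list_weight :: "gen set \<Rightarrow> nat" where
  "list_weight I = (\<Sum>p\<in>I. fst p - 2)"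

lemma monomial_lists_sound:
  assumes "sorted_wrt gen_less gs" "ps \<in> set (monomial_lists gs m w h)"
  shows "set ps \<subseteq> set gs \<and> sorted_wrt gen_less ps \<and> card (set ps) = m \<and>
    list_weight (set ps) = w \<and> (\<Sum>p\<in>set ps. torus_weight p) = h"
  using assms
proof (induction gs m w h arbitrary: ps rule: monomial_lists.induct)
  case (1 m w h)
  then show ?case by (auto simp: list_weight_def split: if_splits)
next
  case (2 p gs m w h)
  show ?case
  proof (cases "m = 0 \<or> w < m * (fst p - 2)")
    case True
    then show ?thesis using 2(4) by (auto simp: list_weight_def split: if_splits)
  next
    case False
    then have nz: "m \<noteq> 0" "\<not> w < m * (fst p - 2)" by auto
    then have w: "fst p - 2 \<le> w" by (metis One_nat_def Suc_leI le_trans mult.commute mult_le_mono2 nat_mult_1_right neq0_conv not_less)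
    consider "ps \<in> set (monomial_lists gs m w h)" |
      qs where "ps = p # qs" "qs \<in> set (monomial_lists gs (m - 1) (w - (fst p - 2)) (h - torus_weight p))"
      using 2(4) nz by auto
    then show ?thesis
    proof cases
      case 1
      then show ?thesis using 2(2)[OF nz] 2(3) by auto
    next
      case (2 qs)
      have IH: "set qs \<subseteq> set gs \<and> sorted_wrt gen_less qs \<and> card (set qs) = m - 1 \<and>
        list_weight (set qs) = w - (fst p - 2) \<and> (\<Sum>p\<in>set qs. torus_weight p) = h - torus_weight p"
        using "2.IH"(1)[OF nz _ 2(2)] "2.prems" by simp
      have "p \<notin> set gs" using "2.prems"(1) by auto
      then have "p \<notin> set qs" using IH by blast
      then show ?thesis using IH 2(1) "2.prems"(1) nz w by (auto simp: list_weight_def)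
    qed
  qed
qed

lemma monomial_lists_complete:
  assumes "sorted_wrt gen_less gs" "I \<subseteq> set gs" "card I = m" "list_weight I = w" "(\<Sum>p\<in>I. torus_weight p) = h"
  shows "\<exists>ps\<in>set (monomial_lists gs m w h). set ps = I"
  using assms
proof (induction gs m w h arbitrary: I rule: monomial_lists.induct)
  case (1 m w h)
  then show ?case by (auto simp: list_weight_def)
next
  case (2 p gs m w h)
  have fin: "finite I" using 2(4) finite_subset by blast
  have ge: "fst p \<le> fst q" if "q \<in> I" for q
  proof -
    have "q = p \<or> gen_less p q" using 2(3,4) that by auto
    then show ?thesis by (auto simp: gen_less_def split: prod.splits)
  qed
  show ?case
  proof (cases "m = 0")
    case True
    then have "I = {}" using 2(5) fin by simp
    then show ?thesis using 2(6,7) True by (auto simp: list_weight_def)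
  next
    case m: False
    have "(\<Sum>q\<in>I. fst p - 2) \<le> (\<Sum>q\<in>I. fst q - 2)" using ge by (intro sum_mono) (simp add: diff_le_mono)
    then have w: "\<not> w < m * (fst p - 2)" using 2(5,6) by (simp add: list_weight_def)
    show ?thesis
    proof (cases "p \<in> I")
      case False
      then have "I \<subseteq> set gs" using 2(4) by auto
      then have "\<exists>ps\<in>set (monomial_lists gs m w h). set ps = I"
        using 2(2)[OF m w] 2(3,5,6,7) by simp
      then show ?thesis using m w by auto
    next
      case True
      let ?K = "I - {p}"
      have K: "?K \<subseteq> set gs" "card ?K = m - 1" using 2(4,5) True fin by (auto simp: card_Diff_singleton)
      have "list_weight I = (fst p - 2) + list_weight ?K"
        unfolding list_weight_def using fin True by (rule sum.remove)
      then have Kw: "list_weight ?K = w - (fst p - 2)" using 2(6) by simp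
      have "(\<Sum>q\<in>I. torus_weight q) = torus_weight p + (\<Sum>q\<in>?K. torus_weight q)"
        using fin True by (rule sum.remove)
      then have Kh: "(\<Sum>q\<in>?K. torus_weight q) = h - torus_weight p" using 2(7) by simp
      have "sorted_wrt gen_less gs" using 2(3) by simp
      then obtain qs where "qs \<in> set (monomial_lists gs (m - 1) (w - (fst p - 2)) (h - torus_weight p))" "set qs = ?K"
        using 2(1)[OF m w _ K Kw Kh] by blast
      then show ?thesis using m w True by (intro bexI[of _ "p # qs"]) auto
    qed
  qed
qed

lemma monomial_lists_distinct:
  assumes "sorted_wrt gen_less gs"
  shows "distinct (map set (monomial_lists gs m w h))"
  using assms
proof (induction gs m w h rule: monomial_lists.induct)
  case (2 p gs m w h)
  show ?case
  proof (cases "m = 0 \<or> w < m * (fst p - 2)")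
    case True
    then show ?thesis by auto
  next
    case False
    then have nz: "m \<noteq> 0" "\<not> w < m * (fst p - 2)" by auto
    let ?X = "monomial_lists gs (m - 1) (w - (fst p - 2)) (h - torus_weight p)" and ?Y = "monomial_lists gs m w h"
    have gs: "sorted_wrt gen_less gs" and p: "p \<notin> set gs" using 2(3) by auto
    have nX: "p \<notin> set ps" if "ps \<in> set ?X" for ps using monomial_lists_sound[OF gs that] p by blast
    have nY: "p \<notin> set ps" if "ps \<in> set ?Y" for ps using monomial_lists_sound[OF gs that] p by blast
    have "map set (map ((#) p) ?X) = map (insert p) (map set ?X)" by simp
    moreover have "inj_on (insert p) (set (map set ?X))"
      using nX by (intro inj_onI) (auto simp: insert_ident)
    ultimately have "distinct (map set (map ((#) p) ?X))"
      using 2(1)[OF nz gs] by (simp only: distinct_map)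
    moreover have "set (map set (map ((#) p) ?X)) \<inter> set (map set ?Y) = {}" using nY by force
    ultimately show ?thesis using 2(2)[OF nz gs] nz by simp
  qed
qed auto

fun covers :: "gen list list \<Rightarrow> gen list list \<Rightarrow> bool"
  and covers_and :: "bool \<Rightarrow> gen list list \<Rightarrow> gen list list \<Rightarrow> bool" where
  "covers [] K = True"
| "covers (ps # pss) K = covers_and (listed ps K) pss K"
| "covers_and True pss K = covers pss K"
| "covers_and False pss K = False"

lemma covers_iff: "covers pss K \<longleftrightarrow> set pss \<subseteq> set K"
proof (induction pss)
  case (Cons ps pss)
  then show ?case by (cases "ps \<in> set K") simp_all
qed simp

text \<open>All generators that occur in degree at least 4 and weight 10: every generator has weight at
least 1, so none has weight above 7.\<close>

definition plane_gens :: "gen list" where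
  "plane_gens = concat (map (\<lambda>A. map (Pair A) [0..<A + 1]) [3..<10])"

section \<open>Numerical data\<close>

text \<open>The lists below were found by linear algebra; only the lemmas about them matter. Generators
\<open>z\<^sup>a\<^sub>A\<close> are written as pairs \<open>(A, a)\<close>.\<close>

text \<open>Up to a scalar and up to functionals that vanish on cocycles, this is the only functional that
kills all coboundaries: \<open>H\<^sup>5\<close> has dimension 1. It was chosen to have few terms.\<close>

definition period :: terms where
  "period = [(2940, [(3,3),(4,0),(4,3),(4,4),(5,0)]), (-2940, [(3,1),(3,3),(4,2),(4,4),(6,0)]),
   (-8400, [(3,1),(3,2),(3,3),(5,0),(6,4)]), (17640, [(3,1),(3,2),(4,2),(4,4),(6,1)]),
   (840, [(3,2),(3,3),(4,0),(5,0),(5,5)]), (-2310, [(3,2),(3,3),(4,4),(5,0),(5,1)]),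
   (3080, [(3,2),(3,3),(4,1),(4,4),(6,0)]), (1320, [(3,0),(3,1),(3,2),(4,0),(7,7)])]"

text \<open>The period of \<open>dU\<close> is zero because \<open>U\<close> is invariant: as a linear form in the values of \<open>U\<close> it
is minus the sum of these multiples of values of \<open>L U\<close> for \<open>x\<^sup>2\<close> and \<open>y\<^sup>2\<close>.\<close>

definition period_invariance :: "(int \<times> nat \<times> gen list) list" where
  "period_invariance = [(6615, 2, [(1,0),(1,1),(4,3),(4,4),(5,0),(5,1)]),
   (-5502, 2, [(1,0),(1,1),(3,3),(4,0),(4,4),(7,1)]),
   (-7560, 2, [(1,0),(1,1),(3,3),(4,4),(5,0),(6,1)]),
   (-5670, 2, [(1,0),(1,1),(4,0),(4,4),(5,0),(5,4)]),
   (11340, 2, [(1,0),(1,1),(4,1),(4,4),(5,0),(5,3)]),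
   (11340, 0, [(1,0),(1,1),(4,3),(4,4),(5,0),(5,3)]),
   (-25200, 0, [(1,0),(1,1),(4,3),(4,4),(5,1),(5,2)]),
   (14175, 2, [(1,0),(1,1),(4,0),(4,4),(5,1),(5,3)]),
   (56700, 0, [(1,0),(1,1),(4,1),(4,4),(5,2),(5,3)]),
   (-113400, 0, [(1,0),(1,1),(4,2),(4,3),(5,2),(5,3)]),
   (-75600, 2, [(1,0),(1,1),(4,2),(4,3),(5,1),(5,2)]),
   (1722, 2, [(1,0),(1,1),(3,3),(4,0),(4,3),(7,2)]),
   (-4536, 2, [(1,0),(1,1),(3,3),(4,1),(4,3),(7,1)]),
   (-1488, 2, [(1,0),(1,1),(3,3),(4,1),(4,4),(7,0)]),
   (1944, 2, [(1,0),(1,1),(3,3),(4,2),(4,3),(7,0)]),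
   (-3780, 2, [(1,0),(1,1),(3,3),(4,0),(5,0),(6,5)]),
   (13440, 2, [(1,0),(1,1),(3,3),(4,2),(5,0),(6,3)]),
   (10395, 2, [(1,0),(1,1),(3,3),(4,0),(4,2),(7,3)]),
   (-13860, 2, [(1,0),(1,1),(3,3),(4,0),(4,1),(7,4)]),
   (-6930, 0, [(1,0),(1,1),(3,3),(4,0),(4,1),(7,6)]),
   (-8316, 2, [(1,0),(1,1),(3,3),(4,1),(4,2),(7,2)]),
   (7560, 2, [(1,0),(1,1),(3,3),(4,1),(5,0),(6,4)]),
   (9450, 2, [(1,0),(1,1),(3,3),(4,0),(5,1),(6,4)]),
   (-34440, 2, [(1,0),(1,1),(3,3),(4,3),(5,1),(6,1)]),
   (-24360, 2, [(1,0),(1,1),(3,3),(4,2),(5,2),(6,1)]),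
   (2100, 2, [(1,0),(1,1),(3,3),(4,2),(5,1),(6,2)]),
   (15960, 2, [(1,0),(1,1),(3,3),(4,3),(5,0),(6,2)]),
   (9450, 2, [(1,0),(1,1),(3,3),(4,0),(5,3),(6,2)]),
   (-12600, 2, [(1,0),(1,1),(3,3),(4,0),(5,2),(6,3)]),
   (37800, 2, [(1,0),(1,1),(3,3),(4,1),(5,2),(6,2)]),
   (-1680, 2, [(1,0),(1,1),(3,3),(4,0),(5,4),(6,1)]),
   (3360, 2, [(1,0),(1,1),(3,3),(4,1),(5,4),(6,0)]),
   (1680, 2, [(1,0),(1,1),(3,3),(4,0),(5,5),(6,0)]),
   (-25200, 2, [(1,0),(1,1),(3,3),(4,1),(5,1),(6,3)]),
   (35000, 2, [(1,0),(1,1),(3,3),(4,3),(5,2),(6,0)]),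
   (4725, 2, [(1,0),(1,1),(3,3),(4,4),(5,1),(6,0)]),
   (11620, 2, [(1,0),(1,1),(3,3),(4,2),(5,3),(6,0)]),
   (-30240, 2, [(1,0),(1,1),(3,3),(4,1),(5,3),(6,1)]),
   (-5880, 0, [(1,0),(1,1),(3,2),(3,3),(6,0),(6,5)]),
   (-8960, 2, [(1,0),(1,1),(3,2),(3,3),(6,0),(6,3)]),
   (2940, 2, [(1,0),(1,1),(3,2),(3,3),(6,1),(6,2)]),
   (2940, 2, [(1,0),(1,1),(4,1),(4,3),(4,4),(6,0)]),
   (17640, 2, [(1,0),(1,1),(3,0),(4,2),(4,4),(7,2)]),
   (29400, 0, [(1,0),(1,1),(3,0),(4,3),(4,4),(7,3)]),
   (-4410, 2, [(1,0),(1,1),(4,0),(4,3),(4,4),(6,1)]),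
   (17640, 0, [(1,0),(1,1),(3,2),(3,3),(4,2),(8,3)]),
   (-79380, 2, [(1,0),(1,1),(3,2),(3,3),(4,1),(8,2)]),
   (-3780, 0, [(1,0),(1,1),(3,3),(4,3),(4,4),(7,0)]),
   (-1260, 2, [(1,0),(1,1),(3,1),(4,3),(4,4),(7,0)]),
   (8820, 2, [(1,0),(1,1),(3,0),(4,3),(4,4),(7,1)]),
   (-7350, 0, [(1,0),(1,1),(3,2),(4,4),(5,4),(6,0)]),
   (2940, 0, [(1,0),(3,1),(3,3),(4,3),(4,4),(5,0)]),
   (19600, 0, [(1,0),(1,1),(3,3),(4,3),(5,4),(6,0)]),
   (3465, 2, [(1,0),(1,1),(3,1),(3,3),(4,4),(8,0)]),
   (-10395, 2, [(1,0),(1,1),(3,2),(3,3),(4,3),(8,0)]),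
   (41580, 2, [(1,0),(1,1),(3,2),(3,3),(4,2),(8,1)]),
   (-7560, 0, [(1,1),(3,1),(3,2),(3,3),(4,4),(6,0)]),
   (-24150, 2, [(1,1),(3,1),(3,2),(3,3),(4,2),(6,0)]),
   (6440, 2, [(1,1),(3,1),(3,2),(3,3),(4,1),(6,1)]),
   (-18060, 2, [(1,0),(3,1),(3,2),(3,3),(4,2),(6,1)]),
   (-36120, 0, [(1,1),(3,1),(3,2),(3,3),(4,3),(6,1)]),
   (30100, 2, [(1,0),(3,1),(3,2),(3,3),(4,1),(6,2)]),
   (-30100, 2, [(1,0),(3,1),(3,2),(3,3),(4,0),(6,3)]),
   (-15575, 2, [(1,1),(3,1),(3,2),(3,3),(4,0),(6,2)]),
   (-9240, 0, [(1,0),(3,1),(3,2),(3,3),(4,0),(6,5)]),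
   (-6020, 2, [(1,1),(3,0),(3,2),(3,3),(4,3),(6,0)]),
   (12460, 0, [(1,0),(1,1),(3,3),(4,4),(5,3),(6,0)]),
   (9150, 0, [(1,0),(1,1),(3,0),(3,3),(4,0),(8,7)]),
   (-192, 0, [(1,0),(1,1),(3,0),(3,3),(5,0),(7,7)]),
   (19870, 0, [(1,0),(1,1),(3,1),(3,2),(4,0),(8,7)]),
   (1344, 0, [(1,0),(1,1),(3,1),(3,3),(5,0),(7,6)]),
   (-4032, 0, [(1,0),(1,1),(3,2),(3,3),(5,0),(7,5)]),
   (-4176, 0, [(1,0),(1,1),(3,1),(3,2),(5,0),(7,7)]),
   (-54250, 0, [(1,0),(1,1),(3,1),(3,3),(4,0),(8,6)]),
   (162750, 0, [(1,0),(1,1),(3,2),(3,3),(4,0),(8,5)]),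
   (166530, 2, [(1,0),(1,1),(3,2),(3,3),(4,0),(8,3)]),
   (-2800, 2, [(1,1),(3,1),(3,2),(3,3),(5,0),(5,2)]),
   (14000, 2, [(1,0),(3,1),(3,2),(3,3),(5,1),(5,2)]),
   (12000, 2, [(1,0),(1,1),(3,1),(3,2),(3,3),(9,2)]),
   (-14000, 2, [(1,0),(1,1),(3,1),(3,3),(6,1),(6,3)]),
   (-35000, 0, [(1,0),(1,1),(3,2),(3,3),(6,2),(6,3)]),
   (-79800, 0, [(1,0),(1,1),(3,1),(3,2),(6,3),(6,4)]),
   (-39900, 2, [(1,0),(1,1),(3,0),(3,1),(6,3),(6,4)]),
   (-11130, 0, [(1,0),(1,1),(3,0),(3,1),(6,4),(6,5)]),
   (-8400, 2, [(1,0),(3,1),(3,2),(3,3),(5,0),(5,3)]),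
   (-6300, 0, [(1,0),(1,1),(3,2),(4,4),(5,0),(6,4)]),
   (16800, 0, [(1,0),(1,1),(3,3),(4,3),(5,0),(6,4)]),
   (-9765, 2, [(1,0),(1,1),(3,2),(4,4),(5,0),(6,2)]),
   (-22050, 0, [(1,0),(1,1),(3,3),(4,4),(5,1),(6,2)]),
   (35280, 0, [(1,0),(1,1),(3,1),(3,2),(6,2),(6,5)]),
   (17640, 2, [(1,0),(1,1),(3,0),(3,1),(6,2),(6,5)]),
   (5880, 0, [(1,0),(1,1),(3,0),(3,1),(6,3),(6,6)]),
   (-10080, 2, [(1,0),(1,1),(3,1),(3,2),(4,4),(8,1)]),
   (8820, 0, [(1,0),(1,1),(3,2),(4,3),(4,4),(7,1)]),
   (-2940, 0, [(1,1),(3,1),(3,2),(4,3),(4,4),(5,0)]),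
   (-14700, 0, [(1,0),(3,1),(3,2),(4,3),(4,4),(5,1)]),
   (-23520, 0, [(1,0),(1,1),(3,3),(4,2),(5,4),(6,1)]),
   (58800, 2, [(1,0),(1,1),(3,1),(3,2),(4,1),(8,4)]),
   (29400, 0, [(1,0),(1,1),(3,2),(3,3),(4,1),(8,4)]),
   (39200, 0, [(1,0),(1,1),(3,1),(3,2),(4,1),(8,6)]),
   (9800, 2, [(1,0),(1,1),(3,0),(3,2),(4,0),(8,6)]),
   (-5880, 0, [(1,0),(1,1),(3,2),(4,3),(5,5),(6,0)]),
   (-5880, 2, [(1,0),(1,1),(3,1),(4,2),(5,5),(6,0)]),
   (1960, 0, [(1,0),(1,1),(3,3),(4,2),(5,5),(6,0)]),
   (-2940, 2, [(1,0),(1,1),(3,1),(4,4),(5,3),(6,0)]),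
   (5880, 0, [(1,0),(1,1),(3,3),(4,4),(5,2),(6,1)]),
   (-1260, 2, [(1,0),(1,1),(3,2),(5,0),(5,1),(5,5)]),
   (-1680, 0, [(1,0),(3,1),(3,2),(3,3),(5,0),(5,5)]),
   (1155, 2, [(1,0),(3,2),(3,3),(4,0),(4,4),(5,0)]),
   (2100, 0, [(1,0),(1,1),(3,3),(4,0),(5,5),(6,2)]),
   (-2940, 2, [(1,0),(3,0),(3,2),(4,3),(4,4),(5,0)]),
   (-4620, 2, [(1,0),(1,1),(3,2),(3,3),(5,0),(7,3)]),
   (-9240, 0, [(1,0),(1,1),(3,3),(4,1),(4,4),(7,2)]),
   (2640, 0, [(1,0),(1,1),(3,0),(3,1),(3,2),(9,7)]),
   (2970, 0, [(1,0),(1,1),(3,2),(4,0),(4,1),(7,7)]),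
   (-2310, 0, [(1,0),(1,1),(3,0),(3,2),(4,0),(8,8)]),
   (660, 2, [(1,0),(1,1),(3,0),(4,0),(4,1),(7,7)]),
   (-1056, 2, [(1,0),(1,1),(3,0),(3,1),(5,0),(7,7)]),
   (-1540, 0, [(1,1),(3,0),(3,1),(3,3),(4,0),(6,6)]),
   (770, 0, [(1,0),(3,0),(3,2),(3,3),(4,0),(6,6)]),
   (4620, 0, [(1,1),(3,0),(3,2),(3,3),(4,0),(6,5)]),
   (-23100, 0, [(1,1),(3,1),(3,2),(3,3),(4,0),(6,4)])]"

text \<open>In each degree a list of coordinates, and for every other monomial of torus weight zero a
combination of relations that contains it together with monomials treated before. Mostly a
single relation suffices.\<close>

definition coordinates_4 :: "gen list list" where
  "coordinates_4 = [[(3,0),(4,1),(4,2),(7,6)], [(3,2),(3,3),(5,2),(7,2)]]"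

definition elimination_4 :: "(int \<times> relation) list list" where
  "elimination_4 = [[(1, Inv 0 [(4,0),(4,1),(5,4),(5,5)])], [(1, Inv 2 [(4,0),(4,1),(5,3),(5,4)])],
   [(1, Inv 0 [(4,1),(4,2),(5,3),(5,4)])], [(1, Inv 2 [(4,1),(4,2),(5,2),(5,3)])],
   [(1, Inv 0 [(4,2),(4,3),(5,2),(5,3)])], [(1, Inv 2 [(4,2),(4,3),(5,1),(5,2)])],
   [(1, Inv 0 [(4,3),(4,4),(5,1),(5,2)])], [(1, Inv 0 [(4,3),(4,4),(5,0),(5,3)])],
   [(1, Inv 0 [(4,2),(4,4),(5,1),(5,3)])], [(1, Inv 0 [(4,1),(4,4),(5,2),(5,3)])],
   [(1, Inv 2 [(4,0),(4,4),(5,1),(5,3)])], [(1, Inv 0 [(4,0),(4,4),(5,2),(5,4)])],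
   [(1, Inv 0 [(4,1),(4,3),(5,2),(5,4)])], [(1, Inv 0 [(4,2),(4,3),(5,1),(5,4)])],
   [(1, Inv 0 [(4,2),(4,4),(5,0),(5,4)])], [(1, Inv 2 [(4,1),(4,3),(5,0),(5,4)])],
   [(1, Inv 0 [(4,1),(4,4),(5,0),(5,5)])], [(1, Inv 0 [(4,0),(4,4),(5,1),(5,5)])],
   [(1, Inv 0 [(4,1),(4,3),(5,1),(5,5)])], [(1, Inv 0 [(4,1),(4,2),(5,2),(5,5)])],
   [(1, Inv 0 [(3,0),(3,1),(6,4),(6,5)])], [(1, Inv 0 [(3,0),(3,1),(6,3),(6,6)])],
   [(1, Inv 2 [(3,0),(3,1),(6,2),(6,5)])], [(1, Inv 0 [(3,0),(3,2),(6,3),(6,5)])],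
   [(1, Inv 0 [(3,1),(3,2),(6,3),(6,4)])], [(1, Inv 0 [(3,1),(3,2),(6,2),(6,5)])],
   [(1, Inv 2 [(3,1),(3,2),(6,1),(6,4)])], [(1, Inv 2 [(3,1),(3,2),(6,2),(6,3)])],
   [(1, Inv 0 [(3,2),(3,3),(6,2),(6,3)])], [(1, Inv 0 [(3,2),(3,3),(6,1),(6,4)])],
   [(1, Inv 0 [(3,2),(3,3),(6,0),(6,5)])], [(1, Inv 0 [(3,1),(3,3),(6,1),(6,5)])],
   [(1, Inv 0 [(3,0),(3,3),(6,2),(6,5)])], [(1, Inv 2 [(3,0),(3,3),(6,0),(6,5)])],
   [(1, Inv 0 [(3,1),(3,3),(6,0),(6,6)])], [(1, Inv 0 [(3,1),(3,2),(6,1),(6,6)])],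
   [(1, Inv 0 [(3,0),(3,1),(3,2),(9,7)])], [(1, Inv 0 [(3,0),(3,1),(3,3),(9,6)])],
   [(1, Inv 0 [(3,0),(3,2),(3,3),(9,5)])], [(1, Inv 0 [(3,1),(3,2),(3,3),(9,4)])],
   [(1, Inv 0 [(3,0),(4,1),(4,2),(7,7)])], [(1, Inv 0 [(3,0),(4,0),(4,3),(7,7)])],
   [(1, Inv 0 [(3,0),(4,1),(4,3),(7,6)])], [(1, Inv 0 [(3,0),(4,2),(4,3),(7,5)])],
   [(1, Inv 2 [(3,0),(4,1),(4,2),(7,5)])], [(1, Inv 0 [(3,1),(4,1),(4,2),(7,6)])],
   [(1, Inv 0 [(3,1),(4,0),(4,3),(7,6)])], [(1, Inv 0 [(3,1),(4,1),(4,3),(7,5)])],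
   [(1, Inv 0 [(3,1),(4,2),(4,3),(7,4)])], [(1, Inv 2 [(3,0),(4,2),(4,3),(7,3)])],
   [(1, Inv 0 [(3,0),(4,3),(4,4),(7,3)])], [(1, Inv 2 [(3,0),(4,3),(4,4),(7,1)])],
   [(1, Inv 0 [(3,1),(4,3),(4,4),(7,2)])], [(1, Inv 0 [(3,1),(4,2),(4,4),(7,3)])],
   [(1, Inv 2 [(3,1),(4,1),(4,4),(7,2)])], [(1, Inv 2 [(3,1),(4,1),(4,3),(7,3)])],
   [(1, Inv 0 [(3,2),(4,2),(4,3),(7,3)])], [(1, Inv 0 [(3,2),(4,2),(4,4),(7,2)])],
   [(1, Inv 0 [(3,2),(4,3),(4,4),(7,1)])], [(1, Inv 0 [(3,3),(4,3),(4,4),(7,0)])],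
   [(1, Inv 2 [(3,3),(4,2),(4,3),(7,0)])], [(1, Inv 0 [(3,3),(4,2),(4,4),(7,1)])],
   [(1, Inv 2 [(3,3),(4,1),(4,3),(7,1)])], [(1, Inv 0 [(3,3),(4,1),(4,4),(7,2)])],
   [(1, Inv 2 [(3,3),(4,0),(4,3),(7,2)])], [(1, Inv 0 [(3,3),(4,1),(4,3),(7,3)])],
   [(1, Inv 2 [(3,3),(4,0),(4,2),(7,3)])], [(1, Inv 0 [(3,3),(4,1),(4,2),(7,4)])],
   [(1, Inv 0 [(3,2),(4,1),(4,3),(7,4)])], [(1, Inv 0 [(3,2),(4,0),(4,3),(7,5)])],
   [(1, Inv 0 [(3,3),(4,0),(4,2),(7,5)])], [(1, Inv 0 [(3,3),(4,0),(4,1),(7,6)])],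
   [(1, Inv 0 [(3,2),(4,0),(4,1),(7,7)])], [(1, Inv 2 [(3,2),(4,0),(4,3),(7,3)])],
   [(1, Inv 0 [(3,2),(4,0),(4,4),(7,4)])], [(1, Inv 0 [(3,1),(4,1),(4,4),(7,4)])],
   [(1, Inv 0 [(3,0),(4,1),(4,4),(7,5)])], [(1, Inv 2 [(3,2),(3,3),(5,2),(7,1)])],
   [(1, Inv 0 [(3,2),(3,3),(5,3),(7,2)])], [(1, Inv 2 [(3,1),(3,3),(5,3),(7,1)])],
   [(1, Inv 0 [(3,2),(3,3),(5,4),(7,1)])], [(1, Inv 0 [(3,2),(3,3),(5,5),(7,0)])],
   [(1, Inv 2 [(3,1),(3,2),(5,5),(7,0)])], [(1, Inv 0 [(3,1),(3,3),(5,5),(7,1)])],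
   [(1, Inv 2 [(3,0),(3,3),(5,4),(7,1)])], [(1, Inv 0 [(3,1),(3,3),(5,4),(7,2)])],
   [(1, Inv 0 [(3,1),(3,2),(5,5),(7,2)])], [(1, Inv 2 [(3,0),(3,2),(5,4),(7,2)])],
   [(1, Inv 0 [(3,1),(3,2),(5,4),(7,3)])], [(1, Inv 0 [(3,0),(3,3),(5,4),(7,3)])],
   [(1, Inv 0 [(3,1),(3,3),(5,3),(7,3)])], [(1, Inv 0 [(3,2),(3,3),(5,2),(7,3)])],
   [(1, Inv 2 [(3,2),(3,3),(5,0),(7,3)])], [(1, Inv 0 [(3,2),(3,3),(5,1),(7,4)])],
   [(1, Inv 2 [(3,1),(3,3),(5,0),(7,4)])], [(1, Inv 2 [(3,1),(3,2),(5,2),(7,3)])],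
   [(1, Inv 0 [(3,1),(3,3),(5,2),(7,4)])], [(1, Inv 0 [(3,0),(3,3),(5,3),(7,4)])],
   [(1, Inv 0 [(3,0),(3,2),(5,4),(7,4)])], [(1, Inv 0 [(3,0),(3,1),(5,5),(7,4)])],
   [(1, Inv 0 [(3,0),(3,1),(5,4),(7,5)])], [(1, Inv 0 [(3,0),(3,2),(5,3),(7,5)])],
   [(1, Inv 0 [(3,1),(3,2),(5,2),(7,5)])], [(1, Inv 0 [(3,1),(3,3),(5,1),(7,5)])],
   [(1, Inv 2 [(3,0),(3,3),(5,0),(7,5)])], [(1, Inv 0 [(3,1),(3,3),(5,0),(7,6)])],
   [(1, Inv 0 [(3,1),(3,2),(5,1),(7,6)])], [(1, Inv 0 [(3,0),(3,2),(5,2),(7,6)])],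
   [(1, Inv 0 [(3,0),(3,1),(5,2),(7,7)])], [(1, Inv 0 [(3,0),(3,2),(5,1),(7,7)])],
   [(2, Cls [(3,0),(3,1),(3,2),(4,4),(7,3)]), (-1, Inv 2 [(3,0),(3,1),(4,4),(8,3)])],
   [(1, Inv 2 [(3,1),(3,2),(4,4),(8,1)])], [(1, Cls [(3,1),(3,2),(3,3),(4,4),(7,0)])],
   [(1, Inv 0 [(3,2),(3,3),(4,4),(8,1)])], [(1, Inv 2 [(3,2),(3,3),(4,2),(8,1)])],
   [(1, Inv 0 [(3,2),(3,3),(4,3),(8,2)])], [(1, Cls [(3,1),(3,2),(3,3),(4,3),(7,1)])],
   [(1, Inv 0 [(3,1),(3,2),(4,4),(8,3)])], [(1, Cls [(3,0),(3,2),(3,3),(4,4),(7,1)])],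
   [(1, Cls [(3,0),(3,1),(3,3),(4,4),(7,2)])], [(1, Inv 0 [(3,0),(3,2),(4,4),(8,4)])],
   [(1, Cls [(3,0),(3,2),(3,3),(4,3),(7,2)])], [(1, Cls [(3,0),(3,1),(3,3),(4,3),(7,3)])],
   [(1, Inv 0 [(3,0),(3,2),(4,3),(8,5)])], [(1, Cls [(3,0),(3,2),(3,3),(4,2),(7,3)])],
   [(1, Inv 0 [(3,0),(3,3),(4,2),(8,5)])], [(1, Inv 2 [(3,0),(3,3),(4,1),(8,4)])],
   [(1, Cls [(3,0),(3,1),(3,3),(4,1),(7,5)])], [(1, Inv 0 [(3,0),(3,1),(4,2),(8,7)])],
   [(1, Cls [(3,0),(3,1),(3,3),(4,2),(7,4)])], [(1, Cls [(3,1),(3,2),(3,3),(4,2),(7,2)])],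
   [(1, Cls [(3,0),(3,1),(3,2),(3,3),(8,4)])], [(1, Inv 0 [(3,2),(3,3),(4,1),(8,4)])],
   [(1, Cls [(3,1),(3,2),(3,3),(4,1),(7,3)])], [(1, Cls [(3,0),(3,1),(3,2),(4,1),(7,6)])],
   [(1, Inv 0 [(3,1),(3,2),(4,1),(8,6)])], [(1, Cls [(3,1),(3,2),(3,3),(4,0),(7,4)])],
   [(1, Inv 0 [(3,1),(3,3),(4,0),(8,6)])], [(1, Cls [(3,0),(3,2),(3,3),(4,0),(7,5)])],
   [(1, Cls [(3,0),(3,1),(3,2),(4,0),(7,7)])], [(30, Cls [(4,0),(4,1),(4,2),(4,3),(4,4)]),
   (-126, Inv 2 [(4,0),(4,3),(4,4),(6,1)]), (60, Inv 2 [(4,1),(4,2),(4,3),(6,2)]),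
   (60, Inv 0 [(4,2),(4,3),(4,4),(6,1)]), (-120, Inv 0 [(4,0),(4,2),(4,3),(6,5)]),
   (110, Inv 2 [(4,0),(4,1),(4,4),(6,3)]), (-48, Inv 2 [(4,1),(4,2),(4,4),(6,1)]),
   (195, Inv 0 [(4,0),(4,2),(4,4),(6,4)]), (-190, Inv 0 [(4,0),(4,3),(4,4),(6,3)]),
   (-60, Inv 2 [(4,0),(4,1),(4,2),(6,5)])], [(1, Inv 0 [(4,2),(4,3),(4,4),(6,1)])],
   [(1, Inv 2 [(4,1),(4,2),(4,4),(6,1)])], [(1, Inv 0 [(4,1),(4,3),(4,4),(6,2)])],
   [(1, Inv 0 [(4,0),(4,3),(4,4),(6,3)])], [(1, Inv 0 [(4,1),(4,2),(4,4),(6,3)])],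
   [(1, Inv 0 [(4,1),(4,2),(4,3),(6,4)])], [(1, Inv 0 [(4,0),(4,2),(4,4),(6,4)])],
   [(1, Inv 0 [(4,0),(4,1),(4,4),(6,5)])], [(1, Cls [(4,0),(4,1),(4,2),(4,3),(4,4)])],
   [(5, Inv 0 [(3,3),(4,4),(5,3),(6,0)]), (45, Inv 0 [(3,2),(4,4),(5,4),(6,0)]),
   (34, Inv 0 [(3,3),(4,3),(5,4),(6,0)]), (56, Cls [(3,1),(3,2),(3,3),(5,4),(6,0)]),
   (-156, Cls [(3,2),(3,3),(4,2),(4,3),(6,0)]), (78, Inv 0 [(3,2),(4,3),(5,5),(6,0)]),
   (78, Cls [(3,1),(3,2),(4,3),(4,4),(6,0)]), (15, Cls [(3,1),(3,3),(4,2),(4,4),(6,0)])],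
   [(4, Inv 0 [(3,3),(4,4),(5,3),(6,0)]), (-3, Inv 0 [(3,2),(4,4),(5,4),(6,0)]),
   (-4, Inv 0 [(3,3),(4,3),(5,4),(6,0)]), (24, Cls [(3,1),(3,2),(3,3),(5,4),(6,0)]),
   (12, Cls [(3,1),(3,3),(4,2),(4,4),(6,0)])], [(1, Cls [(3,1),(3,2),(3,3),(5,4),(6,0)])],
   [(1, Cls [(3,1),(3,3),(4,2),(4,4),(6,0)])], [(1, Inv 2 [(3,3),(4,4),(5,1),(6,0)])],
   [(1, Inv 2 [(3,3),(4,4),(5,0),(6,1)])], [(1, Inv 0 [(3,3),(4,3),(5,4),(6,0)])],
   [(1, Cls [(3,2),(3,3),(4,2),(4,3),(6,0)])], [(1, Inv 0 [(3,3),(4,2),(5,5),(6,0)])],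
   [(1, Cls [(3,2),(3,3),(4,1),(4,4),(6,0)])], [(1, Cls [(3,1),(3,2),(4,3),(4,4),(6,0)])],
   [(1, Inv 0 [(3,1),(4,4),(5,5),(6,0)])], [(1, Inv 2 [(3,0),(4,4),(5,4),(6,0)])],
   [(1, Cls [(3,0),(3,3),(4,2),(4,4),(6,1)])], [(1, Inv 0 [(3,0),(4,4),(5,5),(6,1)])],
   [(1, Inv 2 [(3,1),(4,3),(5,4),(6,0)])], [(1, Inv 0 [(3,1),(4,4),(5,4),(6,1)])],
   [(1, Cls [(3,1),(3,3),(4,1),(4,4),(6,1)])], [(1, Cls [(3,3),(4,0),(4,1),(4,2),(5,4)])],
   [(1, Cls [(3,1),(3,3),(4,0),(4,4),(6,2)])], [(1, Inv 2 [(3,1),(4,4),(5,2),(6,1)])],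
   [(1, Cls [(3,2),(3,3),(4,0),(4,4),(6,1)])], [(1, Cls [(3,0),(3,1),(3,3),(5,5),(6,1)])],
   [(1, Cls [(3,1),(3,3),(4,2),(4,3),(6,1)])], [(1, Inv 0 [(3,3),(4,3),(5,3),(6,1)])],
   [(1, Cls [(3,2),(3,3),(4,1),(4,3),(6,1)])], [(1, Cls [(3,2),(4,0),(4,1),(4,2),(5,5)])],
   [(1, Inv 0 [(3,2),(4,2),(5,5),(6,1)])], [(1, Inv 2 [(3,2),(4,2),(5,3),(6,1)])],
   [(1, Cls [(3,2),(4,0),(4,2),(4,3),(5,3)])], [(1, Cls [(3,2),(4,0),(4,1),(4,4),(5,3)])],
   [(1, Inv 2 [(3,2),(4,1),(5,4),(6,1)])], [(1, Cls [(3,2),(4,0),(4,1),(4,3),(5,4)])],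
   [(1, Inv 0 [(3,3),(4,0),(5,4),(6,3)])], [(1, Cls [(3,3),(4,0),(4,1),(4,3),(5,3)])],
   [(1, Cls [(3,2),(3,3),(4,1),(4,2),(6,2)])], [(1, Cls [(3,3),(4,0),(4,2),(4,3),(5,2)])],
   [(1, Cls [(3,3),(4,0),(4,1),(4,4),(5,2)])], [(1, Cls [(3,0),(3,3),(4,0),(5,2),(5,5)])],
   [(1, Cls [(3,0),(4,0),(4,2),(4,3),(5,5)])], [(1, Cls [(3,0),(3,1),(3,2),(5,5),(6,2)])],
   [(1, Cls [(3,1),(4,0),(4,1),(4,3),(5,5)])], [(1, Inv 0 [(3,1),(4,0),(5,5),(6,4)])],
   [(1, Cls [(3,1),(4,0),(4,2),(4,3),(5,4)])], [(1, Cls [(3,0),(3,1),(3,3),(5,4),(6,2)])],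
   [(1, Cls [(3,0),(3,3),(4,2),(4,3),(6,2)])], [(1, Cls [(3,2),(3,3),(4,0),(4,3),(6,2)])],
   [(1, Cls [(3,1),(3,2),(4,2),(4,3),(6,2)])], [(1, Cls [(3,0),(3,1),(4,3),(4,4),(6,2)])],
   [(1, Cls [(3,0),(3,3),(4,4),(5,0),(5,3)])], [(1, Inv 0 [(3,0),(4,4),(5,0),(6,6)])],
   [(1, Cls [(3,0),(3,2),(4,2),(4,4),(6,2)])], [(1, Inv 2 [(3,2),(4,4),(5,0),(6,2)])],
   [(1, Cls [(3,2),(3,3),(4,4),(5,0),(5,1)])], [(1, Inv 2 [(3,3),(5,0),(5,1),(5,4)])],
   [(1, Cls [(3,1),(3,3),(4,4),(5,0),(5,2)])], [(1, Inv 0 [(3,2),(4,4),(5,0),(6,4)])],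
   [(1, Cls [(3,2),(4,1),(4,3),(4,4),(5,0)])], [(1, Cls [(3,1),(3,2),(4,0),(4,3),(6,4)])],
   [(1, Inv 2 [(3,1),(4,3),(5,0),(6,4)])], [(1, Cls [(3,1),(4,2),(4,3),(4,4),(5,0)])],
   [(1, Cls [(3,1),(3,3),(4,2),(5,0),(5,4)])], [(1, Cls [(3,3),(4,1),(4,2),(4,4),(5,0)])],
   [(1, Cls [(3,2),(3,3),(4,1),(5,0),(5,4)])], [(1, Cls [(3,2),(3,3),(4,2),(5,0),(5,3)])],
   [(1, Inv 2 [(3,2),(4,2),(5,0),(6,4)])], [(1, Cls [(3,2),(4,1),(4,2),(4,4),(5,1)])],
   [(1, Inv 0 [(3,2),(4,2),(5,1),(6,5)])], [(1, Inv 0 [(3,1),(4,3),(5,1),(6,5)])],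
   [(1, Cls [(3,0),(3,1),(3,3),(5,1),(6,5)])], [(1, Cls [(3,3),(4,0),(4,2),(4,4),(5,1)])],
   [(1, Cls [(3,3),(4,1),(4,2),(4,3),(5,1)])], [(1, Cls [(3,2),(3,3),(4,1),(5,1),(5,3)])],
   [(1, Cls [(3,2),(3,3),(4,0),(5,2),(5,3)])], [(1, Cls [(3,2),(4,0),(4,2),(4,4),(5,2)])],
   [(1, Cls [(3,2),(4,1),(4,2),(4,3),(5,2)])], [(1, Inv 0 [(3,2),(4,2),(5,2),(6,4)])],
   [(1, Cls [(3,1),(4,1),(4,2),(4,4),(5,2)])], [(1, Cls [(3,1),(3,3),(4,1),(5,2),(5,3)])],
   [(1, Cls [(3,1),(4,1),(4,2),(4,3),(5,3)])], [(1, Cls [(3,1),(4,0),(4,2),(4,4),(5,3)])],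
   [(1, Cls [(3,1),(3,2),(4,0),(5,3),(5,4)])], [(1, Cls [(3,1),(3,2),(4,3),(5,1),(5,3)])],
   [(1, Cls [(3,2),(4,0),(4,3),(4,4),(5,1)])], [(1, Cls [(3,2),(3,3),(4,0),(5,1),(5,4)])],
   [(1, Cls [(3,1),(3,2),(4,1),(5,2),(5,4)])], [(1, Cls [(3,1),(3,3),(4,1),(5,1),(5,4)])],
   [(1, Cls [(3,1),(4,1),(4,3),(4,4),(5,1)])], [(1, Cls [(3,1),(3,2),(4,4),(5,1),(5,2)])],
   [(1, Cls [(3,1),(3,3),(4,3),(5,1),(5,2)])], [(1, Cls [(3,1),(4,0),(4,3),(4,4),(5,2)])],
   [(1, Cls [(3,1),(3,2),(4,0),(5,2),(5,5)])], [(1, Cls [(3,2),(3,3),(4,3),(5,0),(5,2)])],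
   [(1, Cls [(3,3),(4,0),(4,3),(4,4),(5,0)])], [(1, Cls [(3,1),(3,3),(4,3),(5,0),(5,3)])],
   [(1, Cls [(3,0),(3,1),(4,4),(5,0),(5,5)])], [(1, Cls [(3,0),(3,1),(4,0),(5,4),(5,5)])],
   [(1, Cls [(3,0),(4,0),(4,2),(4,4),(5,4)])], [(1, Cls [(3,0),(4,1),(4,2),(4,3),(5,4)])],
   [(1, Cls [(3,0),(3,3),(4,1),(4,2),(6,4)])], [(1, Cls [(3,0),(4,1),(4,2),(4,4),(5,3)])],
   [(1, Cls [(3,0),(3,2),(4,1),(5,3),(5,4)])], [(1, Cls [(3,0),(3,3),(4,2),(5,2),(5,3)])],
   [(1, Inv 0 [(3,0),(4,3),(5,2),(6,5)])], [(1, Cls [(3,0),(3,2),(4,3),(5,2),(5,3)])],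
   [(1, Cls [(3,0),(4,0),(4,3),(4,4),(5,3)])], [(1, Cls [(3,0),(3,3),(4,0),(4,1),(6,6)])],
   [(1, Cls [(3,0),(4,1),(4,3),(4,4),(5,2)])], [(1, Cls [(3,0),(3,3),(4,4),(5,1),(5,2)])],
   [(1, Cls [(3,0),(4,2),(4,3),(4,4),(5,1)])], [(1, Cls [(3,0),(3,2),(4,2),(5,1),(5,5)])],
   [(1, Cls [(3,0),(3,3),(4,1),(5,1),(5,5)])]]"

definition coordinates_5 :: "gen list list" where
  "coordinates_5 = [[(3,0),(3,1),(3,2),(5,5),(6,2)], [(3,1),(3,2),(3,3),(4,0),(7,4)],
   [(3,0),(3,1),(4,1),(5,3),(5,5)], [(3,0),(3,1),(4,2),(5,2),(5,5)],
   [(3,0),(4,1),(4,3),(4,4),(5,2)], [(3,0),(4,0),(4,2),(4,4),(5,4)],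
   [(3,0),(3,3),(4,1),(5,2),(5,4)]]"

definition elimination_5 :: "(int \<times> relation) list list" where
  "elimination_5 = [[(1, Inv 0 [(3,0),(3,1),(3,2),(3,3),(8,5)])], [(1, Inv 0 [(3,0),(3,1),(3,2),(5,5),(6,3)])],
   [(1, Inv 0 [(3,0),(3,1),(3,2),(5,4),(6,4)])], [(1, Inv 0 [(3,0),(3,1),(3,2),(5,3),(6,5)])],
   [(1, Inv 0 [(3,0),(3,1),(3,2),(5,2),(6,6)])], [(1, Inv 2 [(3,0),(3,1),(3,2),(5,1),(6,5)])],
   [(1, Inv 0 [(3,0),(3,1),(3,3),(5,2),(6,5)])], [(1, Inv 0 [(3,0),(3,1),(3,3),(5,3),(6,4)])],
   [(1, Inv 0 [(3,0),(3,1),(3,3),(5,4),(6,3)])], [(1, Inv 0 [(3,0),(3,1),(3,3),(5,5),(6,2)])],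
   [(1, Inv 2 [(3,0),(3,1),(3,3),(5,5),(6,0)])], [(1, Inv 0 [(3,1),(3,2),(3,3),(5,5),(6,0)])],
   [(1, Inv 2 [(3,1),(3,2),(3,3),(5,3),(6,0)])], [(1, Inv 0 [(3,1),(3,2),(3,3),(5,4),(6,1)])],
   [(1, Inv 0 [(3,0),(3,2),(3,3),(5,4),(6,2)])], [(1, Inv 0 [(3,1),(3,2),(3,3),(5,3),(6,2)])],
   [(1, Inv 2 [(3,1),(3,2),(3,3),(5,1),(6,2)])], [(1, Inv 0 [(3,1),(3,2),(3,3),(5,2),(6,3)])],
   [(1, Inv 0 [(3,0),(3,2),(3,3),(5,2),(6,4)])], [(1, Inv 0 [(3,1),(3,2),(3,3),(5,1),(6,4)])],
   [(1, Inv 0 [(3,1),(3,2),(3,3),(5,0),(6,5)])], [(1, Inv 0 [(3,0),(3,2),(3,3),(5,0),(6,6)])],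
   [(1, Inv 0 [(3,1),(3,2),(3,3),(4,0),(7,5)])], [(1, Inv 0 [(3,0),(3,2),(3,3),(4,0),(7,6)])],
   [(1, Inv 0 [(3,0),(3,1),(3,3),(4,0),(7,7)])], [(1, Inv 0 [(3,0),(3,1),(3,2),(4,1),(7,7)])],
   [(1, Inv 0 [(3,0),(3,1),(3,3),(4,1),(7,6)])], [(1, Inv 0 [(3,0),(3,2),(3,3),(4,1),(7,5)])],
   [(1, Inv 0 [(3,1),(3,2),(3,3),(4,1),(7,4)])], [(1, Inv 2 [(3,1),(3,2),(3,3),(4,1),(7,2)])],
   [(1, Inv 0 [(3,1),(3,2),(3,3),(4,2),(7,3)])], [(1, Inv 0 [(3,0),(3,2),(3,3),(4,2),(7,4)])],
   [(1, Inv 0 [(3,0),(3,1),(3,3),(4,2),(7,5)])], [(1, Inv 0 [(3,0),(3,1),(3,2),(4,3),(7,5)])],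
   [(1, Inv 0 [(3,0),(3,1),(3,3),(4,3),(7,4)])], [(1, Inv 0 [(3,0),(3,2),(3,3),(4,3),(7,3)])],
   [(1, Inv 0 [(3,1),(3,2),(3,3),(4,3),(7,2)])], [(1, Inv 2 [(3,1),(3,2),(3,3),(4,3),(7,0)])],
   [(1, Inv 0 [(3,1),(3,2),(3,3),(4,4),(7,1)])], [(1, Inv 0 [(3,0),(3,2),(3,3),(4,4),(7,2)])],
   [(1, Inv 0 [(3,0),(3,1),(3,3),(4,4),(7,3)])], [(1, Inv 0 [(3,0),(3,1),(4,1),(5,4),(5,5)])],
   [(1, Inv 0 [(3,0),(3,2),(4,0),(5,4),(5,5)])], [(1, Inv 0 [(3,0),(3,1),(4,2),(5,3),(5,5)])],
   [(1, Inv 0 [(3,0),(3,1),(4,3),(5,3),(5,4)])], [(1, Inv 0 [(3,0),(3,1),(4,3),(5,2),(5,5)])],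
   [(1, Inv 2 [(3,0),(3,1),(4,2),(5,1),(5,5)])], [(1, Inv 2 [(3,0),(3,1),(4,2),(5,2),(5,4)])],
   [(1, Inv 0 [(3,0),(3,2),(4,2),(5,3),(5,4)])], [(1, Inv 0 [(3,0),(3,2),(4,1),(5,3),(5,5)])],
   [(1, Inv 0 [(3,0),(4,2),(4,3),(4,4),(5,2)])], [(1, Inv 2 [(3,0),(4,2),(4,3),(4,4),(5,0)])],
   [(1, Inv 0 [(3,2),(4,2),(4,3),(4,4),(5,0)])], [(1, Inv 2 [(3,1),(4,1),(4,3),(4,4),(5,0)])],
   [(1, Inv 0 [(3,0),(4,0),(4,3),(4,4),(5,4)])], [(1, Inv 0 [(3,0),(4,1),(4,3),(4,4),(5,3)])],
   [(1, Inv 0 [(3,0),(4,1),(4,2),(4,4),(5,4)])], [(1, Inv 0 [(3,0),(4,1),(4,2),(4,3),(5,5)])],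
   [(1, Inv 0 [(3,0),(4,0),(4,2),(4,4),(5,5)])], [(1, Inv 2 [(3,0),(4,0),(4,1),(4,4),(5,4)])],
   [(1, Inv 0 [(3,1),(4,0),(4,1),(4,4),(5,5)])], [(1, Inv 0 [(3,1),(4,0),(4,2),(4,3),(5,5)])],
   [(1, Inv 0 [(3,1),(4,1),(4,2),(4,3),(5,4)])], [(1, Inv 0 [(3,1),(4,0),(4,2),(4,4),(5,4)])],
   [(1, Inv 0 [(3,1),(4,1),(4,2),(4,4),(5,3)])], [(1, Inv 0 [(3,1),(4,1),(4,3),(4,4),(5,2)])],
   [(1, Inv 2 [(3,1),(4,0),(4,3),(4,4),(5,1)])], [(1, Inv 0 [(3,2),(4,1),(4,3),(4,4),(5,1)])],
   [(1, Inv 2 [(3,2),(4,1),(4,2),(4,4),(5,0)])], [(1, Inv 0 [(3,3),(4,1),(4,3),(4,4),(5,0)])],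
   [(1, Inv 0 [(3,3),(4,0),(4,3),(4,4),(5,1)])], [(1, Inv 0 [(3,3),(4,1),(4,2),(4,4),(5,1)])],
   [(1, Inv 2 [(3,3),(4,0),(4,2),(4,3),(5,1)])], [(1, Inv 0 [(3,3),(4,1),(4,2),(4,3),(5,2)])],
   [(1, Inv 0 [(3,2),(4,1),(4,2),(4,4),(5,2)])], [(1, Inv 0 [(3,3),(4,0),(4,2),(4,4),(5,2)])],
   [(1, Inv 2 [(3,3),(4,0),(4,1),(4,3),(5,2)])], [(1, Inv 0 [(3,3),(4,0),(4,2),(4,3),(5,3)])],
   [(1, Inv 0 [(3,2),(4,0),(4,2),(4,4),(5,3)])], [(1, Inv 0 [(3,2),(4,0),(4,1),(4,4),(5,4)])],
   [(1, Inv 0 [(3,3),(4,0),(4,1),(4,3),(5,4)])], [(1, Inv 0 [(3,3),(4,0),(4,1),(4,2),(5,5)])],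
   [(1, Inv 0 [(3,0),(3,3),(4,1),(5,3),(5,4)])], [(1, Inv 0 [(3,0),(3,3),(4,0),(5,3),(5,5)])],
   [(1, Inv 0 [(3,0),(3,3),(4,1),(5,2),(5,5)])], [(1, Inv 2 [(3,0),(3,3),(4,0),(5,1),(5,5)])],
   [(1, Inv 2 [(3,0),(3,2),(4,1),(5,1),(5,5)])], [(1, Inv 2 [(3,1),(3,2),(4,0),(5,1),(5,5)])],
   [(1, Inv 0 [(3,1),(3,3),(4,0),(5,2),(5,5)])], [(1, Inv 0 [(3,1),(3,3),(4,0),(5,3),(5,4)])],
   [(1, Inv 0 [(3,1),(3,2),(4,1),(5,3),(5,4)])], [(1, Inv 2 [(3,2),(3,3),(4,0),(5,1),(5,3)]),
   (1, Inv 0 [(3,2),(3,3),(4,0),(5,2),(5,4)])], [(1, Inv 2 [(3,2),(3,3),(4,1),(5,1),(5,2)])],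
   [(2, Inv 0 [(3,2),(3,3),(4,1),(5,0),(5,5)]), (1, Inv 2 [(3,1),(3,3),(4,0),(5,0),(5,5)])],
   [(1, Inv 2 [(3,2),(3,3),(4,1),(5,0),(5,3)])], [(1, Inv 0 [(3,2),(3,3),(4,2),(5,1),(5,3)])],
   [(1, Inv 2 [(3,1),(3,3),(4,2),(5,1),(5,2)])], [(1, Inv 0 [(3,2),(3,3),(4,3),(5,1),(5,2)])],
   [(1, Inv 0 [(3,2),(3,3),(4,3),(5,0),(5,3)])], [(1, Inv 2 [(3,1),(3,3),(4,3),(5,0),(5,2)])],
   [(1, Inv 0 [(3,2),(3,3),(4,4),(5,0),(5,2)])], [(1, Inv 2 [(3,1),(3,3),(4,2),(5,0),(5,3)])],
   [(1, Inv 2 [(3,1),(3,2),(4,2),(5,1),(5,3)]), (1, Inv 0 [(3,1),(3,2),(4,2),(5,2),(5,4)])],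
   [(1, Inv 0 [(3,1),(3,3),(4,3),(5,1),(5,3)])], [(1, Inv 2 [(3,0),(3,3),(4,3),(5,1),(5,2)])],
   [(1, Inv 0 [(3,1),(3,3),(4,4),(5,1),(5,2)])], [(1, Inv 2 [(3,1),(3,2),(4,4),(5,0),(5,2)])],
   [(1, Inv 0 [(3,1),(3,3),(4,4),(5,0),(5,3)])], [(1, Inv 0 [(3,0),(3,3),(4,4),(5,1),(5,3)])],
   [(1, Inv 2 [(3,0),(3,2),(4,4),(5,0),(5,3)])], [(1, Inv 0 [(3,1),(3,2),(4,4),(5,0),(5,4)])],
   [(1, Inv 0 [(3,1),(3,3),(4,3),(5,0),(5,4)])], [(4, Cls [(3,0),(3,1),(3,2),(3,3),(5,1),(5,4)]),
   (2, Inv 2 [(3,0),(3,3),(4,1),(5,1),(5,4)]), (-3, Inv 0 [(3,0),(3,2),(4,4),(5,1),(5,4)]),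
   (30, Inv 2 [(3,1),(3,2),(4,1),(5,1),(5,4)]), (3, Inv 2 [(3,1),(3,3),(4,0),(5,1),(5,4)]),
   (24, Inv 0 [(3,1),(3,2),(4,3),(5,1),(5,4)])], [(1, Inv 0 [(3,2),(3,3),(4,1),(5,1),(5,4)])],
   [(1, Inv 0 [(3,2),(3,3),(4,0),(5,2),(5,4)])], [(1, Inv 0 [(3,2),(3,3),(4,1),(5,2),(5,3)])],
   [(1, Inv 2 [(3,1),(3,2),(4,1),(5,2),(5,3)])], [(1, Inv 0 [(3,1),(3,3),(4,2),(5,2),(5,3)])],
   [(1, Inv 0 [(3,0),(3,3),(4,3),(5,2),(5,3)])], [(1, Cls [(3,0),(3,1),(3,2),(3,3),(5,2),(5,3)])],
   [(1, Inv 0 [(3,0),(3,1),(4,4),(5,2),(5,4)])], [(1, Inv 0 [(3,0),(3,2),(4,4),(5,1),(5,4)])],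
   [(1, Inv 0 [(3,1),(3,2),(4,3),(5,1),(5,4)])], [(1, Cls [(3,0),(3,1),(3,2),(3,3),(5,1),(5,4)])],
   [(1, Inv 0 [(3,0),(3,3),(4,2),(5,1),(5,5)])], [(1, Inv 0 [(3,0),(3,3),(4,3),(5,0),(5,5)])],
   [(1, Inv 0 [(3,1),(3,2),(4,3),(5,0),(5,5)])], [(1, Inv 0 [(3,1),(3,3),(4,2),(5,0),(5,5)])],
   [(1, Inv 0 [(3,2),(3,3),(4,1),(5,0),(5,5)])], [(1, Cls [(3,0),(3,1),(3,2),(3,3),(5,0),(5,5)])],
   [(990, Inv 2 [(3,1),(3,2),(4,1),(4,4),(6,1)]), (17040, Inv 0 [(3,1),(3,2),(4,3),(4,4),(6,1)]),
   (6230, Inv 2 [(3,0),(3,1),(4,3),(4,4),(6,1)]),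
   (-4580, Cls [(3,0),(3,1),(3,2),(4,3),(4,4),(5,1)]),
   (-715, Inv 2 [(3,1),(3,3),(4,1),(4,4),(6,0)]), (5085, Inv 2 [(3,1),(3,2),(4,2),(4,4),(6,0)]),
   (2, Aux), (-660, Cls [(3,1),(3,2),(3,3),(4,1),(4,4),(5,0)])],
   [(1, Cls [(3,0),(3,1),(3,3),(4,3),(4,4),(5,0)])], [(1, Inv 0 [(3,0),(3,1),(4,3),(4,4),(6,3)])],
   [(1, Inv 2 [(3,0),(3,1),(4,2),(4,4),(6,2)])], [(1, Cls [(3,0),(3,2),(3,3),(4,2),(4,4),(5,0)])],
   [(1, Cls [(3,0),(3,1),(3,3),(4,2),(4,4),(5,1)])], [(1, Inv 0 [(3,1),(3,3),(4,3),(4,4),(6,0)])],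
   [(1, Cls [(3,0),(3,1),(3,2),(4,3),(4,4),(5,1)])], [(1, Inv 0 [(3,1),(3,2),(4,3),(4,4),(6,1)])],
   [(-1, Aux)], [(1, Inv 0 [(3,2),(3,3),(4,2),(4,4),(6,0)])],
   [(1, Inv 2 [(3,2),(3,3),(4,1),(4,3),(6,0)])], [(1, Inv 0 [(3,2),(3,3),(4,2),(4,3),(6,1)])],
   [(1, Cls [(3,1),(3,2),(3,3),(4,2),(4,3),(5,0)])], [(1, Inv 0 [(3,1),(3,2),(4,2),(4,4),(6,2)])],
   [(1, Cls [(3,1),(3,2),(3,3),(4,1),(4,4),(5,0)])],
   [(1, Cls [(3,0),(3,1),(3,2),(3,3),(4,4),(6,1)])], [(1, Inv 2 [(3,2),(3,3),(4,0),(4,3),(6,1)])],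
   [(1, Inv 0 [(3,2),(3,3),(4,0),(4,4),(6,2)])], [(1, Cls [(3,1),(3,2),(3,3),(4,0),(4,4),(5,1)])],
   [(1, Inv 2 [(3,1),(3,3),(4,1),(4,3),(6,1)])], [(1, Cls [(3,1),(3,2),(3,3),(4,1),(4,3),(5,1)])],
   [(1, Inv 0 [(3,1),(3,2),(4,2),(4,3),(6,3)])], [(1, Cls [(3,0),(3,2),(3,3),(4,2),(4,3),(5,1)])],
   [(1, Cls [(3,0),(3,1),(3,3),(4,2),(4,3),(5,2)])], [(1, Inv 0 [(3,0),(3,2),(4,2),(4,3),(6,4)])],
   [(1, Cls [(3,0),(3,2),(3,3),(4,1),(4,3),(5,2)])],
   [(1, Cls [(3,0),(3,1),(3,3),(4,1),(4,3),(5,3)])], [(1, Inv 2 [(3,0),(3,1),(4,1),(4,3),(6,4)])],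
   [(1, Cls [(3,0),(3,1),(3,3),(4,1),(4,4),(5,2)])],
   [(1, Cls [(3,0),(3,2),(3,3),(4,1),(4,4),(5,1)])], [(1, Inv 0 [(3,0),(3,3),(4,1),(4,4),(6,3)])],
   [(1, Cls [(3,0),(3,2),(3,3),(4,0),(4,4),(5,2)])],
   [(1, Cls [(3,0),(3,1),(3,2),(4,0),(4,4),(5,4)])], [(1, Inv 0 [(3,0),(3,2),(4,0),(4,4),(6,5)])],
   [(1, Cls [(3,0),(3,2),(3,3),(4,0),(4,3),(5,3)])], [(1, Inv 0 [(3,0),(3,3),(4,1),(4,3),(6,4)])],
   [(1, Inv 2 [(3,0),(3,3),(4,1),(4,2),(6,3)])], [(1, Cls [(3,0),(3,1),(3,3),(4,1),(4,2),(5,4)])],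
   [(1, Cls [(3,0),(3,1),(4,1),(4,2),(4,3),(4,4)])],
   [(1, Cls [(3,0),(3,3),(4,0),(4,1),(4,3),(4,4)])],
   [(1, Cls [(3,0),(3,2),(3,3),(4,0),(4,1),(5,5)])],
   [(1, Cls [(3,0),(3,1),(3,2),(3,3),(4,1),(6,4)])],
   [(1, Cls [(3,1),(3,2),(3,3),(4,1),(4,2),(5,2)])],
   [(1, Cls [(3,2),(3,3),(4,0),(4,1),(4,2),(4,3)])], [(1, Inv 0 [(3,2),(3,3),(4,0),(4,3),(6,3)])],
   [(1, Cls [(3,1),(3,2),(3,3),(4,0),(4,3),(5,2)])],
   [(1, Cls [(3,1),(3,2),(4,0),(4,1),(4,3),(4,4)])],
   [(1, Cls [(3,1),(3,2),(3,3),(4,0),(4,1),(5,4)])],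
   [(1, Cls [(3,1),(3,3),(4,0),(4,1),(4,2),(4,4)])],
   [(1, Cls [(3,1),(3,2),(3,3),(4,0),(4,2),(5,3)])],
   [(1, Cls [(3,0),(3,1),(3,2),(3,3),(4,0),(6,5)])],
   [(1, Cls [(3,0),(3,2),(3,3),(4,0),(4,2),(5,4)])], [(1, Inv 0 [(3,0),(3,2),(4,1),(4,2),(6,6)])],
   [(1, Inv 0 [(3,0),(3,2),(4,0),(4,3),(6,6)])]]"

definition coordinates_6 :: "gen list list" where
  "coordinates_6 = [[(3,0),(3,3),(4,0),(4,1),(4,3),(4,4)], [(3,0),(3,2),(3,3),(4,2),(4,4),(5,0)],
   [(3,1),(3,2),(3,3),(4,1),(4,4),(5,0)], [(3,0),(3,1),(3,2),(3,3),(5,0),(5,5)]]"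

definition elimination_6 :: "(int \<times> relation) list list" where
  "elimination_6 = [[(1, Inv 0 [(3,0),(3,1),(3,2),(3,3),(4,0),(6,6)])],
   [(1, Inv 0 [(3,0),(3,1),(3,2),(3,3),(4,1),(6,5)])],
   [(1, Inv 0 [(3,0),(3,1),(3,2),(3,3),(4,2),(6,4)])],
   [(1, Inv 0 [(3,0),(3,1),(3,2),(3,3),(4,3),(6,3)])],
   [(1, Inv 0 [(3,0),(3,1),(3,2),(3,3),(4,4),(6,2)])],
   [(1, Inv 0 [(3,0),(3,3),(4,0),(4,2),(4,3),(4,4)])],
   [(1, Inv 0 [(3,1),(3,2),(4,0),(4,2),(4,3),(4,4)])],
   [(1, Inv 0 [(3,1),(3,3),(4,0),(4,1),(4,3),(4,4)])],
   [(1, Inv 0 [(3,2),(3,3),(4,0),(4,1),(4,2),(4,4)])],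
   [(1, Inv 0 [(3,0),(3,2),(4,1),(4,2),(4,3),(4,4)])],
   [(1, Inv 0 [(3,0),(3,2),(3,3),(4,3),(4,4),(5,0)])],
   [(1, Inv 2 [(3,0),(3,1),(3,3),(4,2),(4,4),(5,0)])],
   [(1, Inv 0 [(3,0),(3,1),(3,3),(4,3),(4,4),(5,1)])],
   [(1, Inv 0 [(3,0),(3,1),(3,2),(4,3),(4,4),(5,2)])],
   [(1, Inv 0 [(3,1),(3,2),(3,3),(4,2),(4,4),(5,0)])],
   [(1, Inv 2 [(3,1),(3,2),(3,3),(4,1),(4,3),(5,0)])],
   [(1, Inv 0 [(3,1),(3,2),(3,3),(4,2),(4,3),(5,1)])],
   [(1, Inv 0 [(3,0),(3,2),(3,3),(4,2),(4,4),(5,1)])],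
   [(1, Inv 0 [(3,1),(3,2),(3,3),(4,1),(4,4),(5,1)])],
   [(1, Inv 2 [(3,1),(3,2),(3,3),(4,0),(4,3),(5,1)])],
   [(1, Inv 0 [(3,1),(3,2),(3,3),(4,0),(4,4),(5,2)])],
   [(1, Inv 2 [(3,0),(3,2),(3,3),(4,1),(4,3),(5,1)])],
   [(1, Inv 0 [(3,1),(3,2),(3,3),(4,1),(4,3),(5,2)])],
   [(1, Inv 2 [(3,1),(3,2),(3,3),(4,0),(4,2),(5,2)])],
   [(1, Inv 0 [(3,1),(3,2),(3,3),(4,1),(4,2),(5,3)])],
   [(1, Inv 0 [(3,1),(3,2),(3,3),(4,0),(4,3),(5,3)])],
   [(1, Inv 0 [(3,0),(3,2),(3,3),(4,1),(4,3),(5,3)])],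
   [(1, Inv 2 [(3,0),(3,1),(3,3),(4,1),(4,2),(5,3)])],
   [(1, Inv 0 [(3,0),(3,2),(3,3),(4,1),(4,2),(5,4)])],
   [(1, Inv 0 [(3,1),(3,2),(3,3),(4,0),(4,2),(5,4)])],
   [(1, Inv 0 [(3,1),(3,2),(3,3),(4,0),(4,1),(5,5)])],
   [(1, Inv 0 [(3,0),(3,2),(3,3),(4,0),(4,2),(5,5)])],
   [(1, Inv 0 [(3,0),(3,1),(3,3),(4,1),(4,2),(5,5)])],
   [(1, Inv 2 [(3,0),(3,1),(3,2),(4,1),(4,2),(5,4)])],
   [(1, Inv 0 [(3,0),(3,1),(3,3),(4,1),(4,3),(5,4)])],
   [(1, Inv 0 [(3,0),(3,1),(3,3),(4,0),(4,3),(5,5)])],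
   [(1, Inv 0 [(3,0),(3,1),(3,2),(4,0),(4,4),(5,5)])],
   [(1, Inv 0 [(3,0),(3,1),(3,3),(4,0),(4,4),(5,4)])],
   [(1, Inv 2 [(3,0),(3,1),(3,3),(4,0),(4,4),(5,2)])],
   [(1, Inv 0 [(3,0),(3,1),(3,3),(4,2),(4,4),(5,2)])],
   [(1, Inv 0 [(3,0),(3,1),(3,3),(4,2),(4,3),(5,3)])],
   [(1, Inv 0 [(3,0),(3,1),(3,2),(4,2),(4,4),(5,3)])],
   [(1, Inv 0 [(3,0),(3,1),(3,2),(3,3),(5,1),(5,5)])],
   [(1, Inv 0 [(3,0),(3,1),(3,2),(3,3),(5,2),(5,4)])]]"

lemma covers_6: "covers (monomial_lists plane_gens 6 10 0) (eliminate 2 [] elimination_6 coordinates_6)"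
  by code_simp

lemma covers_5: "covers (monomial_lists plane_gens 5 10 0) (eliminate 2 period elimination_5 coordinates_5)"
  by code_simp

lemma covers_4: "covers (monomial_lists plane_gens 4 10 0) (eliminate 2 [] elimination_4 coordinates_4)"
  by code_simp

text \<open>The differences \<open>264 - 255 = 9\<close> and \<open>192 - 180 = 12\<close> are the dimensions of the spaces of
invariants.\<close>

lemma monomial_counts:
  "length (monomial_lists plane_gens 4 10 0) = 264" "length (monomial_lists plane_gens 4 10 (- 2)) = 255"
  "length (monomial_lists plane_gens 5 10 0) = 192" "length (monomial_lists plane_gens 5 10 (- 2)) = 180"
  by code_simp+

text \<open>Terms with a generator of degree 2 occur because \<open>{S\<^sub>1, S\<^sub>3} \<subseteq> S\<^sub>2\<close>; relative cochains vanish on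
them.\<close>

lemma period_cycle:
  "normal_form (filter (\<lambda>(c, ps). list_all (\<lambda>p. fst p \<noteq> 2) ps)
     (combine 1 [] (map (\<lambda>(c, ps). (c, Cls ((1, 0) # (1, 1) # ps))) period @
        map (\<lambda>(c, i, ps). (c, Inv i ps)) period_invariance))) = []"
  by code_simp

section \<open>Coordinates that determine an invariant cocycle\<close>

lemma plane_gens_sorted: "sorted_wrt gen_less plane_gens"
  by code_simp

lemma set_plane_gens: "set plane_gens = {(A, a). 3 \<le> A \<and> A < 10 \<and> a \<le> A}"
proof -
  have "set plane_gens = (\<Union>A\<in>{3..<10}. Pair A ` {0..<A + 1})"
    by (simp only: plane_gens_def set_concat set_map set_upt image_image)
  then show ?thesis by auto
qed

text \<open>Each of the other \<open>m - 1\<close> generators has weight at least 1, so \<open>A - 2 \<le> w - (m - 1) \<le> 7\<close>.\<close>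

lemma rel_monomials_small:
  assumes I: "I \<in> rel_monomials 2 m w" and "w \<le> int m + 6"
  shows "I \<subseteq> set plane_gens" "list_weight I = nat w" "card I = m" "finite I"
proof -
  have fin: "finite I" and c: "card I = m" and w: "(\<Sum>p\<in>I. gen_weight p) = w"
    using I by (auto simp: rel_monomials_def monomials_def)
  have ge: "3 \<le> fst p \<and> snd p \<le> fst p" if "p \<in> I" for p
  proof -
    have "p \<in> gens 2" "fst p \<noteq> 2" using I that by (auto simp: rel_monomials_def monomials_def)
    then show ?thesis by (cases p) (auto simp: gens_def)
  qed
  have gw: "gen_weight p = int (fst p) - 2" for p by (cases p) (simp add: gen_weight_def)
  show "I \<subseteq> set plane_gens"
  proof
    fix p assume p: "p \<in> I"
    have "w = gen_weight p + (\<Sum>q\<in>I - {p}. gen_weight q)"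
      using w fin p by (simp add: sum.remove)
    moreover have "(\<Sum>q\<in>I - {p}. gen_weight q) \<ge> (\<Sum>q\<in>I - {p}. 1)"
      using ge by (intro sum_mono) (force simp: gw)
    moreover have "card (I - {p}) = m - 1" "m > 0" using c fin p by (auto simp: card_Diff_singleton card_gt_0_iff)
    ultimately have "int (fst p) < 10" using assms(2) by (simp add: gw of_nat_diff)
    then show "p \<in> set plane_gens" using ge[OF p] by (cases p) (auto simp: set_plane_gens)
  qed
  have "int (list_weight I) = (\<Sum>p\<in>I. gen_weight p)"
    unfolding list_weight_def of_nat_sum using ge by (intro sum.cong) (force simp: gw)+
  then show "list_weight I = nat w" using w by simp
  show "card I = m" "finite I" by fact+
qed

lemma monomial_lists_rel_monomials:
  assumes "ps \<in> set (monomial_lists plane_gens m w h)"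
  shows "set ps \<in> rel_monomials 2 m (int w)" "sorted_wrt gen_less ps" "(\<Sum>p\<in>set ps. torus_weight p) = h"
proof -
  have ps: "set ps \<subseteq> set plane_gens" "sorted_wrt gen_less ps" "card (set ps) = m"
    "list_weight (set ps) = w" "(\<Sum>p\<in>set ps. torus_weight p) = h"
    using monomial_lists_sound[OF plane_gens_sorted assms] by auto
  have g: "p \<in> gens 2 \<and> fst p \<noteq> 2" if "p \<in> set ps" for p
    using subsetD[OF ps(1) that] unfolding set_plane_gens by (auto simp: gens_def)
  have "gen_weight p = int (fst p - 2)" if "p \<in> set ps" for p
    using g[OF that] by (cases p) (auto simp: gen_weight_def gens_def)
  then have "(\<Sum>p\<in>set ps. gen_weight p) = int (list_weight (set ps))"
    unfolding list_weight_def of_nat_sum by (intro sum.cong) auto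
  then show "set ps \<in> rel_monomials 2 m (int w)"
    using g ps by (auto simp: rel_monomials_def monomials_def)
  show "sorted_wrt gen_less ps" "(\<Sum>p\<in>set ps. torus_weight p) = h" by fact+
qed

lemma rel_monomials_in_lists:
  assumes "I \<in> rel_monomials 2 m w" "w \<le> int m + 6" "(\<Sum>p\<in>I. torus_weight p) = h"
  obtains ps where "ps \<in> set (monomial_lists plane_gens m (nat w) h)" "set ps = I"
  using monomial_lists_complete[OF plane_gens_sorted rel_monomials_small(1)[OF assms(1,2)]
      rel_monomials_small(3)[OF assms(1,2)] rel_monomials_small(2)[OF assms(1,2)] assms(3)] by blast

text \<open>The use of an elimination: all values at monomials of torus weight zero vanish by
\<open>eliminate_sound\<close>, and the others vanish by invariance under the torus.\<close>

lemma determined_by_coordinates: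
  assumes F: "rel_form 2 m w F" "rel_diff 2 F = (\<lambda>J. 0)" "eval_terms F ex = 0"
    and w: "w = int n" "n \<le> m + 6"
    and coords: "\<And>ps. ps \<in> set coordinates \<Longrightarrow> on_list F ps = 0"
    and cert: "covers (monomial_lists plane_gens m n 0) (eliminate 2 ex certificate coordinates)"
  shows "F J = 0"
proof (rule ccontr)
  assume nz: "F J \<noteq> 0"
  then have "J \<in> rel_monomials 2 m w" using F(1) by (simp add: rel_form_def)
  moreover have "(\<Sum>p\<in>J. torus_weight p) = 0" by (rule rel_form_torus_weight[OF _ F(1) nz]) simp
  ultimately obtain ps where ps: "ps \<in> set (monomial_lists plane_gens m n 0)" "set ps = J"
    using rel_monomials_in_lists[of J m w 0] w by auto
  have "\<forall>ps\<in>set (eliminate 2 ex certificate coordinates). on_list F ps = 0"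
    using coords by (intro eliminate_sound eval_relation[OF F]) auto
  then have "on_list F ps = 0" using ps cert unfolding covers_iff by blast
  then show False using nz ps on_list_sorted[OF monomial_lists_rel_monomials(2)[OF ps(1)], of F] by simp
qed

text \<open>Invariance as a finite system: the value of \<open>L F\<close> for \<open>x\<^sup>2\<close> can be nonzero only at monomials of
torus weight \<open>-2\<close>.\<close>

lemma highest_weight_in_lists:
  assumes supp: "\<And>J. F J \<noteq> 0 \<Longrightarrow> J \<in> set ` set (monomial_lists plane_gens m (nat w) 0)" and w: "0 \<le> w" "w \<le> int m + 6"
    and e: "\<And>ps. ps \<in> set (monomial_lists plane_gens m (nat w) (- 2)) \<Longrightarrow> lie_op (2, 2) F (set ps) = 0"
  shows "rel_form 2 m w F"
proof (rule rel_form_highest_weight)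
  have supp': "J \<in> rel_monomials 2 m w \<and> (\<Sum>q\<in>J. torus_weight q) = 0" if "F J \<noteq> 0" for J
    using supp[OF that] monomial_lists_rel_monomials[where m = m and w = "nat w" and h = 0] w by auto
  then show "F J \<noteq> 0 \<Longrightarrow> J \<in> rel_monomials 2 m w \<and> (\<Sum>q\<in>J. torus_weight q) = 0" for J .
  fix J :: "gen set" assume J: "finite J" "J \<subseteq> gens 2"
  show "lie_op (2, 2) F J = 0"
  proof (rule ccontr)
    assume nz: "lie_op (2, 2) F J \<noteq> 0"
    from lie_op_support[OF nz] obtain q where q: "q \<in> J" "gen_bracket (2, 2) q \<notin> J - {q}"
      "F (insert (gen_bracket (2, 2) q) (J - {q})) \<noteq> 0" by blast
    let ?b = "gen_bracket (2, 2) q" and ?K = "J - {q}"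
    have I: "insert ?b ?K \<in> rel_monomials 2 m w" "(\<Sum>p\<in>insert ?b ?K. torus_weight p) = 0"
      using supp'[OF q(3)] by auto
    obtain A a where Aa: "q = (A, a)" by (cases q)
    have b: "?b = (A, Suc a)" by (simp add: Aa)
    have f: "fst ?b = fst q" unfolding b Aa by simp
    note J' = rel_monomials_replace[OF J q(1,2) f I(1)]
    have 1: "(\<Sum>p\<in>J. torus_weight p) = - 2" using J'(2) I(2) by (simp add: b Aa)
    have "J \<in> rel_monomials 2 m w" by (rule J'(1))
    then obtain ps where "ps \<in> set (monomial_lists plane_gens m (nat w) (- 2))" "set ps = J"
      using rel_monomials_in_lists[OF _ w(2) 1] by blast
    then show False using e nz by blast
  qed
qed auto

section \<open>The period\<close>

definition period_value :: "(gen set \<Rightarrow> real) \<Rightarrow> real" where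
  "period_value F = eval_terms F period"

lemma period_valid:
  "list_all (\<lambda>(c, ps). valid_gens 2 ps \<and> valid_gens 1 ((1, 0) # (1, 1) # ps)) period"
  by (simp add: period_def valid_gens_def)

lemma on_list_omega_ext:
  assumes "set ps \<subseteq> gens 2"
  shows "on_list (omega_ext F) ((1, 0) # (1, 1) # ps) = on_list F ps"
  using on_list_cong[OF assms, of "contract (1, 1) (contract (1, 0) (omega_ext F))" F] contract_omega_ext
  by simp

lemma on_list_vanishing_on_gen:
  "(\<And>J. p \<in> J \<Longrightarrow> F J = 0) \<Longrightarrow> p \<in> set ps \<Longrightarrow> on_list F ps = 0"
proof (induction ps arbitrary: F)
  case (Cons q ps)
  show ?case
  proof (cases "q = p")
    case True
    have "contract q F = (\<lambda>J. 0 * F J + 0 * F J)"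
      using Cons.prems(1) True by (intro ext) (simp add: contract_def)
    then show ?thesis by (simp only: on_list.simps on_list_lin)
  next
    case False
    have "contract q F J = 0" if "p \<in> J" for J
      using Cons.prems(1)[of "insert q J"] that by (simp add: contract_def)
    then show ?thesis using Cons.IH[of "contract q F"] Cons.prems(2) False by simp
  qed
qed simp

text \<open>On \<open>(y, x, \<dots>)\<close> the form \<open>F \<and> \<omega>\<close> takes the values of \<open>F\<close>; so the period of \<open>F\<close> is a combination
of values of \<open>dU\<close>, and \<open>period_cycle\<close> writes it as a combination of values of Lie derivatives of
\<open>U\<close>, which are zero.\<close>

theorem period_of_coboundary:
  assumes U: "rel_form 1 6 8 U" and F: "rel_diff 1 U = omega_ext F"
  shows "period_value F = 0"
proof -
  let ?cls = "map (\<lambda>(c, ps). (c, Cls ((1, 0) # (1, 1) # ps))) period"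
  let ?inv = "map (\<lambda>(c, i, ps). (c, Inv i ps)) period_invariance"
  have "eval_terms U (combine 1 [] (?cls @ ?inv)) = 0"
  proof -
    let ?P = "\<lambda>(c, ps). list_all (\<lambda>p. fst p \<noteq> 2) ps"
    have "eval_terms U ts = eval_terms U (filter ?P ts)" for ts
    proof (induction ts)
      case (Cons t ts)
      obtain c ps where t: "t = (c, ps)" by fastforce
      have "on_list U ps = 0" if not_all: "\<not> list_all (\<lambda>p. fst p \<noteq> 2) ps"
      proof -
        obtain p where "p \<in> set ps" "fst p = 2" using not_all unfolding list_all_iff by blast
        then show ?thesis using rel_form_zero[OF U] by (intro on_list_vanishing_on_gen[of p]) auto
      qed
      then show ?case using Cons.IH by (simp add: t)
    qed simp
    then show ?thesis using eval_normal_form[of U] by (metis period_cycle eval_terms_simps(1))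
  qed
  moreover have "eval_terms U (combine 1 [] ?inv) = 0"
  proof -
    have inv: "eval_terms U (relation_terms 1 [] (Inv i ps)) = 0" for i ps
      using eval_lie_terms[OF U _ valid_gensD] by simp
    have "eval_terms U (combine 1 [] (map (\<lambda>(c, i, ps). (c, Inv i ps)) ts)) = 0" for ts
    proof (induction ts)
      case (Cons t ts)
      obtain c i ps where t: "t = (c, i, ps)" by (cases t) auto
      show ?case using Cons.IH inv[of i ps] by (simp only: t list.map prod.case combine.simps eval_terms_simps eval_scale)
    qed simp
    then show ?thesis .
  qed
  moreover have "eval_terms U (combine 1 [] (rs @ rs')) =
      eval_terms U (combine 1 [] rs) + eval_terms U (combine 1 [] rs')" for rs rs'
    by (simp add: eval_combine)
  ultimately have 0: "eval_terms U (combine 1 [] ?cls) = 0" by simp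
  have "eval_terms U (combine 1 [] (map (\<lambda>(c, ps). (c, Cls ((1, 0) # (1, 1) # ps))) ts)) = - eval_terms F ts"
    if "list_all (\<lambda>(c, ps). valid_gens 2 ps \<and> valid_gens 1 ((1, 0) # (1, 1) # ps)) ts" for ts
    using that
  proof (induction ts)
    case (Cons t ts)
    obtain c ps where t: "t = (c, ps)" by fastforce
    have v: "valid_gens 2 ps" "valid_gens 1 ((1, 0) # (1, 1) # ps)" using Cons.prems by (auto simp: t)
    have "eval_terms U (diff_terms ((1, 0) # (1, 1) # ps)) = - on_list (omega_ext F) ((1, 0) # (1, 1) # ps)"
      using eval_diff_terms[OF valid_gensD[OF v(2)], of U] F by simp
    also have "\<dots> = - on_list F ps" by (simp only: on_list_omega_ext[OF valid_gensD[OF v(1)]])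
    finally show ?case using Cons v by (simp add: t del: diff_terms.simps)
  qed simp
  from this[OF period_valid] 0 show ?thesis by (simp add: period_value_def)
qed

lemma period_value_lin: "period_value (\<lambda>J. a * F J + b * G J) = a * period_value F + b * period_value G"
  by (simp add: period_value_def eval_terms_lin)

lemma period_of_rel_diff:
  assumes "rel_form 2 4 10 V"
  shows "period_value (rel_diff 2 V) = 0"
proof (rule period_of_coboundary)
  show "rel_form 1 6 8 (omega_ext V)" using omega_ext_form[OF assms] by simp
  show "rel_diff 1 (omega_ext V) = omega_ext (rel_diff 2 V)" by (rule rel_diff_omega_ext[OF assms])
qed

section \<open>Cocycles of degree five\<close>

lemma card_set_lists:
  "card (set ` set (monomial_lists plane_gens m w h)) = length (monomial_lists plane_gens m w h)"
  using distinct_card[OF monomial_lists_distinct[OF plane_gens_sorted]] by (metis length_map list.set_map)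

lemma rel_diff_vanishes_degree_6:
  assumes "rel_form 2 5 10 F" "\<And>ps. ps \<in> set coordinates_6 \<Longrightarrow> on_list (rel_diff 2 F) ps = 0"
  shows "rel_diff 2 F = (\<lambda>J. 0)"
proof
  fix J
  have form: "rel_form 2 6 10 (rel_diff 2 F)" using rel_diff_form[OF _ _ assms(1)] by simp
  have closed: "rel_diff 2 (rel_diff 2 F) = (\<lambda>J. 0)" by (rule rel_diff_rel_diff) simp
  show "rel_diff 2 F J = 0"
    by (rule determined_by_coordinates[OF form closed _ _ _ assms(2) covers_6]) simp_all
qed

lemma card_tagged_le:
  "card (Pair (0::nat) ` set xs \<union> Pair 1 ` set ys \<union> Pair 2 ` set zs) \<le> length xs + length ys + length zs"
proof -
  have le: "card (Pair n ` set us) \<le> length us" for n :: nat and us :: "'b list"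
    by (rule order_trans[OF card_image_le card_length]) simp
  have "card (Pair (0::nat) ` set xs \<union> Pair 1 ` set ys \<union> Pair 2 ` set zs) \<le>
      card (Pair (0::nat) ` set xs) + card (Pair (1::nat) ` set ys) + card (Pair (2::nat) ` set zs)"
    using card_Un_le[of "Pair (0::nat) ` set xs" "Pair 1 ` set ys"]
      card_Un_le[of "Pair (0::nat) ` set xs \<union> Pair 1 ` set ys" "Pair 2 ` set zs"] by linarith
  also have "\<dots> \<le> length xs + length ys + length zs"
    by (intro add_mono le)
  finally show ?thesis .
qed

text \<open>The equations: 180 for invariance, 4 for the differential, and 7 coordinates. They leave a nonzero
solution among 192 unknowns.\<close>

theorem exists_cocycle_with_period:
  "\<exists>F. rel_form 2 5 10 F \<and> rel_diff 2 F = (\<lambda>J. 0) \<and> period_value F \<noteq> 0"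
proof -
  let ?S = "set ` set (monomial_lists plane_gens 5 10 0)"
  \<comment> \<open>the tags 0, 1, 2 distinguish the three kinds of equations\<close>
  let ?E = "Pair (0::nat) ` set (monomial_lists plane_gens 5 10 (- 2)) \<union> Pair 1 ` set coordinates_6 \<union> Pair 2 ` set coordinates_5"
  define l where "l = (\<lambda>(n::nat, ps) x. if n = 0 then lie_op (2, 2) x (set ps)
     else if n = 1 then on_list (rel_diff 2 x) ps else on_list x ps)"
  have lin: "l e (\<lambda>s. a * x s + b * y s) = a * l e x + b * l e y" for e a b x y
  proof (cases e)
    case (Pair n ps)
    show ?thesis
      unfolding Pair l_def prod.case lie_op_lin rel_diff_lin[abs_def] on_list_lin by simp
  qed
  have "card ?E \<le> length (monomial_lists plane_gens 5 10 (- 2)) + length coordinates_6 + length coordinates_5"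
    by (rule card_tagged_le)
  also have "\<dots> < card ?S" unfolding card_set_lists monomial_counts by (simp add: coordinates_6_def coordinates_5_def)
  finally have card: "card ?E < card ?S" .
  have "\<exists>F. (\<exists>s. F s \<noteq> 0) \<and> (\<forall>s. F s \<noteq> 0 \<longrightarrow> s \<in> ?S) \<and> (\<forall>e\<in>?E. l e F = 0)"
    by (rule nonzero_solution[OF lin _ _ card]) simp_all
  then obtain F where "(\<exists>s. F s \<noteq> 0) \<and> (\<forall>s. F s \<noteq> 0 \<longrightarrow> s \<in> ?S) \<and> (\<forall>e\<in>?E. l e F = 0)"
    by (rule exE)
  note F = this[THEN conjunct1] this[THEN conjunct2, THEN conjunct1, rule_format]
    this[THEN conjunct2, THEN conjunct2, THEN bspec]
  have form: "rel_form 2 5 10 F"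
  proof (rule highest_weight_in_lists)
    fix ps assume "ps \<in> set (monomial_lists plane_gens 5 (nat 10) (- 2))"
    then show "lie_op (2, 2) F (set ps) = 0" using F(3)[of "(0, ps)"] by (auto simp: l_def)
  qed (use F(2) in auto)
  have closed: "rel_diff 2 F = (\<lambda>J. 0)"
  proof (rule rel_diff_vanishes_degree_6[OF form])
    fix ps assume "ps \<in> set coordinates_6"
    then show "on_list (rel_diff 2 F) ps = 0" using F(3)[of "(1, ps)"] by (simp add: l_def)
  qed
  have "period_value F \<noteq> 0"
  proof
    assume "period_value F = 0"
    then have per: "eval_terms F period = 0" by (simp only: period_value_def)
    have coords: "on_list F ps = 0" if "ps \<in> set coordinates_5" for ps
      using F(3)[of "(2, ps)"] that by (simp add: l_def)
    have "F J = 0" for J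
      by (rule determined_by_coordinates[OF form closed per _ _ coords covers_5]) simp_all
    then show False using F(1) by blast
  qed
  then show ?thesis using form closed by blast
qed

text \<open>The unknowns are the 264 values of \<open>V\<close> and the factor \<open>t\<close>, which is stored at \<open>None\<close>.\<close>

theorem period_zero_imp_coboundary:
  assumes F: "rel_form 2 5 10 F" "rel_diff 2 F = (\<lambda>J. 0)" "period_value F = 0"
  shows "\<exists>V. rel_form 2 4 10 V \<and> F = rel_diff 2 V"
proof -
  let ?T = "set ` set (monomial_lists plane_gens 4 10 0)"
  let ?S = "insert None (Some ` ?T)"
  let ?E = "Pair (0::nat) ` set (monomial_lists plane_gens 4 10 (- 2)) \<union> Pair 1 ` set coordinates_4 \<union> Pair 2 ` set coordinates_5"
  define l where "l = (\<lambda>(n::nat, ps) x. if n = 0 then lie_op (2, 2) (\<lambda>J. x (Some J)) (set ps)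
     else if n = 1 then on_list (\<lambda>J. x (Some J)) ps else on_list (rel_diff 2 (\<lambda>J. x (Some J))) ps - x None * on_list F ps)"
  have lin: "l e (\<lambda>s. a * x s + b * y s) = a * l e x + b * l e y" for e a b x y
  proof (cases e)
    case (Pair n ps)
    show ?thesis
      unfolding Pair l_def prod.case lie_op_lin rel_diff_lin[abs_def] on_list_lin by (simp add: algebra_simps)
  qed
  have "card ?E \<le> length (monomial_lists plane_gens 4 10 (- 2)) + length coordinates_4 + length coordinates_5"
    by (rule card_tagged_le)
  also have "\<dots> < Suc (card ?T)" unfolding card_set_lists monomial_counts by (simp add: coordinates_4_def coordinates_5_def)
  also have "\<dots> = card ?S" by (subst card_insert_disjoint) (auto simp: card_image)
  finally have card: "card ?E < card ?S" .
  have "\<exists>x. (\<exists>s. x s \<noteq> 0) \<and> (\<forall>s. x s \<noteq> 0 \<longrightarrow> s \<in> ?S) \<and> (\<forall>e\<in>?E. l e x = 0)"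
    by (rule nonzero_solution[OF lin _ _ card]) simp_all
  then obtain x where "(\<exists>s. x s \<noteq> 0) \<and> (\<forall>s. x s \<noteq> 0 \<longrightarrow> s \<in> ?S) \<and> (\<forall>e\<in>?E. l e x = 0)"
    by (rule exE)
  note x = this[THEN conjunct1] this[THEN conjunct2, THEN conjunct1, rule_format]
    this[THEN conjunct2, THEN conjunct2, THEN bspec]
  define V where "V = (\<lambda>J. x (Some J))"
  define t where "t = x None"
  have form: "rel_form 2 4 10 V"
  proof (rule highest_weight_in_lists)
    fix ps assume "ps \<in> set (monomial_lists plane_gens 4 (nat 10) (- 2))"
    then show "lie_op (2, 2) V (set ps) = 0" using x(3)[of "(0, ps)"] by (auto simp: l_def V_def)
  next
    fix J assume "V J \<noteq> 0"
    then show "J \<in> set ` set (monomial_lists plane_gens 4 (nat 10) 0)" using x(2)[of "Some J"] by (auto simp: V_def)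
  qed auto
  have dV: "rel_form 2 5 10 (rel_diff 2 V)" using rel_diff_form[OF _ _ form] by simp
  \<comment> \<open>an invariant cocycle of period zero with seven vanishing coordinates, hence zero\<close>
  define G where "G = (\<lambda>J. 1 * rel_diff 2 V J + (- t) * F J)"
  have G: "rel_form 2 5 10 G" unfolding G_def by (rule rel_form_lin[OF dV F(1)])
  have Gd: "rel_diff 2 G = (\<lambda>J. 0)"
    unfolding G_def rel_diff_lin[abs_def] by (simp add: rel_diff_rel_diff F(2))
  have Gp: "eval_terms G period = 0"
    using period_value_lin[of 1 "rel_diff 2 V" "- t" F] period_of_rel_diff[OF form] F(3)
    by (simp add: G_def period_value_def)
  have coords: "on_list G ps = 0" if "ps \<in> set coordinates_5" for ps
  proof -
    have "l (2, ps) x = 0" by (rule x(3)) (use that in blast)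
    then show ?thesis unfolding G_def on_list_lin by (simp add: l_def V_def t_def)
  qed
  have "G J = 0" for J
    by (rule determined_by_coordinates[OF G Gd Gp _ _ coords covers_5]) simp_all
  then have eq: "rel_diff 2 V J = t * F J" for J by (simp add: G_def)
  have "t \<noteq> 0"
  proof
    assume t0: "t = 0"
    then have closed: "rel_diff 2 V = (\<lambda>J. 0)" using eq by auto
    have coords: "on_list V ps = 0" if "ps \<in> set coordinates_4" for ps
    proof -
      have "l (1, ps) x = 0" by (rule x(3)) (use that in blast)
      then show ?thesis by (simp add: l_def V_def)
    qed
    have "V J = 0" for J
      by (rule determined_by_coordinates[OF form closed _ _ _ coords covers_4]) simp_all
    then have "x s = 0" for s using t0 by (cases s) (auto simp: V_def t_def)
    then show False using x(1) by blast
  qed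
  have "rel_form 2 4 10 (\<lambda>J. (1 / t) * V J + 0 * V J)" by (rule rel_form_lin[OF form form])
  moreover have "F = rel_diff 2 (\<lambda>J. (1 / t) * V J + 0 * V J)"
    unfolding rel_diff_lin[abs_def] using eq \<open>t \<noteq> 0\<close> by auto
  ultimately show ?thesis by blast
qed

section \<open>Quotients\<close>

lemma mem_coset: "y \<in> coset B x \<longleftrightarrow> y - x \<in> B"
  unfolding coset_def by (auto simp: algebra_simps intro: exI[of _ "y - x"])

lemma coset_eq_iff:
  assumes "subspace B"
  shows "coset B x = coset B y \<longleftrightarrow> x - y \<in> B"
proof
  assume "coset B x = coset B y"
  then show "x - y \<in> B" using mem_coset[of x B x] mem_coset[of x B y] subspace_0[OF assms] by simp
next
  assume d: "x - y \<in> B"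
  have "z - x \<in> B \<longleftrightarrow> z - y \<in> B" for z
    using subspace_add[OF assms _ d, of "z - x"] subspace_diff[OF assms _ d, of "z - y"] by auto
  then show "coset B x = coset B y" by (auto simp: mem_coset)
qed

lemma quot_add_coset:
  assumes "subspace B"
  shows "quot_add (coset B x) (coset B y) = coset B (x + y)"
proof (intro set_eqI iffI)
  fix z assume "z \<in> quot_add (coset B x) (coset B y)"
  then obtain a b where "z = a + b" "a - x \<in> B" "b - y \<in> B" by (auto simp: quot_add_def mem_coset)
  then show "z \<in> coset B (x + y)"
    using subspace_add[OF assms, of "a - x" "b - y"] by (simp add: mem_coset algebra_simps)
next
  fix z assume "z \<in> coset B (x + y)"
  then have "x \<in> coset B x" "z - x \<in> coset B y" "z = x + (z - x)"
    using subspace_0[OF assms] by (auto simp: mem_coset algebra_simps)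
  then show "z \<in> quot_add (coset B x) (coset B y)" unfolding quot_add_def by blast
qed

lemma quot_scale_coset:
  assumes "subspace B"
  shows "quot_scale B c (coset B x) = coset B (c *\<^sub>R x)"
proof (intro set_eqI iffI)
  fix z assume "z \<in> quot_scale B c (coset B x)"
  then obtain a b where "z = c *\<^sub>R a + b" "a - x \<in> B" "b \<in> B" by (auto simp: quot_scale_def mem_coset)
  then show "z \<in> coset B (c *\<^sub>R x)"
    using subspace_add[OF assms subspace_scale[OF assms, of "a - x" c], of b]
    by (simp add: mem_coset algebra_simps)
next
  fix z assume "z \<in> coset B (c *\<^sub>R x)"
  then have "x \<in> coset B x" "z - c *\<^sub>R x \<in> B" "z = c *\<^sub>R x + (z - c *\<^sub>R x)"
    using subspace_0[OF assms] by (auto simp: mem_coset)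
  then show "z \<in> quot_scale B c (coset B x)" unfolding quot_scale_def by blast
qed

text \<open>A nonzero linear functional identifies the quotient by its kernel with \<open>\<real>\<close>.\<close>

lemma quot_isomorphic_realsI:
  assumes Z: "subspace Z" and "linear f" and f: "f z0 \<noteq> 0" "z0 \<in> Z" and B: "B = {z \<in> Z. f z = (0::real)}"
  shows "quot_isomorphic_reals Z B"
proof -
  interpret f: linear f by fact
  have mem_B: "z \<in> B \<longleftrightarrow> z \<in> Z \<and> f z = 0" for z using B by simp
  have sB: "subspace B"
    using Z unfolding B subspace_def by (auto simp: f.add f.scale f.zero)
  define g where "g = (\<lambda>X. f (SOME x. x \<in> X))"
  have g: "g (coset B z) = f z" for z
  proof -
    have "z \<in> coset B z" using subspace_0[OF sB] by (simp add: mem_coset)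
    then have "(SOME x. x \<in> coset B z) \<in> coset B z" by (rule someI)
    then have "f ((SOME x. x \<in> coset B z) - z) = 0" by (simp add: mem_coset mem_B)
    then show ?thesis by (simp add: g_def f.diff)
  qed
  have "bij_betw g (quot Z B) UNIV" unfolding bij_betw_def
  proof
    show "inj_on g (quot Z B)"
    proof (rule inj_onI)
      fix X Y assume "X \<in> quot Z B" "Y \<in> quot Z B" and eq: "g X = g Y"
      then obtain x y where xy: "X = coset B x" "x \<in> Z" "Y = coset B y" "y \<in> Z" by (auto simp: quot_def)
      then have "f x = f y" using eq by (simp add: g)
      then have "x - y \<in> B" using xy subspace_diff[OF Z] by (simp add: mem_B f.diff)
      then show "X = Y" using xy coset_eq_iff[OF sB] by simp
    qed
    have "c \<in> g ` quot Z B" for c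
    proof -
      have "g (coset B ((c / f z0) *\<^sub>R z0)) = c" using f by (simp add: g f.scale)
      moreover have "coset B ((c / f z0) *\<^sub>R z0) \<in> quot Z B"
        using subspace_scale[OF Z f(2)] by (auto simp: quot_def)
      ultimately show ?thesis by (metis image_eqI)
    qed
    then show "g ` quot Z B = UNIV" by auto
  qed
  moreover have "g (quot_add X Y) = g X + g Y" if "X \<in> quot Z B" "Y \<in> quot Z B" for X Y
    using that by (auto simp: quot_def quot_add_coset[OF sB] g f.add)
  moreover have "g (quot_scale B c X) = c * g X" if "X \<in> quot Z B" for c X
    using that by (auto simp: quot_def quot_scale_coset[OF sB] g f.scale)
  ultimately show ?thesis unfolding quot_isomorphic_reals_def by blast
qed

section \<open>Cocycles and coboundaries\<close>

lemma rel_cochain_keys: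
  assumes "u \<in> rel_cochains k m w" "I \<in> supp u"
  shows "finite I \<and> I \<subseteq> gens k"
  using assms by (auto simp: rel_cochains_def monomials_def)

lemma vals_ce_diff_rel: "1 \<le> k \<Longrightarrow> u \<in> rel_cochains k m w \<Longrightarrow> vals (ce_diff k u) = rel_diff k (vals u)"
  by (intro vals_ce_diff_eq) (auto dest: rel_cochain_keys)

lemma vals_eq_iff: "vals u = vals v \<longleftrightarrow> u = v"
  by (metis cochain_eqI)

lemma rel_cocycles_iff:
  assumes "1 \<le> k"
  shows "u \<in> rel_cocycles k m w \<longleftrightarrow> rel_form k m w (vals u) \<and> rel_diff k (vals u) = (\<lambda>J. 0)"
proof -
  have "ce_diff k u = 0 \<longleftrightarrow> rel_diff k (vals u) = (\<lambda>J. 0)" if "u \<in> rel_cochains k m w"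
    using vals_ce_diff_rel[OF assms that] vals_eq_iff[of "ce_diff k u" 0] by auto
  then show ?thesis unfolding rel_cocycles_def using rel_cochains_iff[OF assms] by auto
qed

lemma rel_coboundaries_iff:
  assumes "1 \<le> k"
  shows "u \<in> rel_coboundaries k (Suc m) w \<longleftrightarrow> (\<exists>V. rel_form k m w V \<and> vals u = rel_diff k V)"
proof
  assume "u \<in> rel_coboundaries k (Suc m) w"
  then obtain v where v: "v \<in> rel_cochains k m w" "u = ce_diff k v" by (auto simp: rel_coboundaries_def)
  then show "\<exists>V. rel_form k m w V \<and> vals u = rel_diff k V"
    using vals_ce_diff_rel[OF assms v(1)] rel_cochains_iff[OF assms] by blast
next
  assume "\<exists>V. rel_form k m w V \<and> vals u = rel_diff k V"
  then obtain V where V: "rel_form k m w V" "vals u = rel_diff k V" by blast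
  have vals: "vals (of_vals V) = V" by (rule vals_of_vals[OF rel_form_finite[OF V(1)]])
  then have mem: "of_vals V \<in> rel_cochains k m w" using V(1) rel_cochains_iff[OF assms] by simp
  then have "vals u = vals (ce_diff k (of_vals V))" using V(2) vals_ce_diff_rel[OF assms mem] vals by simp
  then show "u \<in> rel_coboundaries k (Suc m) w"
    using mem by (auto simp: rel_coboundaries_def vals_eq_iff)
qed

lemma vals_add: "vals (u + v) = (\<lambda>J. 1 * vals u J + 1 * vals v J)"
  and vals_scaleR: "vals (c *\<^sub>R u) = (\<lambda>J. c * vals u J + 0 * vals u J)"
  using vals_lin[of 1 u 1 v] vals_lin[of c u 0 u] by auto

lemma subspace_rel_cocycles:
  assumes "1 \<le> k"
  shows "subspace (rel_cocycles k m w)"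
proof -
  have "0 \<in> rel_cocycles k m w"
  proof -
    have z: "rel_diff k (\<lambda>J. 0) = (\<lambda>J. 0)" and f: "rel_form k m w (\<lambda>J. 0)"
      using rel_diff_lin[of k 0 "\<lambda>J. 0" 0 "\<lambda>J. 0"] lie_op_lin[of _ 0 "\<lambda>J. 0" 0 "\<lambda>J. 0"]
      by (auto simp: rel_form_def)
    have "vals 0 = (\<lambda>J. 0)" by auto
    then show ?thesis unfolding rel_cocycles_iff[OF assms] using z f by simp
  qed
  moreover have "u + v \<in> rel_cocycles k m w" if "u \<in> rel_cocycles k m w" "v \<in> rel_cocycles k m w" for u v
    using that unfolding rel_cocycles_iff[OF assms] vals_add
    by (simp only: rel_form_lin rel_diff_lin[abs_def]) simp
  moreover have "c *\<^sub>R u \<in> rel_cocycles k m w" if "u \<in> rel_cocycles k m w" for c u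
    using that unfolding rel_cocycles_iff[OF assms] vals_scaleR
    by (simp only: rel_form_lin rel_diff_lin[abs_def]) simp
  ultimately show ?thesis unfolding subspace_def by blast
qed

lemma subspace_rel_coboundaries:
  assumes "1 \<le> k"
  shows "subspace (rel_coboundaries k (Suc m) w)"
proof -
  have sp: "vals u = rel_diff k V \<Longrightarrow> rel_form k m w V \<Longrightarrow> u \<in> rel_coboundaries k (Suc m) w" for u V
    using rel_coboundaries_iff[OF assms] by blast
  have zero: "rel_diff k (\<lambda>J. 0) = (\<lambda>J. 0)" "rel_form k m w (\<lambda>J. 0)"
    using rel_diff_lin[of k 0 "\<lambda>J. 0" 0 "\<lambda>J. 0"] lie_op_lin[of _ 0 "\<lambda>J. 0" 0 "\<lambda>J. 0"]
    by (auto simp: rel_form_def)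
  have "vals 0 = rel_diff k (\<lambda>J. 0)" using zero by auto
  from sp[OF this zero(2)] have "0 \<in> rel_coboundaries k (Suc m) w" .
  moreover have "u + v \<in> rel_coboundaries k (Suc m) w"
    if uv: "u \<in> rel_coboundaries k (Suc m) w" "v \<in> rel_coboundaries k (Suc m) w" for u v
  proof -
    obtain U V where UV: "rel_form k m w U" "vals u = rel_diff k U" "rel_form k m w V" "vals v = rel_diff k V"
      using uv rel_coboundaries_iff[OF assms] by blast
    have "vals (u + v) = rel_diff k (\<lambda>J. 1 * U J + 1 * V J)"
      unfolding vals_add UV rel_diff_lin[abs_def] ..
    then show ?thesis using rel_form_lin[OF UV(1,3)] sp by blast
  qed
  moreover have "c *\<^sub>R u \<in> rel_coboundaries k (Suc m) w" if u: "u \<in> rel_coboundaries k (Suc m) w" for c u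
  proof -
    obtain U where U: "rel_form k m w U" "vals u = rel_diff k U"
      using u rel_coboundaries_iff[OF assms] by blast
    have "vals (c *\<^sub>R u) = rel_diff k (\<lambda>J. c * U J + 0 * U J)"
      unfolding vals_scaleR U rel_diff_lin[abs_def] ..
    then show ?thesis using rel_form_lin[OF U(1) U(1)] sp by blast
  qed
  ultimately show ?thesis unfolding subspace_def by blast
qed

section \<open>The class as a product with \<omega>\<close>

text \<open>The union over all representatives is a single coset, since \<open>B\<close> is sent to coboundaries.\<close>

lemma wedge_omega_coset:
  assumes B: "subspace B" "\<And>b. b \<in> B \<Longrightarrow> wedge b omega \<in> rel_coboundaries 1 (m + 2) (w - 2)"
    and add: "\<And>b. b \<in> B \<Longrightarrow> wedge (x + b) omega = wedge x omega + wedge b omega"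
    and B': "subspace (rel_coboundaries 1 (m + 2) (w - 2))"
  shows "wedge_omega m w (coset B x) = coset (rel_coboundaries 1 (m + 2) (w - 2)) (wedge x omega)"
proof -
  have "coset (rel_coboundaries 1 (m + 2) (w - 2)) (wedge y omega) =
      coset (rel_coboundaries 1 (m + 2) (w - 2)) (wedge x omega)" if y: "y \<in> coset B x" for y
  proof -
    obtain b where b: "b \<in> B" "y = x + b" using y by (auto simp: coset_def)
    have "wedge y omega - wedge x omega \<in> rel_coboundaries 1 (m + 2) (w - 2)"
      unfolding b(2) add[OF b(1)] add_diff_cancel_left' by (rule B(2)[OF b(1)])
    then show ?thesis unfolding coset_eq_iff[OF B'] .
  qed
  moreover have "x \<in> coset B x" using subspace_0[OF B(1)] by (simp add: mem_coset)
  ultimately show ?thesis unfolding wedge_omega_def by blast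
qed

theorem theorem1p1:
  shows "quot_isomorphic_reals (rel_cocycles 2 5 10) (rel_coboundaries 2 5 10) \<and>
    (\<forall>\<gamma>. quot_generator (rel_cocycles 1 7 8) (rel_coboundaries 1 7 8) \<gamma> \<longrightarrow>
       (\<exists>!\<eta>. \<eta> \<in> cohomology 2 5 10 \<and> \<gamma> = wedge_omega 5 10 \<eta>))"
proof -
  let ?Z = "rel_cocycles 2 5 10" and ?B = "rel_coboundaries 2 5 10"
  let ?Z' = "rel_cocycles 1 7 8" and ?B' = "rel_coboundaries 1 7 8"
  define per where "per = (\<lambda>u. period_value (vals u))"
  have sZ: "subspace ?Z" by (rule subspace_rel_cocycles) simp
  have sB: "subspace ?B" using subspace_rel_coboundaries[of 2 4 10] by simp
  have sB': "subspace ?B'" using subspace_rel_coboundaries[of 1 6 8] by simp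
  have lin: "linear per"
    by (rule linearI) (simp_all add: per_def vals_add vals_scaleR period_value_lin del: mult_zero_left mult_1 add_0_right)
  interpret per: linear per by fact
  have Z: "u \<in> ?Z \<longleftrightarrow> rel_form 2 5 10 (vals u) \<and> rel_diff 2 (vals u) = (\<lambda>J. 0)" for u
    by (rule rel_cocycles_iff) simp
  have B0: "u \<in> ?B \<longleftrightarrow> (\<exists>V. rel_form 2 4 10 V \<and> vals u = rel_diff 2 V)" for u
    using rel_coboundaries_iff[of 2 u 4 10] by simp
  have B: "?B = {u \<in> ?Z. per u = 0}"
  proof (intro set_eqI iffI)
    fix u assume "u \<in> ?B"
    then obtain V where V: "rel_form 2 4 10 V" "vals u = rel_diff 2 V" using B0 by blast
    then show "u \<in> {u \<in> ?Z. per u = 0}"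
      using rel_diff_form[OF _ _ V(1)] period_of_rel_diff[OF V(1)] by (simp add: Z per_def rel_diff_rel_diff)
  next
    fix u assume "u \<in> {u \<in> ?Z. per u = 0}"
    then show "u \<in> ?B" using period_zero_imp_coboundary[of "vals u"] by (auto simp: Z B0 per_def)
  qed
  obtain F where F: "rel_form 2 5 10 F" "rel_diff 2 F = (\<lambda>J. 0)" "period_value F \<noteq> 0"
    using exists_cocycle_with_period by blast
  define e where "e = of_vals F"
  have "vals e = F" unfolding e_def by (rule vals_of_vals[OF rel_form_finite[OF F(1)]])
  then have e: "e \<in> ?Z" "per e \<noteq> 0" using F by (auto simp: Z per_def)
  have keys: "finite I \<and> I \<subseteq> gens 2" if "u \<in> ?Z" "I \<in> supp u" for u I
    using that rel_cochain_keys[of u 2 5 10 I] by (simp add: rel_cocycles_def)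
  have vw: "vals (wedge u omega) = omega_ext (vals u)" if "u \<in> ?Z" for u
    by (rule vals_wedge_omega[OF keys[OF that]])
  have w_add: "wedge (u + v) omega = wedge u omega + wedge v omega" if "u \<in> ?Z" "v \<in> ?Z" for u v
    using that subspace_add[OF sZ that]
    by (intro cochain_eqI) (simp only: vw vals_add omega_ext_lin)
  have w_scale: "wedge (c *\<^sub>R u) omega = c *\<^sub>R wedge u omega" if "u \<in> ?Z" for c u
    using that subspace_scale[OF sZ that, of c]
    by (intro cochain_eqI) (simp only: vw vals_scaleR omega_ext_lin)
  have w_Z: "wedge u omega \<in> ?Z'" if "u \<in> ?Z" for u
  proof -
    have u: "rel_form 2 5 10 (vals u)" "rel_diff 2 (vals u) = (\<lambda>J. 0)" using that Z by auto
    have "rel_form 1 7 8 (omega_ext (vals u))" using omega_ext_form[OF u(1)] by simp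
    moreover have "rel_diff 1 (omega_ext (vals u)) = (\<lambda>J. 0)"
      unfolding rel_diff_omega_ext[OF u(1)] u(2) by (auto simp: omega_ext_def)
    ultimately show ?thesis using vw[OF that] by (subst rel_cocycles_iff) auto
  qed
  \<comment> \<open>the product with \<omega> is well defined and injective on cohomology\<close>
  have w_B: "wedge u omega \<in> ?B' \<longleftrightarrow> u \<in> ?B" if u: "u \<in> ?Z" for u
  proof
    assume "wedge u omega \<in> ?B'"
    then obtain U where "rel_form 1 6 8 U" "vals (wedge u omega) = rel_diff 1 U"
      using rel_coboundaries_iff[of 1 "wedge u omega" 6 8] by auto
    then have "per u = 0" unfolding per_def using vw[OF u] by (intro period_of_coboundary) auto
    then show "u \<in> ?B" using u B by blast
  next
    assume "u \<in> ?B"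
    then obtain V where V: "rel_form 2 4 10 V" "vals u = rel_diff 2 V" using B0 by blast
    have "rel_form 1 6 8 (omega_ext V)" using omega_ext_form[OF V(1)] by simp
    moreover have "vals (wedge u omega) = rel_diff 1 (omega_ext V)"
      unfolding vw[OF u] V(2) rel_diff_omega_ext[OF V(1)] ..
    ultimately show "wedge u omega \<in> ?B'" using rel_coboundaries_iff[of 1 "wedge u omega" 6 8] by auto
  qed
  have w_coset: "wedge_omega 5 10 (coset ?B x) = coset ?B' (wedge x omega)" if "x \<in> ?Z" for x
    using wedge_omega_coset[of ?B 5 10 x] that sB sB' w_B w_add B by auto
  have "quot_isomorphic_reals ?Z ?B"
    by (rule quot_isomorphic_realsI[OF sZ lin e(2,1) B])
  moreover have "\<exists>!\<eta>. \<eta> \<in> cohomology 2 5 10 \<and> \<gamma> = wedge_omega 5 10 \<eta>"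
    if gen: "quot_generator ?Z' ?B' \<gamma>" for \<gamma>
  proof -
    obtain g where g: "\<gamma> = coset ?B' g" using gen by (auto simp: quot_generator_def quot_def)
    have "coset ?B' (wedge e omega) \<in> quot ?Z' ?B'" using w_Z[OF e(1)] by (auto simp: quot_def)
    then obtain c where c: "coset ?B' (wedge e omega) = coset ?B' (c *\<^sub>R g)"
      using gen quot_scale_coset[OF sB'] g by (metis quot_generator_def)
    have "c \<noteq> 0"
    proof
      assume "c = 0"
      then have "wedge e omega \<in> ?B'" using c coset_eq_iff[OF sB', of "wedge e omega" 0] by simp
      then show False using w_B[OF e(1)] e(2) B by blast
    qed
    define x where "x = (1 / c) *\<^sub>R e"
    have x: "x \<in> ?Z" unfolding x_def by (rule subspace_scale[OF sZ e(1)])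
    have "wedge e omega - c *\<^sub>R g \<in> ?B'" using c coset_eq_iff[OF sB'] by blast
    then have "(1 / c) *\<^sub>R (wedge e omega - c *\<^sub>R g) \<in> ?B'" by (rule subspace_scale[OF sB'])
    then have "wedge x omega - g \<in> ?B'"
      unfolding x_def w_scale[OF e(1)] using \<open>c \<noteq> 0\<close> by (simp add: scaleR_diff_right)
    then have \<gamma>: "\<gamma> = coset ?B' (wedge x omega)" using coset_eq_iff[OF sB'] g by metis
    show ?thesis
    proof (intro ex1I[of _ "coset ?B x"] conjI)
      show "coset ?B x \<in> cohomology 2 5 10" using x by (auto simp: cohomology_def quot_def)
      show "\<gamma> = wedge_omega 5 10 (coset ?B x)" using \<gamma> w_coset[OF x] by simp
    next
      fix \<eta> assume \<eta>: "\<eta> \<in> cohomology 2 5 10 \<and> \<gamma> = wedge_omega 5 10 \<eta>"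
      then obtain y where y: "y \<in> ?Z" "\<eta> = coset ?B y" by (auto simp: cohomology_def quot_def)
      have "wedge y omega - wedge x omega \<in> ?B'"
        using \<eta> y w_coset \<gamma> coset_eq_iff[OF sB'] by metis
      moreover have "wedge y omega - wedge x omega = wedge (y - x) omega"
        using w_add[OF subspace_diff[OF sZ y(1) x] x] by simp
      ultimately have "y - x \<in> ?B" using w_B[OF subspace_diff[OF sZ y(1) x]] by simp
      then show "\<eta> = coset ?B x" using y coset_eq_iff[OF sB] by blast
    qed
  qed
  ultimately show ?thesis by blast
qed

end
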